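(* Let the frequency $\omega_0>0$ be fixed, and consider the periodic Schrödinger operator $-\frac{d^2}{dx^2}+q(x)$ with $q(x)=Av(x)$, where $v$ is a real-valued piecewise $C^\infty$ function with $v(x+L)=v(x)$ (in part d) $v$ is instead the periodic combination of delta functions given there), and $A\to\infty$. Then: a) if $v\in C^\infty$ on $(0,L)$ and $v(x)\ge c>0$, then $\omega_0$ belongs to a gap when $A$ is large enough; b) if $v\in C^\infty$ on $(0,L)$, $v(x)\le -c<0$, and $\omega_0$ is a degenerate band edge, then $V_g(\omega_0)\to\infty$ as $A\to\infty$ (along the values of $A$ for which $\omega_0$ is a degenerate band edge); c) if $v\in C^\infty$ on $(0,a)$ and on $(a,L)$, $0<a<L$, and $v(x)\ge c>0$ on one of these intervals, $v(x)\le -c<0$ on the other one, then $\omega_0$ is not a degenerate band edge when $A$ is large enough; d) if $$q(x)=A\sum_{n=-\infty}^{\infty}\bigl[\delta(x-(2n+1)l)-\delta(x-2nl)\bigr],\qquad l=L/2,$$ then the points $\omega_n=\frac{n\pi}{l}$, $n\ge1$, are degenerate band edges, and, for frequencies $\omega$ in a neighborhood of a fixed $\omega_n$, $V_g(\omega)=O(A^{-1})$ when $A\to\infty$ and $A|\sin\omega l|<1$.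
   Context: Here $c>0$ is a constant, $\delta$ is the Dirac delta function, and "piecewise $C^\infty$" is meant in the usual sense (all derivatives have one-sided limits at the break points, including the ends of the period). Monodromy matrix: let $\psi_1,\psi_2$ solve $-\psi''+q\psi=\omega^2\psi$ with Cauchy data $\psi_1=1,\ \psi_1'=0$ and $\psi_2=0,\ \psi_2'=1$ at $x=0$ (at $x=0^-$, the limit from the left, when $q$ has a delta function at $0$). Then $$M_\omega=\begin{bmatrix}\psi_1&\omega\psi_2\\ \psi_1'/\omega&\psi_2'\end{bmatrix}\Big|_{x=L}$$ (at $x=L^-$ in the delta function case), and $F(\omega)=\frac12\operatorname{Tr}M_\omega$. The eigenvalues of $M_\omega$ are $e^{\pm ik(\omega)}$, so $\cos k(\omega)=F(\omega)$, where the dispersion relation $k(\omega)$ is analytic with $\operatorname{Im}k(\omega)>0$ for $\operatorname{Im}\omega>0$, and for real $\omega\ge0$ it is defined by continuity from the upper half plane. The group velocity, considered for $\omega$ in the bands, is $V_g(\omega)=L/k'(\omega)$. On the frequency axis $\omega\ge0$ (energy $\lambda=\omega^2$; only positive energies are considered) the bands are the intervals $b_n=[\omega_{2n-1},\omega_{2n}]$ forming the set $\{|F(\omega)|\le1\}$, and $\{|F(\omega)|>1\}$ is the union of the gaps. A band edge is degenerate if it belongs to the boundary of two different bands (equivalently $F=\pm1$ and $F'=0$ there), and non-degenerate if it belongs to the boundary of a band and of a gap. (The symbol $\omega_n$ in part d) denotes $n\pi/l$, not these band endpoints.) All these objects depend on $A$.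
   Formalization: The dispersion relation k is required to be analytic with Im k > 0 only for Re ω > 0, Im ω > 0, not on the whole upper half plane, since in b) and d) negative-energy bands (imaginary ω) make k impossible there; V_g is unchanged wherever the original k exists. *)

theory Defs
  imports "HOL-Complex_Analysis.Complex_Analysis"
begin

text \<open>Smoothness on an open interval, all derivatives having one-sided limits at its ends.\<close>

definition smooth_piece :: "real \<Rightarrow> real \<Rightarrow> (real \<Rightarrow> real) \<Rightarrow> bool" where
  "smooth_piece a b v \<longleftrightarrow>
     (\<forall>n. (deriv ^^ n) v differentiable_on {a<..<b} \<and>
          (\<exists>y. ((deriv ^^ n) v \<longlongrightarrow> y) (at_right a)) \<and>
          (\<exists>y. ((deriv ^^ n) v \<longlongrightarrow> y) (at_left b)))"

text \<open>
  A potential is a regular part \<open>q\<close> plus point masses: \<open>m x\<close> is the coefficient of the delta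
  function at \<open>x\<close>. A solution of \<open>- \<psi>'' + (q + \<Sum> m(y) \<delta>(x - y)) \<psi> = E \<psi>\<close> over one period is a
  pair \<open>\<psi>, \<phi>\<close>, where \<open>\<phi> x\<close> is the left derivative of \<open>\<psi>\<close> at \<open>x\<close>: \<open>\<psi>\<close> is continuous and \<open>\<phi>\<close>
  jumps by \<open>m x * \<psi> x\<close> at \<open>x\<close>. In particular \<open>\<phi> 0\<close> and \<open>\<phi> L\<close> are the derivatives at
  \<open>0-\<close> and \<open>L-\<close>, a mass at \<open>0\<close> is counted and one at \<open>L\<close> is not. For \<open>m = 0\<close>, \<open>\<psi>\<close> is an
  ordinary continuously differentiable solution with \<open>\<phi> = \<psi>'\<close>. The set \<open>S\<close> contains the break
  points.
\<close>

definition schroedinger_solution ::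
    "(real \<Rightarrow> real) \<Rightarrow> (real \<Rightarrow> real) \<Rightarrow> real \<Rightarrow> complex \<Rightarrow>
     (real \<Rightarrow> complex) \<Rightarrow> (real \<Rightarrow> complex) \<Rightarrow> bool" where
  "schroedinger_solution q m L E \<psi> \<phi> \<longleftrightarrow>
     continuous_on {0..L} \<psi> \<and>
     (\<forall>x\<in>{0<..L}. (\<phi> \<longlongrightarrow> \<phi> x) (at_left x)) \<and>
     (\<forall>x\<in>{0..<L}. (\<phi> \<longlongrightarrow> \<phi> x + complex_of_real (m x) * \<psi> x) (at_right x)) \<and>
     (\<exists>S. finite S \<and> (\<forall>x\<in>{0<..<L} - S.
        (\<psi> has_vector_derivative \<phi> x) (at x) \<and>
        (\<phi> has_vector_derivative (complex_of_real (q x) - E) * \<psi> x) (at x)))"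

definition cauchy_solution ::
    "(real \<Rightarrow> real) \<Rightarrow> (real \<Rightarrow> real) \<Rightarrow> real \<Rightarrow> complex \<Rightarrow> complex \<Rightarrow> complex \<Rightarrow>
     (real \<Rightarrow> complex) \<times> (real \<Rightarrow> complex)" where
  "cauchy_solution q m L E a b =
     (SOME s. schroedinger_solution q m L E (fst s) (snd s) \<and> fst s 0 = a \<and> snd s 0 = b)"

definition monodromy_matrix ::
    "(real \<Rightarrow> real) \<Rightarrow> (real \<Rightarrow> real) \<Rightarrow> real \<Rightarrow> complex \<Rightarrow> complex ^ 2 ^ 2" where
  "monodromy_matrix q m L \<omega> =
     (let (\<psi>1, \<phi>1) = cauchy_solution q m L (\<omega>\<^sup>2) 1 0;
          (\<psi>2, \<phi>2) = cauchy_solution q m L (\<omega>\<^sup>2) 0 1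
      in vector [vector [\<psi>1 L, \<omega> * \<psi>2 L],
                 vector [\<phi>1 L / \<omega>, \<phi>2 L]])"

definition half_trace ::
    "(real \<Rightarrow> real) \<Rightarrow> (real \<Rightarrow> real) \<Rightarrow> real \<Rightarrow> complex \<Rightarrow> complex" where
  "half_trace q m L \<omega> = trace (monodromy_matrix q m L \<omega>) / 2"

text \<open>
  Neighbouring bands may touch at a point where \<open>F = \<plusminus>1\<close>, so the bands are not the components of
  \<open>{|F| \<le> 1}\<close>; they are the closures of the components of \<open>{|F| < 1}\<close>.
\<close>

definition is_band :: "(complex \<Rightarrow> complex) \<Rightarrow> real set \<Rightarrow> bool" where
  "is_band F B \<longleftrightarrow> (\<exists>C\<in>components {x. 0 \<le> x \<and> cmod (F (complex_of_real x)) < 1}. B = closure C)"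

definition is_gap :: "(complex \<Rightarrow> complex) \<Rightarrow> real set \<Rightarrow> bool" where
  "is_gap F G \<longleftrightarrow> G \<in> components {x. 0 \<le> x \<and> cmod (F (complex_of_real x)) > 1}"

definition in_band :: "(complex \<Rightarrow> complex) \<Rightarrow> real \<Rightarrow> bool" where
  "in_band F \<omega> \<longleftrightarrow> (\<exists>B. is_band F B \<and> \<omega> \<in> B)"

definition in_gap :: "(complex \<Rightarrow> complex) \<Rightarrow> real \<Rightarrow> bool" where
  "in_gap F \<omega> \<longleftrightarrow> (\<exists>G. is_gap F G \<and> \<omega> \<in> G)"

definition degenerate_band_edge :: "(complex \<Rightarrow> complex) \<Rightarrow> real \<Rightarrow> bool" where
  "degenerate_band_edge F \<omega> \<longleftrightarrow>
     (\<exists>B B'. is_band F B \<and> is_band F B' \<and> B \<noteq> B' \<and> \<omega> \<in> frontier B \<and> \<omega> \<in> frontier B')"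

definition nondegenerate_band_edge :: "(complex \<Rightarrow> complex) \<Rightarrow> real \<Rightarrow> bool" where
  "nondegenerate_band_edge F \<omega> \<longleftrightarrow>
     (\<exists>B G. is_band F B \<and> is_gap F G \<and> \<omega> \<in> frontier B \<and> \<omega> \<in> frontier G)"

text \<open>
  The dispersion relation is taken on the open first quadrant, which \<open>\<omega> \<mapsto> \<omega>\<^sup>2\<close> maps onto the upper
  half plane of energies, and extended to the positive semi-axis by continuity. The imaginary axis,
  that is, the negative energies, has to be left out: if there are bands there (as for negative
  \<open>q\<close>), then \<open>F\<close> takes values in \<open>[-1, 1]\<close> on it, and \<open>Im k > 0\<close> is impossible.
\<close>

definition dispersion_relation :: "(complex \<Rightarrow> complex) \<Rightarrow> (complex \<Rightarrow> complex) \<Rightarrow> bool" where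
  "dispersion_relation F k \<longleftrightarrow>
     (let Q = {\<omega>. 0 < Re \<omega> \<and> 0 < Im \<omega>} in
       k holomorphic_on Q \<and>
       (\<forall>\<omega>\<in>Q. 0 < Im (k \<omega>) \<and> cos (k \<omega>) = F \<omega>) \<and>
       (\<forall>x\<ge>0. (k \<longlongrightarrow> k (complex_of_real x)) (at (complex_of_real x) within Q)))"

text \<open>
  On \<open>Q\<close> and the positive semi-axis \<open>k\<close> is unique up to an additive multiple of \<open>2\<pi>\<close>, so the choice
  does not affect its derivative.
\<close>

definition dispersion :: "(complex \<Rightarrow> complex) \<Rightarrow> real \<Rightarrow> complex" where
  "dispersion F x = (SOME k. dispersion_relation F k) (complex_of_real x)"

text \<open>At a non-degenerate band edge \<open>k'\<close> is infinite and \<open>L / k' = 0\<close>.\<close>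

definition group_velocity :: "real \<Rightarrow> (complex \<Rightarrow> complex) \<Rightarrow> real \<Rightarrow> real" where
  "group_velocity L F \<omega> =
     (if nondegenerate_band_edge F \<omega> then 0
      else L / Re (vector_derivative (dispersion F) (at \<omega>)))"

text \<open>The quotient \<open>L / k'\<close> makes sense: \<open>k'\<close> exists, is real and does not vanish.\<close>

definition finite_group_velocity :: "(complex \<Rightarrow> complex) \<Rightarrow> real \<Rightarrow> bool" where
  "finite_group_velocity F \<omega> \<longleftrightarrow>
     (\<exists>D::real. D \<noteq> 0 \<and> (dispersion F has_vector_derivative complex_of_real D) (at \<omega>))"

text \<open>Coefficients of \<open>A \<Sum>n. \<delta>(x - (2n+1)l) - \<delta>(x - 2nl)\<close>.\<close>

definition delta_comb :: "real \<Rightarrow> real \<Rightarrow> real \<Rightarrow> real" where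
  "delta_comb l A x =
     A * (indicator (range (\<lambda>n::int. (2 * of_int n + 1) * l)) x
        - indicator (range (\<lambda>n::int. 2 * of_int n * l)) x)"

end

theory Submission
  imports Defs
begin

text \<open>
  Everything rests on the Lagrange identity \<open>(E - E') \<integral> \<psi> \<psi>' = [\<psi> \<phi>' - \<phi> \<psi>']\<close> for solutions at the
  energies \<open>E\<close> and \<open>E'\<close>. Applied to the fundamental solutions it expresses the monodromy matrix at
  \<open>E'\<close> through the one at \<open>E\<close> and the integrals \<open>I\<^sub>i\<^sub>j = \<integral> \<psi>\<^sub>i(E) \<psi>\<^sub>j(E')\<close>. Hence \<open>F\<close> is entire; a zero of
  \<open>F'\<close> at a point with \<open>F = \<sigma> = \<plusminus>1\<close> forces \<open>M = \<sigma> I\<close>; and in that case, because \<open>det M = 1\<close>, one has exactly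
  \<open>F(E') = \<sigma> (1 - (E - E')\<^sup>2 (I\<^sub>1\<^sub>1 I\<^sub>2\<^sub>2 - I\<^sub>1\<^sub>2 I\<^sub>2\<^sub>1) / 2)\<close>. So at a degenerate edge \<open>k'\<close> is \<open>2 \<omega>\<close> times the
  square root of the Gram determinant of \<open>\<psi>\<^sub>1, \<psi>\<^sub>2\<close>, the sign being fixed by \<open>Im k > 0\<close>.

  Where \<open>q = e - p\<close> with \<open>p\<close> of order \<open>A\<close>, the energy \<open>\<phi>\<^sup>2 / p + \<psi>\<^sup>2\<close> changes at most by a factor independent
  of \<open>A\<close>. This makes the Gram determinant \<open>O(1/A)\<close> in part b). Where \<open>q \<ge> e + \<kappa>\<close>, a solution with
  \<open>\<psi> = 1, \<psi>' = 0\<close> at the left end has \<open>\<psi>\<^sup>2 \<ge> 1 + \<kappa> x\<^sup>2\<close>, which gives \<open>F > 1\<close> in part a) and, together with the energy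
  bound on the other interval, excludes \<open>M = \<plusminus>I\<close> in part c). In part d) the explicit solutions give
  \<open>F = 1 - (2 + A\<^sup>2 / (2 \<omega>\<^sup>2)) sin\<^sup>2 (\<omega> l)\<close>.
\<close>

section \<open>Solutions and the Lagrange identity\<close>

text \<open>Two objects of the statement are chosen, not constructed: \<open>half_trace\<close>
  through a choice of Cauchy solutions and \<open>dispersion\<close> through a choice of
  \<open>k\<close>. Both must be shown to exist before any value of them can be used, and uniqueness
  of the Cauchy problem is what makes the trace computable. The Lagrange identity serves uniqueness,
  dependence on the energy and self-adjointness alike, and it does not see point masses, so one
  locale covers smooth potentials and the delta comb. The obstacle for the velocity is that sin k =
  0 at a degenerate edge, so cos k = F cannot be differentiated implicitly there, while
  \<open>k\<close> is known on the axis only as a boundary value from the quadrant. The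
  factorisation of \<open>F\<close> at the edge is therefore needed for complex frequencies and not
  just along the axis: only off the axis does Im k > 0 select the branch of the square root.\<close>

lemma deriv_nonneg_imp_le:
  fixes f :: "real \<Rightarrow> real"
  assumes "a \<le> b" "continuous_on {a..b} f" "finite S"
    and D: "\<And>x. x \<in> {a<..<b} - S \<Longrightarrow> \<exists>d\<ge>0. (f has_real_derivative d) (at x)"
  shows "f a \<le> f b"
proof -
  obtain d where d: "\<And>x. x \<in> {a<..<b} - S \<Longrightarrow> d x \<ge> 0 \<and> (f has_real_derivative d x) (at x)"
    using D by metis
  \<comment> \<open>Off the exceptional set \<open>e\<close> is the derivative; the value
    \<open>0\<close> on \<open>S\<close> and at the ends keeps it nonnegative everywhere. Across
    \<open>S\<close> the fundamental theorem only asks for continuity of \<open>f\<close>, so the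
    interval need not be split.\<close>
  define e where "e x = (if x \<in> {a<..<b} - S then d x else 0)" for x
  have "(e has_integral (f b - f a)) {a..b}"
    using assms d
    by (intro fundamental_theorem_of_calculus_interior_strong[of S])
       (auto simp: e_def has_real_derivative_iff_has_vector_derivative[symmetric])
  hence "0 \<le> f b - f a"
    by (rule has_integral_nonneg) (use d in \<open>auto simp: e_def\<close>)
  thus ?thesis by simp
qed

lemma continuous_on_IccI_sides:
  fixes f :: "real \<Rightarrow> 'a::topological_space"
  assumes "\<And>x. x \<in> {a..<b} \<Longrightarrow> (f \<longlongrightarrow> f x) (at_right x)"
    and "\<And>x. x \<in> {a<..b} \<Longrightarrow> (f \<longlongrightarrow> f x) (at_left x)"
  shows "continuous_on {a..b} f"
proof (cases "a < b")
  case True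
  show ?thesis
    by (intro continuous_on_IccI) (use True assms in \<open>auto intro: filterlim_split_at\<close>)
next
  case False
  then consider "{a..b} = {}" | "a = b" by fastforce
  then show ?thesis by cases auto
qed

lemma schroedinger_solution_continuous:
  assumes "schroedinger_solution q m L E \<psi> \<phi>"
  shows "continuous_on {0..L} \<psi>"
  using assms by (simp add: schroedinger_solution_def)

lemma schroedinger_solution_tendsto:
  assumes "schroedinger_solution q m L E \<psi> \<phi>"
  shows "x \<in> {0<..L} \<Longrightarrow> (\<psi> \<longlongrightarrow> \<psi> x) (at_left x)"
    and "x \<in> {0..<L} \<Longrightarrow> (\<psi> \<longlongrightarrow> \<psi> x) (at_right x)"
proof -
  note c = schroedinger_solution_continuous[OF assms]
  show "(\<psi> \<longlongrightarrow> \<psi> x) (at_left x)" if "x \<in> {0<..L}"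
  proof -
    have "continuous_on {0..x} \<psi>" using c that by (auto intro: continuous_on_subset)
    thus ?thesis using that continuous_on_Icc_at_leftD[of 0 x \<psi>] by auto
  qed
  show "(\<psi> \<longlongrightarrow> \<psi> x) (at_right x)" if "x \<in> {0..<L}"
  proof -
    have "continuous_on {x..L} \<psi>" using c that by (auto intro: continuous_on_subset)
    thus ?thesis using that continuous_on_Icc_at_rightD[of x L \<psi>] by auto
  qed
qed

lemma schroedinger_solution_no_mass_continuous:
  assumes "schroedinger_solution q (\<lambda>x. 0) L E \<psi> \<phi>"
  shows "continuous_on {0..L} \<phi>"
  using assms by (intro continuous_on_IccI_sides) (auto simp: schroedinger_solution_def)

text \<open>The Wronskian stays continuous across a point mass because its jump is \<open>m (\<psi> \<psi>' - \<psi> \<psi>') = 0\<close>.\<close>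

lemma lagrange_identity:
  assumes s: "schroedinger_solution q m L E \<psi> \<phi>" and s': "schroedinger_solution q m L E' \<psi>' \<phi>'"
    and x: "x \<in> {0..L}"
  shows "(E - E') * integral {0..x} (\<lambda>t. \<psi> t * \<psi>' t) =
           (\<psi> x * \<phi>' x - \<phi> x * \<psi>' x) - (\<psi> 0 * \<phi>' 0 - \<phi> 0 * \<psi>' 0)"
proof -
  define w where "w t = \<psi> t * \<phi>' t - \<phi> t * \<psi>' t" for t
  note lims = schroedinger_solution_tendsto[OF s] schroedinger_solution_tendsto[OF s']
  obtain S where S: "finite S" "\<And>x. x \<in> {0<..<L} - S \<Longrightarrow> (\<psi> has_vector_derivative \<phi> x) (at x) \<and>
        (\<phi> has_vector_derivative (complex_of_real (q x) - E) * \<psi> x) (at x)"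
    using s by (auto simp: schroedinger_solution_def)
  obtain S' where S': "finite S'" "\<And>x. x \<in> {0<..<L} - S' \<Longrightarrow> (\<psi>' has_vector_derivative \<phi>' x) (at x) \<and>
        (\<phi>' has_vector_derivative (complex_of_real (q x) - E') * \<psi>' x) (at x)"
    using s' by (auto simp: schroedinger_solution_def)
  have w: "continuous_on {0..L} w"
  proof (rule continuous_on_IccI_sides)
    fix y assume y: "y \<in> {0..<L}"
    have "(w \<longlongrightarrow> \<psi> y * (\<phi>' y + complex_of_real (m y) * \<psi>' y) - (\<phi> y + complex_of_real (m y) * \<psi> y) * \<psi>' y) (at_right y)"
      unfolding w_def by (intro tendsto_intros lims)
        (use y s s' in \<open>auto simp: schroedinger_solution_def\<close>)
    also have "\<psi> y * (\<phi>' y + complex_of_real (m y) * \<psi>' y) - (\<phi> y + complex_of_real (m y) * \<psi> y) * \<psi>' y = w y"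
      by (simp add: w_def algebra_simps)
    finally show "(w \<longlongrightarrow> w y) (at_right y)" .
  next
    fix y assume y: "y \<in> {0<..L}"
    show "(w \<longlongrightarrow> w y) (at_left y)"
      unfolding w_def by (intro tendsto_intros lims)
        (use y s s' in \<open>auto simp: schroedinger_solution_def\<close>)
  qed
  have "((\<lambda>t. (E - E') * (\<psi> t * \<psi>' t)) has_integral (w x - w 0)) {0..x}"
  proof (rule fundamental_theorem_of_calculus_interior_strong[of "S \<union> S'"])
    show "(w has_vector_derivative (E - E') * (\<psi> t * \<psi>' t)) (at t)" if "t \<in> {0<..<x} - (S \<union> S')" for t
    proof -
      have t: "t \<in> {0<..<L} - S" "t \<in> {0<..<L} - S'" using that x by auto
      note d = S(2)[OF t(1), THEN conjunct1] S(2)[OF t(1), THEN conjunct2]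
               S'(2)[OF t(2), THEN conjunct1] S'(2)[OF t(2), THEN conjunct2]
      show ?thesis unfolding w_def
        by (rule has_vector_derivative_eq_rhs, (rule derivative_intros d)+) (simp add: algebra_simps)
    qed
  qed (use S(1) S'(1) x w in \<open>auto intro: continuous_on_subset\<close>)
  hence "integral {0..x} (\<lambda>t. (E - E') * (\<psi> t * \<psi>' t)) = w x - w 0"
    by (rule integral_unique)
  thus ?thesis by (simp add: w_def)
qed

text \<open>Holds because \<open>q\<close> and \<open>m\<close> are real. It serves twice: at real
  energies it makes the fundamental solutions real, and at nonreal ones it supplies the second
  solution of the self-adjointness argument.\<close>

lemma schroedinger_solution_cnj:
  assumes "schroedinger_solution q m L E \<psi> \<phi>"
  shows "schroedinger_solution q m L (cnj E) (\<lambda>x. cnj (\<psi> x)) (\<lambda>x. cnj (\<phi> x))"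
proof -
  obtain S where S: "finite S" "\<And>x. x \<in> {0<..<L} - S \<Longrightarrow> (\<psi> has_vector_derivative \<phi> x) (at x) \<and>
        (\<phi> has_vector_derivative (complex_of_real (q x) - E) * \<psi> x) (at x)"
    using assms by (auto simp: schroedinger_solution_def)
  have "((\<lambda>x. cnj (\<psi> x)) has_vector_derivative cnj (\<phi> x)) (at x) \<and>
    ((\<lambda>x. cnj (\<phi> x)) has_vector_derivative (complex_of_real (q x) - cnj E) * cnj (\<psi> x)) (at x)"
    if "x \<in> {0<..<L} - S" for x
    using has_vector_derivative_cnj[OF S(2)[OF that, THEN conjunct1]]
      has_vector_derivative_cnj[OF S(2)[OF that, THEN conjunct2]] by simp
  moreover have "((\<lambda>x. cnj (\<phi> x)) \<longlongrightarrow> cnj (\<phi> x)) (at_left x)" if "x \<in> {0<..L}" for x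
    using assms that by (intro tendsto_intros) (auto simp: schroedinger_solution_def)
  moreover have "((\<lambda>x. cnj (\<phi> x)) \<longlongrightarrow> cnj (\<phi> x) + complex_of_real (m x) * cnj (\<psi> x)) (at_right x)"
    if "x \<in> {0..<L}" for x
    using assms that tendsto_cnj[of \<phi> "\<phi> x + complex_of_real (m x) * \<psi> x" "at_right x"]
    by (auto simp: schroedinger_solution_def)
  moreover have "continuous_on {0..L} (\<lambda>x. cnj (\<psi> x))"
    using assms by (intro continuous_intros) (auto simp: schroedinger_solution_def)
  ultimately show ?thesis using S(1) unfolding schroedinger_solution_def
    by (intro conjI ballI exI[of _ S]) simp_all
qed

lemma schroedinger_solution_linear:
  assumes s: "schroedinger_solution q m L E \<psi> \<phi>" and s': "schroedinger_solution q m L E \<psi>' \<phi>'"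
  shows "schroedinger_solution q m L E (\<lambda>x. \<alpha> * \<psi> x + \<beta> * \<psi>' x) (\<lambda>x. \<alpha> * \<phi> x + \<beta> * \<phi>' x)"
proof -
  obtain S where S: "finite S" "\<And>x. x \<in> {0<..<L} - S \<Longrightarrow> (\<psi> has_vector_derivative \<phi> x) (at x) \<and>
        (\<phi> has_vector_derivative (complex_of_real (q x) - E) * \<psi> x) (at x)"
    using s by (auto simp: schroedinger_solution_def)
  obtain S' where S': "finite S'" "\<And>x. x \<in> {0<..<L} - S' \<Longrightarrow> (\<psi>' has_vector_derivative \<phi>' x) (at x) \<and>
        (\<phi>' has_vector_derivative (complex_of_real (q x) - E) * \<psi>' x) (at x)"
    using s' by (auto simp: schroedinger_solution_def)
  have "((\<lambda>x. \<alpha> * \<psi> x + \<beta> * \<psi>' x) has_vector_derivative \<alpha> * \<phi> x + \<beta> * \<phi>' x) (at x) \<and>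
    ((\<lambda>x. \<alpha> * \<phi> x + \<beta> * \<phi>' x) has_vector_derivative
      (complex_of_real (q x) - E) * (\<alpha> * \<psi> x + \<beta> * \<psi>' x)) (at x)"
    if "x \<in> {0<..<L} - (S \<union> S')" for x
  proof -
    have t: "x \<in> {0<..<L} - S" "x \<in> {0<..<L} - S'" using that by auto
    note d = S(2)[OF t(1), THEN conjunct1] S(2)[OF t(1), THEN conjunct2]
             S'(2)[OF t(2), THEN conjunct1] S'(2)[OF t(2), THEN conjunct2]
    show ?thesis
      by (intro conjI; rule has_vector_derivative_eq_rhs, (rule derivative_intros d)+)
         (simp_all add: algebra_simps)
  qed
  moreover have "((\<lambda>x. \<alpha> * \<phi> x + \<beta> * \<phi>' x) \<longlongrightarrow> \<alpha> * \<phi> x + \<beta> * \<phi>' x) (at_left x)" if "x \<in> {0<..L}" for x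
    using s s' that by (intro tendsto_intros) (auto simp: schroedinger_solution_def)
  moreover have "((\<lambda>x. \<alpha> * \<phi> x + \<beta> * \<phi>' x) \<longlongrightarrow>
      \<alpha> * \<phi> x + \<beta> * \<phi>' x + complex_of_real (m x) * (\<alpha> * \<psi> x + \<beta> * \<psi>' x)) (at_right x)"
    if "x \<in> {0..<L}" for x
  proof -
    have "((\<lambda>x. \<alpha> * \<phi> x + \<beta> * \<phi>' x) \<longlongrightarrow> \<alpha> * (\<phi> x + complex_of_real (m x) * \<psi> x)
        + \<beta> * (\<phi>' x + complex_of_real (m x) * \<psi>' x)) (at_right x)"
      using s s' that by (intro tendsto_intros) (auto simp: schroedinger_solution_def)
    thus ?thesis by (simp add: algebra_simps)
  qed
  moreover have "continuous_on {0..L} (\<lambda>x. \<alpha> * \<psi> x + \<beta> * \<psi>' x)"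
    using s s' by (intro continuous_intros) (auto simp: schroedinger_solution_def)
  moreover have "finite (S \<union> S')" using S S' by simp
  ultimately show ?thesis unfolding schroedinger_solution_def
    by (intro conjI ballI exI[of _ "S \<union> S'"]) simp_all
qed

text \<open>\<open>\<phi> 0\<close> belongs to the left of a possible mass at \<open>0\<close>, so
  it is not a derivative of \<open>\<psi>\<close> inside the interval. It is recovered from the
  right-hand limit of \<open>\<phi>\<close>, since the jump \<open>m 0 * \<psi> 0\<close> vanishes
  together with \<open>\<psi>\<close>. This is what makes the Gram form of the fundamental solutions
  definite.\<close>

lemma schroedinger_solution_zero:
  assumes s: "schroedinger_solution q m L E \<psi> \<phi>" and "L > 0" and z: "\<And>x. x \<in> {0..L} \<Longrightarrow> \<psi> x = 0"
  shows "\<phi> 0 = 0"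
proof -
  obtain S where S: "finite S" "\<And>x. x \<in> {0<..<L} - S \<Longrightarrow> (\<psi> has_vector_derivative \<phi> x) (at x)"
    using s by (auto simp: schroedinger_solution_def)
  have z': "\<phi> x = 0" if "x \<in> {0<..<L} - S" for x
  proof -
    have "((\<lambda>x. 0) has_vector_derivative \<phi> x) (at x)"
      using S(2)[OF that] by (rule has_vector_derivative_transform_within_open[of _ _ _ "{0<..<L}"])
        (use that z in auto)
    thus ?thesis by (rule vector_derivative_unique_at[OF _ has_vector_derivative_const])
  qed
  have "\<forall>\<^sub>F x in at_right 0. x \<in> {0<..<L}"
    using \<open>L > 0\<close> by (rule eventually_at_right_real)
  moreover have "\<forall>\<^sub>F x in at_right 0. x \<notin> S"
    using S(1) by (metis eventually_at_filter eventually_mono finite_subset frequently_def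
      islimpt_finite not_eventually eventually_at_topological islimpt_def subset_UNIV at_le[THEN filter_leD]
      islimpt_conv_frequently_at)
  ultimately have "\<forall>\<^sub>F x in at_right 0. \<phi> x = 0" by eventually_elim (use z' in auto)
  hence "(\<phi> \<longlongrightarrow> 0) (at_right 0)" by (rule tendsto_eventually)
  moreover have "(\<phi> \<longlongrightarrow> \<phi> 0) (at_right 0)"
  proof -
    have "(\<phi> \<longlongrightarrow> \<phi> 0 + complex_of_real (m 0) * \<psi> 0) (at_right 0)"
      using s \<open>L > 0\<close> unfolding schroedinger_solution_def by simp
    thus ?thesis using z[of 0] \<open>L > 0\<close> by simp
  qed
  ultimately show ?thesis
    by (intro tendsto_unique[OF trivial_limit_at_right_real])
qed

section \<open>Existence and bounds for the Cauchy problem\<close>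

lemma integrable_on_Pair:
  fixes f :: "real \<Rightarrow> 'a::banach" and g :: "real \<Rightarrow> 'b::banach"
  assumes "f integrable_on S" "g integrable_on S"
  shows "(\<lambda>t. (f t, g t)) integrable_on S"
proof -
  have "((\<lambda>a. (a, 0::'b)) \<circ> f) integrable_on S"
    by (intro integrable_linear assms bounded_linear_intros)
  moreover have "((\<lambda>a. (0::'a, a)) \<circ> g) integrable_on S"
    by (intro integrable_linear assms bounded_linear_intros)
  ultimately have "(\<lambda>t. ((\<lambda>a. (a, 0::'b)) \<circ> f) t + ((\<lambda>a. (0::'a, a)) \<circ> g) t) integrable_on S"
    by (rule integrable_add)
  thus ?thesis by simp
qed

text \<open>
  Picard iteration for \<open>z x = exp (- \<lambda> x) y x\<close>: for \<open>\<lambda> = 2 (1 + B)\<close> the integral operator contracts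
  the supremum norm by \<open>1 / 2\<close> on the whole interval, so no continuation argument is needed.
\<close>

lemma linear_ode_exists:
  fixes g :: "real \<Rightarrow> complex" and a b :: complex
  assumes L: "L > 0" and B: "\<And>t. t \<in> {0..L} \<Longrightarrow> cmod (g t) \<le> B"
    and int: "\<And>z. continuous_on {0..L} z \<Longrightarrow> (\<lambda>t. g t * z t) integrable_on {0..L}"
    and cont: "\<And>t. t \<in> {0<..<L} - S \<Longrightarrow> isCont g t"
  obtains \<psi> \<phi> where "continuous_on {0..L} \<psi>" "continuous_on {0..L} \<phi>" "\<psi> 0 = a" "\<phi> 0 = b"
    "\<And>x. x \<in> {0<..<L} - S \<Longrightarrow>
       (\<psi> has_vector_derivative \<phi> x) (at x) \<and> (\<phi> has_vector_derivative g x * \<psi> x) (at x)"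
    "\<And>x. x \<in> {0..L} \<Longrightarrow> cmod (\<psi> x) \<le> 2 * (cmod a + cmod b) * exp (2 * (1 + B) * L)"
proof -
  have B0: "B \<ge> 0" using B[of 0] L norm_ge_zero[of "g 0"] by (simp del: norm_ge_zero)
  define \<mu> where "\<mu> = 2 * (1 + B)"
  have \<mu>: "\<mu> > 0" using B0 by (simp add: \<mu>_def)
  define N where "N t y = (snd y, g t * fst y)" for t and y :: "complex \<times> complex"
  have N_diff: "N t y - N t y' = N t (y - y')" for t y y'
    by (simp add: N_def algebra_simps)
  have N_le: "norm (N t y) \<le> (1 + B) * norm y" if "t \<in> {0..L}" for t y
  proof -
    have "norm (N t y) \<le> norm (snd y) + norm (g t * fst y)"
      unfolding N_def by (rule norm_Pair_le)
    also have "\<dots> \<le> norm y + B * norm y"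
      using norm_snd_le[of "snd y" "fst y"] norm_fst_le[of "fst y" "snd y"]
      by (intro add_mono) (auto simp: norm_mult intro!: mult_mono B that B0)
    finally show ?thesis by (simp add: algebra_simps)
  qed
  have N_int: "(\<lambda>t. N t (y t)) integrable_on {0..L}" if "continuous_on {0..L} y" for y
    unfolding N_def using that
    by (intro integrable_on_Pair int integrable_continuous_real continuous_intros)
  have N_int': "(\<lambda>t. N t (y t)) integrable_on {0..x}" if "continuous_on {0..L} y" "x \<in> {0..L}" for y x
    by (rule integrable_on_subinterval[OF N_int[OF that(1)]]) (use that in auto)
  \<comment> \<open>Clamping the argument to \<open>{0..L}\<close> extends functions on the interval
    to bounded continuous functions on the line, so the complete type of such functions can host the
    fixed point.\<close>
  define pr where "pr x = max 0 (min L x)" for x :: real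
  have pr: "pr x \<in> {0..L}" "x \<in> {0..L} \<Longrightarrow> pr x = x" for x using L by (auto simp: pr_def)
  have pr_cont: "continuous_on UNIV pr" unfolding pr_def by (intro continuous_intros)
  define J where "J y x = integral {0..x} (\<lambda>t. N t (y t))" for y x
  have J_cont: "continuous_on {0..L} (J y)" if "continuous_on {0..L} y" for y
    unfolding J_def by (intro indefinite_integral_continuous_1 N_int that)
  define ex where "ex z t = exp (\<mu> * t) *\<^sub>R z t" for z :: "real \<Rightarrow> complex \<times> complex" and t
  have ex_cont: "continuous_on {0..L} (ex (apply_bcontfun z))" for z
    unfolding ex_def by (intro continuous_intros continuous_on_apply_bcontfun)
  define \<Phi> where "\<Phi> z = Bcontfun (\<lambda>x. exp (- \<mu> * pr x) *\<^sub>R ((a, b) + J (ex (apply_bcontfun z)) (pr x)))"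
    for z :: "real \<Rightarrow>\<^sub>C (complex \<times> complex)"
  have \<Phi>: "apply_bcontfun (\<Phi> z) x = exp (- \<mu> * pr x) *\<^sub>R ((a, b) + J (ex (apply_bcontfun z)) (pr x))" for z x
  proof -
    let ?h = "\<lambda>X. exp (- \<mu> * X) *\<^sub>R ((a, b) + J (ex (apply_bcontfun z)) X)"
    have h: "continuous_on {0..L} ?h" by (intro continuous_intros J_cont ex_cont)
    have "continuous_on UNIV (\<lambda>x. ?h (pr x))"
      by (rule continuous_on_compose2[OF h pr_cont]) (use pr in auto)
    moreover have "bounded (range (\<lambda>x. ?h (pr x)))"
      by (rule bounded_subset[OF compact_imp_bounded[OF compact_continuous_image[OF h]]]) (use pr in auto)
    ultimately have "(\<lambda>x. ?h (pr x)) \<in> bcontfun" by (simp add: bcontfun_def)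
    thus ?thesis unfolding \<Phi>_def by (subst Bcontfun_inverse) auto
  qed
  have contr: "dist (\<Phi> z) (\<Phi> w) \<le> 1/2 * dist z w" for z w
  proof (rule dist_bound)
    fix x
    define X where "X = pr x"
    have X: "X \<in> {0..L}" using pr by (simp add: X_def)
    define d where "d = dist z w"
    have d0: "d \<ge> 0" by (simp add: d_def)
    have "dist (apply_bcontfun (\<Phi> z) x) (apply_bcontfun (\<Phi> w) x)
        = exp (- \<mu> * X) * norm (J (ex (apply_bcontfun z)) X - J (ex (apply_bcontfun w)) X)"
      by (simp add: \<Phi> X_def dist_norm scaleR_diff_right[symmetric])
    also have "J (ex (apply_bcontfun z)) X - J (ex (apply_bcontfun w)) X =
        integral {0..X} (\<lambda>t. N t (ex (apply_bcontfun z) t - ex (apply_bcontfun w) t))"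
      unfolding J_def by (subst Henstock_Kurzweil_Integration.integral_diff[symmetric])
        (use X in \<open>auto intro!: N_int' ex_cont simp: N_diff\<close>)
    also have "norm \<dots> \<le> integral {0..X} (\<lambda>t. (1 + B) * (exp (\<mu> * t) * d))"
    proof (rule Henstock_Kurzweil_Integration.integral_norm_bound_integral)
      show "(\<lambda>t. N t (ex (apply_bcontfun z) t - ex (apply_bcontfun w) t)) integrable_on {0..X}"
        using X by (intro N_int' continuous_intros ex_cont)
      show "(\<lambda>t. (1 + B) * (exp (\<mu> * t) * d)) integrable_on {0..X}"
        by (intro integrable_continuous_real continuous_intros)
      fix t assume t: "t \<in> {0..X}"
      have "norm (N t (ex (apply_bcontfun z) t - ex (apply_bcontfun w) t))
          \<le> (1 + B) * norm (ex (apply_bcontfun z) t - ex (apply_bcontfun w) t)"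
        by (rule N_le) (use t X in auto)
      also have "norm (ex (apply_bcontfun z) t - ex (apply_bcontfun w) t)
          = exp (\<mu> * t) * dist (apply_bcontfun z t) (apply_bcontfun w t)"
        by (simp add: ex_def dist_norm scaleR_diff_right[symmetric])
      also have "(1 + B) * \<dots> \<le> (1 + B) * (exp (\<mu> * t) * d)"
        unfolding d_def by (intro mult_left_mono dist_bounded) (use B0 in auto)
      finally show "norm (N t (ex (apply_bcontfun z) t - ex (apply_bcontfun w) t)) \<le> (1 + B) * (exp (\<mu> * t) * d)"
        by simp
    qed
    \<comment> \<open>The choice \<open>\<mu> = 2 * (1 + B)\<close> enters here: (1 + B) / \<mu> is
      the contraction factor 1 / 2.\<close>
    also have "integral {0..X} (\<lambda>t. (1 + B) * (exp (\<mu> * t) * d)) = d / 2 * exp (\<mu> * X) - d / 2 * exp (\<mu> * 0)"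
      by (intro integral_unique fundamental_theorem_of_calculus)
         (use X in \<open>auto intro!: derivative_eq_intros
            simp: has_real_derivative_iff_has_vector_derivative[symmetric] \<mu>_def\<close>)
    also have "exp (- \<mu> * X) * \<dots> \<le> d / 2"
    proof -
      have "exp (- \<mu> * X) * (d / 2 * exp (\<mu> * X) - d / 2 * exp (\<mu> * 0))
          = d / 2 * (exp (- \<mu> * X) * exp (\<mu> * X)) - d / 2 * exp (- \<mu> * X)"
        by (simp add: right_diff_distrib mult.left_commute)
      also have "exp (- \<mu> * X) * exp (\<mu> * X) = 1" by (simp add: mult_exp_exp)
      finally show ?thesis using d0 by simp
    qed
    finally show "dist (apply_bcontfun (\<Phi> z) x) (apply_bcontfun (\<Phi> w) x) \<le> 1/2 * dist z w"
      by (simp add: d_def)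
  qed
  obtain z where z: "\<Phi> z = z"
    using banach_fix_type[of "1/2" \<Phi>] contr by auto
  \<comment> \<open>The contraction also yields an a priori bound: the norm of the fixed point is at
    most that of \<open>\<Phi> 0\<close> plus half of itself. Hence the bound on
    \<open>\<psi>\<close> depends on the coefficient only through \<open>B\<close>, and is uniform
    for energies in a bounded set.\<close>
  have "norm (\<Phi> 0) \<le> norm (a, b)"
  proof (rule norm_bound)
    fix x
    have "J (ex (apply_bcontfun 0)) (pr x) = 0"
      by (simp add: J_def ex_def N_def zero_prod_def[symmetric])
    hence "norm (apply_bcontfun (\<Phi> 0) x) = exp (- \<mu> * pr x) * norm (a, b)"
      unfolding \<Phi> by (simp del: scaleR_Pair)
    also have "\<dots> \<le> 1 * norm (a, b)"
      using pr[of x] \<mu> by (intro mult_right_mono) auto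
    finally show "norm (apply_bcontfun (\<Phi> 0) x) \<le> norm (a, b)" by simp
  qed
  moreover have "norm z \<le> norm (\<Phi> 0) + dist (\<Phi> z) (\<Phi> 0)"
    using norm_triangle_sub[of z "\<Phi> 0"] z by (simp add: dist_norm)
  moreover have "dist (\<Phi> z) (\<Phi> 0) \<le> 1/2 * norm z"
    using contr[of z 0] by (simp add: dist_norm)
  ultimately have z_le: "norm z \<le> 2 * norm (a, b)" by linarith
  define y where "y = ex (apply_bcontfun z)"
  have y_eq: "y x = (a, b) + J y x" if "x \<in> {0..L}" for x
  proof -
    have "y x = exp (\<mu> * x) *\<^sub>R apply_bcontfun (\<Phi> z) x" by (simp add: y_def ex_def z)
    also have "\<dots> = (a, b) + J y x"
      using pr(2)[OF that] by (simp add: \<Phi> y_def exp_minus)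
    finally show ?thesis .
  qed
  have y_cont: "continuous_on UNIV y"
    unfolding y_def ex_def by (intro continuous_intros continuous_on_apply_bcontfun)
  have y_deriv: "(y has_vector_derivative N x (y x)) (at x)" if x: "x \<in> {0<..<L} - S" for x
  proof -
    have c: "isCont (\<lambda>t. N t (y t)) x"
      unfolding N_def using x y_cont cont
      by (intro continuous_intros) (auto simp: continuous_on_eq_continuous_at)
    have "((\<lambda>u. integral {0..u} (\<lambda>t. N t (y t))) has_vector_derivative N x (y x)) (at x within {0..L} - {})"
      by (rule integral_has_vector_derivative_continuous_at[OF N_int])
         (use x y_cont c in \<open>auto intro: continuous_on_subset continuous_at_imp_continuous_at_within\<close>)
    hence "(J y has_vector_derivative N x (y x)) (at x)"
      using x by (simp add: J_def[abs_def] at_within_Icc_at)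
    hence "((\<lambda>u. (a, b) + J y u) has_vector_derivative N x (y x)) (at x)"
      by (auto intro!: derivative_eq_intros)
    thus ?thesis
      by (rule has_vector_derivative_transform_within_open[of _ _ _ "{0<..<L}"])
         (use x y_eq in auto)
  qed
  show ?thesis
  proof (rule that[of "\<lambda>x. fst (y x)" "\<lambda>x. snd (y x)"])
    show "continuous_on {0..L} (\<lambda>x. fst (y x))" "continuous_on {0..L} (\<lambda>x. snd (y x))"
      by (intro continuous_intros continuous_on_subset[OF y_cont]; simp)+
    have "J y 0 = 0" by (simp add: J_def)
    thus "fst (y 0) = a" "snd (y 0) = b" using y_eq[of 0] L by auto
    show "((\<lambda>x. fst (y x)) has_vector_derivative snd (y x)) (at x) \<and>
          ((\<lambda>x. snd (y x)) has_vector_derivative g x * fst (y x)) (at x)"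
      if "x \<in> {0<..<L} - S" for x
      using bounded_linear.has_vector_derivative[OF bounded_linear_fst y_deriv[OF that]]
        bounded_linear.has_vector_derivative[OF bounded_linear_snd y_deriv[OF that]]
      by (simp add: N_def)
    fix x assume x: "x \<in> {0..L}"
    have "cmod (fst (y x)) \<le> norm (y x)" using norm_fst_le[of "fst (y x)" "snd (y x)"] by simp
    also have "\<dots> = exp (\<mu> * x) * norm (apply_bcontfun z x)" by (simp add: y_def ex_def)
    also have "\<dots> \<le> exp (\<mu> * L) * (2 * norm (a, b))"
      using x \<mu> z_le norm_bounded[of z x] by (intro mult_mono) auto
    also have "\<dots> \<le> exp (\<mu> * L) * (2 * (cmod a + cmod b))"
      by (intro mult_left_mono norm_Pair_le) auto
    finally show "cmod (fst (y x)) \<le> 2 * (cmod a + cmod b) * exp (2 * (1 + B) * L)"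
      by (simp add: \<mu>_def algebra_simps)
  qed
qed

section \<open>The dispersion relation\<close>

definition quadrant :: "complex set" where
  "quadrant = {w. 0 < Re w \<and> 0 < Im w}"

lemma convex_quadrant: "convex quadrant"
proof -
  have "quadrant = {w. Re w > 0} \<inter> {w. Im w > 0}" by (auto simp: quadrant_def)
  thus ?thesis by (metis convex_Int convex_halfspace_Re_gt convex_halfspace_Im_gt)
qed

text \<open>Near a real point, a root, a logarithm or a sign that varies continuously within a
  discrete set is constant on such a piece of the quadrant. Every choice of a branch below rests on
  this.\<close>

lemma connected_quadrant_ball: "connected (quadrant \<inter> ball z r)"
  by (intro convex_connected convex_Int convex_quadrant convex_ball)

lemma real_not_in_quadrant: "complex_of_real x \<notin> quadrant"
  by (simp add: quadrant_def)

lemma quadrant_approaches_real: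
  assumes "x \<ge> 0"
  shows "at (complex_of_real x) within quadrant \<noteq> bot"
proof -
  have "complex_of_real x islimpt quadrant"
    unfolding islimpt_approachable
  proof (intro allI impI)
    fix e :: real assume e: "e > 0"
    let ?w = "Complex (x + e/3) (e/3)"
    have "dist ?w (complex_of_real x) \<le> \<bar>e/3\<bar> + \<bar>e/3\<bar>"
      unfolding dist_norm by (rule order_trans[OF cmod_le]) simp
    also have "\<dots> < e" using e by simp
    finally show "\<exists>w\<in>quadrant. w \<noteq> complex_of_real x \<and> dist w (complex_of_real x) < e"
      using e assms by (intro bexI[of _ ?w]) (auto simp: quadrant_def complex_eq_iff)
  qed
  thus ?thesis by (simp add: trivial_limit_within)
qed

lemma eventually_at_within_notin:
  assumes "z \<notin> Q"
  shows "eventually P (at z within Q) \<longleftrightarrow> (\<exists>d>0. \<forall>w\<in>Q. dist w z < d \<longrightarrow> P w)"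
proof -
  have "w \<noteq> z" if "w \<in> Q" for w using assms that by auto
  thus ?thesis unfolding eventually_at by (metis (no_types, lifting))
qed

lemma connected_image_avoids_value:
  fixes f :: "'a \<Rightarrow> real"
  assumes "connected (f ` S)" "c \<notin> f ` S"
  shows "(\<forall>x\<in>S. f x < c) \<or> (\<forall>x\<in>S. c < f x)"
proof (rule ccontr)
  assume "\<not> ?thesis"
  then obtain x y where "x \<in> S" "c \<le> f x" "y \<in> S" "f y \<le> c" by (auto simp: not_less)
  hence "c \<in> f ` S" using connectedD_interval[OF assms(1), of "f y" "f x" c] by blast
  thus False using assms(2) by simp
qed

text \<open>Each real y near x is itself approached by quadrant points close to x, where
  \<open>h\<close> is already within e / 2 of \<open>l\<close>; the closed estimate survives the
  passage to y. Nothing is assumed about the value of \<open>h\<close> at x, because the lemma is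
  also applied to a difference quotient based there.\<close>

lemma tendsto_quadrant_imp_real:
  fixes h :: "complex \<Rightarrow> complex"
  assumes x: "x > 0" and h: "(h \<longlongrightarrow> l) (at (complex_of_real x) within quadrant)"
    and hy: "\<And>y. y > 0 \<Longrightarrow> y \<noteq> x \<Longrightarrow>
       (h \<longlongrightarrow> h (complex_of_real y)) (at (complex_of_real y) within quadrant)"
  shows "((\<lambda>y. h (complex_of_real y)) \<longlongrightarrow> l) (at x)"
proof (rule tendstoI)
  fix e :: real assume e: "e > 0"
  obtain d where d: "d > 0"
    "\<And>w. w \<in> quadrant \<Longrightarrow> dist w (complex_of_real x) < d \<Longrightarrow> dist (h w) l < e/2"
    using tendstoD[OF h, of "e/2"] e
    unfolding eventually_at_within_notin[OF real_not_in_quadrant] by auto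
  have "dist (h (complex_of_real y)) l < e" if y: "y \<noteq> x" "dist y x < min d x" for y
  proof -
    have y0: "y > 0" using y x by (auto simp: dist_real_def)
    have "\<forall>\<^sub>F w in at (complex_of_real y) within quadrant. dist w (complex_of_real x) < d"
    proof -
      have "complex_of_real y \<in> ball (complex_of_real x) d"
        using y(2) by (simp add: dist_commute dist_of_real)
      hence "\<forall>\<^sub>F w in nhds (complex_of_real y). w \<in> ball (complex_of_real x) d"
        by (intro eventually_nhds_in_open) auto
      thus ?thesis unfolding eventually_at_filter
        by eventually_elim (auto simp: dist_commute)
    qed
    moreover have "\<forall>\<^sub>F w in at (complex_of_real y) within quadrant. w \<in> quadrant"
      by (simp add: eventually_at_filter)
    ultimately have "\<forall>\<^sub>F w in at (complex_of_real y) within quadrant. dist l (h w) \<le> e/2"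
      by eventually_elim (use d(2) in \<open>force simp: dist_commute\<close>)
    hence "dist l (h (complex_of_real y)) \<le> e/2"
      by (intro Lim_dist_ubound[OF quadrant_approaches_real hy]) (use y0 y in auto)
    thus ?thesis using e by (simp add: dist_commute)
  qed
  thus "\<forall>\<^sub>F y in at x. dist (h (complex_of_real y)) l < e"
    unfolding eventually_at using d(1) x by (intro exI[of _ "min d x"]) auto
qed

lemma has_vector_derivative_quotientI:
  fixes f :: "real \<Rightarrow> complex"
  assumes "((\<lambda>y. (f y - f x) / complex_of_real (y - x)) \<longlongrightarrow> D) (at x)"
  shows "(f has_vector_derivative D) (at x)"
proof -
  have "((\<lambda>y. norm ((f y - f x) / complex_of_real (y - x) - D)) \<longlongrightarrow> 0) (at x)"
    using assms by (intro tendsto_norm_zero) (simp add: LIM_zero)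
  moreover have "\<forall>\<^sub>F y in at x. norm ((f y - f x) / complex_of_real (y - x) - D)
      = norm (f y - f x - (y - x) *\<^sub>R D) / norm (y - x)"
  proof (intro eventually_at_filter[THEN iffD2] always_eventually allI impI)
    fix y :: real assume "y \<noteq> x"
    hence "(f y - f x) / complex_of_real (y - x) - D = (f y - f x - (y - x) *\<^sub>R D) / complex_of_real (y - x)"
      by (simp add: diff_divide_distrib scaleR_conv_of_real del: of_real_diff)
    thus "norm ((f y - f x) / complex_of_real (y - x) - D)
      = norm (f y - f x - (y - x) *\<^sub>R D) / norm (y - x)"
      by (simp add: norm_divide del: of_real_diff)
  qed
  ultimately have "((\<lambda>y. norm (f y - f x - (y - x) *\<^sub>R D) / norm (y - x)) \<longlongrightarrow> 0) (at x)"
    by (rule Lim_transform_eventually)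
  thus ?thesis
    by (simp add: has_vector_derivative_def has_derivative_iff_norm bounded_linear_scaleR_left)
qed

text \<open>Put d = |a - b|. Where |X - a| = d / 2, also |X - b| is at least d / 2, so the product
  is at least d^2 / 4, which is impossible near \<open>z\<close>. By connectedness \<open>X\<close>
  stays inside or outside that circle, and the factor bounded away from \<open>0\<close> can be
  divided out. For \<open>a = b\<close> one takes a square root of the modulus instead.\<close>

lemma tendsto_one_of_two_roots:
  fixes X :: "complex \<Rightarrow> complex"
  assumes X: "continuous_on Q X" and conn: "\<And>r. connected (Q \<inter> ball z r)" and z: "z \<notin> Q"
    and lim: "((\<lambda>w. (X w - a) * (X w - b)) \<longlongrightarrow> 0) (at z within Q)"
  shows "(X \<longlongrightarrow> a) (at z within Q) \<or> (X \<longlongrightarrow> b) (at z within Q)"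
proof (cases "a = b")
  case True
  have "((\<lambda>w. cmod ((X w - a) * (X w - b))) \<longlongrightarrow> 0) (at z within Q)"
    by (rule tendsto_norm_zero[OF lim])
  hence "((\<lambda>w. sqrt (cmod ((X w - a) * (X w - b)))) \<longlongrightarrow> sqrt 0) (at z within Q)"
    by (rule tendsto_real_sqrt)
  hence "((\<lambda>w. cmod (X w - a)) \<longlongrightarrow> 0) (at z within Q)"
    using True by (simp add: norm_mult)
  hence "((\<lambda>w. X w - a) \<longlongrightarrow> 0) (at z within Q)" by (rule tendsto_norm_zero_cancel)
  thus ?thesis by (simp add: LIM_zero_iff)
next
  case False
  define d where "d = cmod (a - b)"
  have d: "d > 0" using False by (simp add: d_def)
  obtain r where r: "r > 0" "\<And>w. w \<in> Q \<Longrightarrow> dist w z < r \<Longrightarrow> cmod ((X w - a) * (X w - b)) < d\<^sup>2 / 4"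
    using tendstoD[OF lim, of "d\<^sup>2/4"] d unfolding eventually_at_within_notin[OF z] by auto
  let ?Q = "Q \<inter> ball z r"
  have ev: "\<forall>\<^sub>F w in at z within Q. w \<in> ?Q"
    unfolding eventually_at using r(1) by (auto simp: dist_commute)
  have tri: "d \<le> cmod (X w - a) + cmod (X w - b)" for w
    unfolding d_def using norm_triangle_ineq4[of "X w - b" "X w - a"] by simp
  have ne: "cmod (X w - a) \<noteq> d/2" if "w \<in> ?Q" for w
  proof
    assume h: "cmod (X w - a) = d/2"
    have "cmod (X w - b) \<ge> d/2" using tri[of w] h by simp
    hence "cmod ((X w - a) * (X w - b)) \<ge> (d/2) * (d/2)"
      unfolding norm_mult h using d by (intro mult_left_mono) auto
    thus False using r(2)[of w] that by (auto simp: power2_eq_square dist_commute)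
  qed
  have "connected ((\<lambda>w. cmod (X w - a)) ` ?Q)"
    by (intro connected_continuous_image conn continuous_intros continuous_on_subset[OF X]) auto
  hence "(\<forall>w\<in>?Q. cmod (X w - a) < d/2) \<or> (\<forall>w\<in>?Q. cmod (X w - a) > d/2)"
    using ne connected_image_avoids_value[of "\<lambda>w. cmod (X w - a)" ?Q "d/2"] by fastforce
  then consider (a) "\<And>w. w \<in> ?Q \<Longrightarrow> cmod (X w - a) < d/2" | (b) "\<And>w. w \<in> ?Q \<Longrightarrow> cmod (X w - a) > d/2"
    by blast
  moreover have key: "(X \<longlongrightarrow> p) (at z within Q)"
    if "\<And>w. w \<in> ?Q \<Longrightarrow> cmod (X w - p') \<ge> d/2" "((\<lambda>w. (X w - p) * (X w - p')) \<longlongrightarrow> 0) (at z within Q)" for p p'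
  proof -
    have "((\<lambda>w. cmod ((X w - p) * (X w - p')) * (2/d)) \<longlongrightarrow> 0) (at z within Q)"
      using tendsto_mult_left_zero[OF tendsto_norm_zero[OF that(2)], of "2/d"] .
    moreover have "\<forall>\<^sub>F w in at z within Q. norm (X w - p) \<le> cmod ((X w - p) * (X w - p')) * (2/d)"
      using ev
    proof eventually_elim
      case (elim w)
      have "cmod (X w - p) * (d/2) \<le> cmod (X w - p) * cmod (X w - p')"
        by (intro mult_left_mono that(1) elim) auto
      thus ?case using d by (simp add: norm_mult pos_le_divide_eq mult.commute)
    qed
    ultimately have "((\<lambda>w. X w - p) \<longlongrightarrow> 0) (at z within Q)" by (rule Lim_null_comparison[rotated])
    thus ?thesis by (simp add: LIM_zero_iff)
  qed
  ultimately show ?thesis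
  proof cases
    case a
    have "cmod (X w - b) \<ge> d/2" if "w \<in> ?Q" for w using a[OF that] tri[of w] by linarith
    from key[OF this lim] show ?thesis by simp
  next
    case b
    have "(X \<longlongrightarrow> b) (at z within Q)"
      by (rule key[of a]) (use b lim in \<open>auto simp: mult.commute less_imp_le\<close>)
    thus ?thesis by simp
  qed
qed

text \<open>A continuous logarithm of a convergent function with nonzero limit converges: after
  division by \<open>X0\<close> the principal logarithm is available near \<open>z\<close>, and its
  difference from \<i> k only takes values that are logarithms of \<open>X0\<close>. These are 2 pi
  apart, so the difference is constant on a connected neighbourhood.\<close>

lemma tendsto_of_tendsto_exp:
  fixes k :: "complex \<Rightarrow> complex"
  assumes k: "continuous_on Q k" and conn: "\<And>r. connected (Q \<inter> ball z r)" and z: "z \<notin> Q"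
    and lim: "((\<lambda>w. exp (\<i> * k w)) \<longlongrightarrow> X0) (at z within Q)" and X0: "X0 \<noteq> 0"
  shows "\<exists>l. (k \<longlongrightarrow> l) (at z within Q)"
proof -
  define e where "e w = exp (\<i> * k w) / X0" for w
  have e1: "(e \<longlongrightarrow> 1) (at z within Q)"
    using tendsto_divide[OF lim tendsto_const X0] X0 by (simp add: e_def[abs_def])
  obtain r where r: "r > 0" "\<And>w. w \<in> Q \<Longrightarrow> dist w z < r \<Longrightarrow> dist (e w) 1 < 1"
    using tendstoD[OF e1, of 1] unfolding eventually_at_within_notin[OF z] by auto
  let ?Q = "Q \<inter> ball z r"
  have ev: "\<forall>\<^sub>F w in at z within Q. w \<in> ?Q"
    unfolding eventually_at using r(1) by (auto simp: dist_commute)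
  have nonneg: "e w \<notin> \<real>\<^sub>\<le>\<^sub>0" if "w \<in> ?Q" for w
  proof -
    have "dist (e w) 1 < 1" using r(2)[of w] that by (auto simp: dist_commute)
    hence "\<bar>Re (e w) - 1\<bar> < 1" using abs_Re_le_cmod[of "e w - 1"] by (simp add: dist_norm)
    thus ?thesis by (auto simp: complex_nonpos_Reals_iff)
  qed
  define N where "N w = \<i> * k w - Ln (e w)" for w
  have e_cont: "continuous_on Q e" unfolding e_def using X0 by (intro continuous_intros k) auto
  have N_exp: "exp (N w) = X0" for w
    using X0 by (simp add: N_def exp_diff e_def)
  have "N constant_on ?Q"
  proof (rule continuous_discrete_range_constant[OF conn])
    show "continuous_on ?Q N" unfolding N_def
      by (intro continuous_intros continuous_on_subset[OF k] continuous_on_subset[OF e_cont]) (use nonneg in auto)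
    show "\<exists>e>0. \<forall>y. y \<in> ?Q \<and> N y \<noteq> N x \<longrightarrow> e \<le> norm (N y - N x)" for x
    proof (intro exI[of _ "2*pi"] conjI allI impI)
      fix y assume y: "y \<in> ?Q \<and> N y \<noteq> N x"
      show "2 * pi \<le> norm (N y - N x)"
      proof (rule ccontr)
        assume "\<not> ?thesis"
        hence "\<bar>Im (N y) - Im (N x)\<bar> < 2 * pi" using abs_Im_le_cmod[of "N y - N x"] by simp
        thus False using exp_complex_eqI[of "N y" "N x"] N_exp y by simp
      qed
    qed simp
  qed
  then obtain c where c: "\<And>w. w \<in> ?Q \<Longrightarrow> N w = c" unfolding constant_on_def by blast
  have "((\<lambda>w. - \<i> * (c + Ln (e w))) \<longlongrightarrow> - \<i> * (c + Ln 1)) (at z within Q)"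
    by (intro tendsto_intros e1) auto
  moreover have "\<forall>\<^sub>F w in at z within Q. - \<i> * (c + Ln (e w)) = k w"
    using ev
  proof eventually_elim
    case (elim w)
    have "c + Ln (e w) = \<i> * k w" using c[OF elim] by (auto simp: N_def)
    thus ?case by simp
  qed
  ultimately show ?thesis by (blast intro: Lim_transform_eventually)
qed

lemma cos_in_unit_interval_imp_real:
  fixes z :: complex
  assumes "cos z = complex_of_real t" "\<bar>t\<bar> \<le> 1"
  shows "Im z = 0"
proof -
  have "cos z = cos (complex_of_real (arccos t))"
    using assms by (simp add: cos_of_real cos_arccos_abs)
  then obtain n where "z = complex_of_real (arccos t) + of_real (2*n*pi) \<or> z = - complex_of_real (arccos t) + of_real (2*n*pi)"
    unfolding complex_cos_eq by blast
  thus ?thesis by auto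
qed

text \<open>Missing the values 1 and -1 on a contractible set, \<open>F\<close> is the cosine of a
  holomorphic function; missing all of [-1, 1], that function has nowhere real values, so a global
  sign makes its imaginary part positive. Boundary values come from X = exp (\<i> k), a root of X^2
  - 2 F X + 1 in the closed unit disc. It tends to a root of the limiting polynomial, and this root
  is nonzero because the product of the two roots is 1.\<close>

theorem dispersion_relation_exists:
  assumes F: "F holomorphic_on UNIV"
    and avoid: "\<And>w t. w \<in> quadrant \<Longrightarrow> \<bar>t\<bar> \<le> 1 \<Longrightarrow> F w \<noteq> complex_of_real t"
  shows "\<exists>k. dispersion_relation F k"
proof -
  have FQ: "F holomorphic_on quadrant" using F holomorphic_on_subset by blast
  obtain g where g: "g holomorphic_on quadrant" "\<And>w. w \<in> quadrant \<Longrightarrow> F w = cos (g w)"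
    using contractible_imp_holomorphic_arccos[OF FQ convex_imp_contractible[OF convex_quadrant]]
      avoid[of _ 1] avoid[of _ "-1"] by auto
  have Im_ne: "Im (g w) \<noteq> 0" if "w \<in> quadrant" for w
  proof
    assume "Im (g w) = 0"
    hence "g w = complex_of_real (Re (g w))" by (simp add: complex_eq_iff)
    hence "F w = complex_of_real (cos (Re (g w)))" using g(2)[OF that] by (metis cos_of_real)
    thus False using avoid[OF that, of "cos (Re (g w))"] by simp
  qed
  have "connected ((\<lambda>w. Im (g w)) ` quadrant)"
    by (intro connected_continuous_image continuous_intros holomorphic_on_imp_continuous_on g
        convex_connected convex_quadrant)
  hence "(\<forall>w\<in>quadrant. Im (g w) > 0) \<or> (\<forall>w\<in>quadrant. Im (g w) < 0)"
    using Im_ne connected_image_avoids_value[of "\<lambda>w. Im (g w)" quadrant 0] by fastforce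
  then obtain s :: complex where s: "s = 1 \<or> s = -1" "\<And>w. w \<in> quadrant \<Longrightarrow> Im (s * g w) > 0"
  proof
    assume "\<forall>w\<in>quadrant. Im (g w) > 0" thus ?thesis by (intro that[of 1]) auto
  next
    assume "\<forall>w\<in>quadrant. Im (g w) < 0" thus ?thesis by (intro that[of "-1"]) auto
  qed
  define h where "h w = s * g w" for w
  have h_hol: "h holomorphic_on quadrant" unfolding h_def by (intro holomorphic_intros g)
  have h_cos: "cos (h w) = F w" if "w \<in> quadrant" for w
    using s(1) g(2)[OF that] by (auto simp: h_def)
  have h_Im: "Im (h w) > 0" if "w \<in> quadrant" for w using s(2)[OF that] by (simp add: h_def)
  have lim: "\<exists>l. (h \<longlongrightarrow> l) (at (complex_of_real x) within quadrant)" for x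
  proof -
    define X where "X w = exp (\<i> * h w)" for w
    define F0 where "F0 = F (complex_of_real x)"
    \<comment> \<open>The roots of X^2 - 2 F0 X + 1; which square root is taken does not matter, as
      both roots remain candidates.\<close>
    define a where "a = F0 + csqrt (F0\<^sup>2 - 1)"
    define b where "b = F0 - csqrt (F0\<^sup>2 - 1)"
    have ab: "a * b = 1" "a + b = 2 * F0"
      by (simp_all add: a_def b_def algebra_simps flip: power2_eq_square)
    have X_cont: "continuous_on quadrant X" unfolding X_def
      by (intro continuous_intros holomorphic_on_imp_continuous_on h_hol)
    have Ftends: "(F \<longlongrightarrow> F0) (at (complex_of_real x) within quadrant)"
    proof -
      have "isCont F (complex_of_real x)"
        using holomorphic_on_imp_continuous_on[OF F] by (simp add: continuous_on_eq_continuous_at)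
      thus ?thesis unfolding F0_def isCont_def by (rule tendsto_within_subset[OF _ subset_UNIV])
    qed
    have roots: "(X w - a) * (X w - b) = 2 * (F w - F0) * X w" if "w \<in> quadrant" for w
    proof -
      have "2 * F w = X w + 1 / X w"
        unfolding h_cos[OF that, symmetric] cos_exp_eq X_def by (simp add: exp_minus field_simps)
      hence "2 * F w * X w = X w * X w + 1" by (simp add: X_def field_simps)
      moreover have "(X w - a) * (X w - b) = X w * X w - (a + b) * X w + a * b"
        by (simp add: algebra_simps)
      ultimately show ?thesis using ab by (simp add: algebra_simps)
    qed
    have "((\<lambda>w. (X w - a) * (X w - b)) \<longlongrightarrow> 0) (at (complex_of_real x) within quadrant)"
    proof (rule Lim_null_comparison)
      show "((\<lambda>w. cmod (2 * (F w - F0))) \<longlongrightarrow> 0) (at (complex_of_real x) within quadrant)"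
        using Ftends by (intro tendsto_norm_zero tendsto_mult_right_zero) (simp add: LIM_zero)
      have "norm ((X w - a) * (X w - b)) \<le> cmod (2 * (F w - F0))" if "w \<in> quadrant" for w
      proof -
        have "cmod (X w) \<le> 1" using h_Im[OF that] by (simp add: X_def)
        thus ?thesis unfolding roots[OF that] norm_mult[of _ "X w"]
          by (simp add: mult_left_le)
      qed
      thus "\<forall>\<^sub>F w in at (complex_of_real x) within quadrant. norm ((X w - a) * (X w - b)) \<le> cmod (2 * (F w - F0))"
        by (simp add: eventually_at_filter)
    qed
    from tendsto_one_of_two_roots[OF X_cont connected_quadrant_ball real_not_in_quadrant this]
    obtain X0 where X0: "X0 = a \<or> X0 = b" "(X \<longlongrightarrow> X0) (at (complex_of_real x) within quadrant)" by blast
    have "X0 \<noteq> 0" using X0(1) ab(1) by auto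
    thus ?thesis using tendsto_of_tendsto_exp[of quadrant h "complex_of_real x" X0] X0(2)
      connected_quadrant_ball real_not_in_quadrant holomorphic_on_imp_continuous_on[OF h_hol]
      by (auto simp: X_def[abs_def])
  qed
  \<comment> \<open>On the real axis \<open>k\<close> is defined as the limit from the quadrant, so
    continuity up to the axis is built in. At other points outside the quadrant the choice is
    arbitrary.\<close>
  define k where "k w = (if w \<in> quadrant then h w else SOME l. (h \<longlongrightarrow> l) (at w within quadrant))" for w
  have k_h: "k w = h w" if "w \<in> quadrant" for w using that by (simp add: k_def)
  have "(k \<longlongrightarrow> k (complex_of_real x)) (at (complex_of_real x) within quadrant)" for x
  proof -
    have "(h \<longlongrightarrow> k (complex_of_real x)) (at (complex_of_real x) within quadrant)"
      using someI_ex[OF lim[of x]] real_not_in_quadrant[of x] by (simp add: k_def)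
    thus ?thesis
      by (rule Lim_transform_eventually) (simp add: eventually_at_filter k_h)
  qed
  moreover have "k holomorphic_on quadrant"
    by (rule holomorphic_transform[OF h_hol]) (simp add: k_h)
  ultimately have "dispersion_relation F k"
    unfolding dispersion_relation_def Let_def quadrant_def[symmetric]
    using h_Im h_cos k_h by auto
  thus ?thesis by (intro exI[of _ k])
qed


section \<open>The derivative of \<open>k\<close> along the real axis\<close>

context
  fixes F k :: "complex \<Rightarrow> complex" and x :: real
  assumes k: "dispersion_relation F k" and x: "x > 0" and F: "continuous_on UNIV F"
begin

lemma dispersion_tendsto:
  "y \<ge> 0 \<Longrightarrow> (k \<longlongrightarrow> k (complex_of_real y)) (at (complex_of_real y) within quadrant)"
  using k by (simp add: dispersion_relation_def Let_def quadrant_def)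

lemma dispersion_continuous: "continuous_on quadrant k"
  using k by (simp add: dispersion_relation_def Let_def quadrant_def holomorphic_on_imp_continuous_on)

lemma dispersion_quadrant:
  "w \<in> quadrant \<Longrightarrow> 0 < Im (k w)" "w \<in> quadrant \<Longrightarrow> cos (k w) = F w"
  using k by (simp_all add: dispersion_relation_def Let_def quadrant_def)

lemma dispersion_cos_real:
  assumes "y \<ge> 0"
  shows "cos (k (complex_of_real y)) = F (complex_of_real y)"
proof (rule tendsto_unique[OF quadrant_approaches_real[OF assms]])
  show "((\<lambda>w. cos (k w)) \<longlongrightarrow> cos (k (complex_of_real y))) (at (complex_of_real y) within quadrant)"
    by (intro tendsto_intros dispersion_tendsto assms)
  have "isCont F (complex_of_real y)" using F by (simp add: continuous_on_eq_continuous_at)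
  hence "(F \<longlongrightarrow> F (complex_of_real y)) (at (complex_of_real y) within quadrant)"
    unfolding isCont_def by (rule tendsto_within_subset) simp
  thus "((\<lambda>w. cos (k w)) \<longlongrightarrow> F (complex_of_real y)) (at (complex_of_real y) within quadrant)"
    by (rule Lim_transform_eventually) (simp add: eventually_at_filter dispersion_quadrant)
qed

text \<open>Implicit differentiation of cos k = f, possible since |f| < 1 makes \<open>k\<close>
  real with sin k nonzero at \<open>x\<close>. The result is k' = - f' / sin k; squaring replaces
  sin k by 1 - f^2, and the square is what a bound on the size of the velocity requires.\<close>

lemma dispersion_derivative_inside_band:
  assumes f: "\<And>y. y > 0 \<Longrightarrow> F (complex_of_real y) = complex_of_real (f y)"
    and f': "(f has_real_derivative f') (at x)" and fx: "\<bar>f x\<bar> < 1"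
  obtains D where "((\<lambda>y. k (complex_of_real y)) has_vector_derivative complex_of_real D) (at x)"
    "D\<^sup>2 * (1 - (f x)\<^sup>2) = f'\<^sup>2"
proof -
  define \<kappa> where "\<kappa> = Re (k (complex_of_real x))"
  have cos: "cos (k (complex_of_real y)) = complex_of_real (f y)" if "y > 0" for y
    using dispersion_cos_real[of y] f[of y] that by simp
  have k0: "k (complex_of_real x) = complex_of_real \<kappa>"
    using cos_in_unit_interval_imp_real[OF cos[OF x]] fx by (simp add: \<kappa>_def complex_eq_iff)
  have "complex_of_real (cos \<kappa>) = complex_of_real (f x)"
    using cos[OF x] by (simp add: k0 cos_of_real)
  hence cosk: "cos \<kappa> = f x" by (simp only: of_real_eq_iff)
  have sin2: "(sin \<kappa>)\<^sup>2 = 1 - (f x)\<^sup>2" by (simp add: sin_squared_eq cosk)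
  have "(f x)\<^sup>2 < 1" using fx by (simp add: abs_square_less_1)
  hence sin0: "sin \<kappa> \<noteq> 0" using sin2 by auto
  \<comment> \<open>As \<open>k\<close> is only known to be continuous here, the Caratheodory form
    of the derivative of cos is used: it writes the increment of the cosine as a continuous multiple
    \<open>g\<close> of the increment of \<open>k\<close>, and division by \<open>g\<close> leaves
    the difference quotient of \<open>k\<close>.\<close>
  have "DERIV cos (complex_of_real \<kappa>) :> - sin (complex_of_real \<kappa>)" by (rule DERIV_cos)
  then obtain g where g: "\<And>z. cos z - cos (complex_of_real \<kappa>) = g z * (z - complex_of_real \<kappa>)"
    "isCont g (complex_of_real \<kappa>)" "g (complex_of_real \<kappa>) = - sin (complex_of_real \<kappa>)"
    unfolding CARAT_DERIV by blast
  have klim: "((\<lambda>y. k (complex_of_real y)) \<longlongrightarrow> complex_of_real \<kappa>) (at x)"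
    using tendsto_quadrant_imp_real[OF x dispersion_tendsto] x dispersion_tendsto k0 by simp
  have glim: "((\<lambda>y. g (k (complex_of_real y))) \<longlongrightarrow> - sin (complex_of_real \<kappa>)) (at x)"
    using isCont_tendsto_compose[OF g(2) klim] g(3) by simp
  have s0: "sin (complex_of_real \<kappa>) \<noteq> 0" using sin0 by (simp add: sin_of_real)
  have "((\<lambda>y. (f y - f x) / (y - x)) \<longlongrightarrow> f') (at x)"
    using f' by (simp add: has_field_derivative_iff)
  hence "((\<lambda>y. complex_of_real ((f y - f x) / (y - x)) / g (k (complex_of_real y))) \<longlongrightarrow>
      complex_of_real f' / - sin (complex_of_real \<kappa>)) (at x)"
    using s0 by (intro tendsto_intros glim) auto
  moreover have "\<forall>\<^sub>F y in at x. complex_of_real ((f y - f x) / (y - x)) / g (k (complex_of_real y)) =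
      (k (complex_of_real y) - k (complex_of_real x)) / complex_of_real (y - x)"
  proof -
    have "\<forall>\<^sub>F y in at x. g (k (complex_of_real y)) \<noteq> 0"
      using s0 by (intro tendsto_imp_eventually_ne[OF glim]) simp
    moreover have "\<forall>\<^sub>F y in at x. y > 0"
      using eventually_at_in_open'[of "{0<..}" x] x by simp
    ultimately show ?thesis
    proof eventually_elim
      case (elim y)
      have "complex_of_real (f y - f x) = g (k (complex_of_real y)) * (k (complex_of_real y) - k (complex_of_real x))"
        using g(1)[of "k (complex_of_real y)"] cos[OF elim(2)] cos[OF x] by (simp add: k0)
      thus ?case using elim(1) by (simp add: of_real_divide del: of_real_diff)
    qed
  qed
  ultimately have "((\<lambda>y. (k (complex_of_real y) - k (complex_of_real x)) / complex_of_real (y - x)) \<longlongrightarrow>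
      complex_of_real (- f' / sin \<kappa>)) (at x)"
    by (rule Lim_transform_eventually[THEN tendsto_eq_rhs]) (simp add: sin_of_real)
  hence "((\<lambda>y. k (complex_of_real y)) has_vector_derivative complex_of_real (- f' / sin \<kappa>)) (at x)"
    by (rule has_vector_derivative_quotientI)
  moreover have "(- f' / sin \<kappa>)\<^sup>2 * (1 - (f x)\<^sup>2) = f'\<^sup>2"
    using sin0 by (simp add: sin2[symmetric] power_divide)
  ultimately show ?thesis by (rule that)
qed

text \<open>
  With \<open>S = sin ((k - k(x)) / 2)\<close> one has \<open>2 S\<^sup>2 = (w - x)\<^sup>2 G\<close>, so \<open>S = \<plusminus>(w - x) sqrt (G / 2)\<close> with one
  sign on a half disc at \<open>x\<close>, and \<open>Im k > 0\<close> picks the plus sign.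
\<close>

lemma dispersion_derivative_degenerate_edge:
  assumes \<sigma>: "\<sigma> = 1 \<or> \<sigma> = (-1::complex)"
    and FG: "\<And>w. Re w > 0 \<Longrightarrow> F w = \<sigma> * (1 - (w - complex_of_real x)\<^sup>2 * G w)"
    and G: "(G \<longlongrightarrow> complex_of_real G0) (at (complex_of_real x))" and G0: "G0 > 0"
  shows "((\<lambda>y. k (complex_of_real y)) has_vector_derivative complex_of_real (sqrt (2 * G0))) (at x)"
proof -
  define k0 where "k0 = k (complex_of_real x)"
  define S where "S w = sin ((k w - k0) / 2)" for w
  define X where "X = complex_of_real x"
  have cosk0: "cos k0 = \<sigma>"
    using dispersion_cos_real[of x] x FG[of "complex_of_real x"] by (simp add: k0_def)
  have "sin k0 ^ 2 = 0" using \<sigma> by (auto simp: sin_squared_eq cosk0)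
  hence sink0: "sin k0 = 0" by simp
  have Imk0: "Im k0 = 0"
    using \<sigma> cos_in_unit_interval_imp_real[of k0 1] cos_in_unit_interval_imp_real[of k0 "-1"] cosk0 by auto
  \<comment> \<open>Since sin k0 = 0 and cos k0 = \<sigma>, the addition formula gives cos (k - k0)
    = \<sigma> F, and the half-angle formula turns 1 - \<sigma> F into 2 S^2.\<close>
  have S2: "2 * (S w)\<^sup>2 = (w - X)\<^sup>2 * G w" if "w \<in> quadrant" for w
  proof -
    have "2 * (S w)\<^sup>2 = 1 - cos (k w - k0)"
      using cos_double_sin[of "(k w - k0) / 2"] by (simp add: S_def del: distrib_left_numeral right_diff_distrib_numeral)
    also have "cos (k w - k0) = \<sigma> * F w"
      using dispersion_quadrant(2)[OF that] by (simp add: cos_diff cosk0 sink0)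
    finally show ?thesis
      using FG[of w] that \<sigma> by (auto simp: quadrant_def X_def)
  qed
  obtain r where r: "r > 0" "\<And>w. w \<in> quadrant \<Longrightarrow> dist w X < r \<Longrightarrow> dist (G w) (complex_of_real G0) < G0"
    using tendstoD[OF tendsto_within_subset[OF G, of quadrant] G0]
    unfolding eventually_at_within_notin[OF real_not_in_quadrant] X_def by auto
  let ?Q = "quadrant \<inter> ball X r"
  have ev: "\<forall>\<^sub>F w in at X within quadrant. w \<in> ?Q"
    unfolding eventually_at using r(1) by (auto simp: dist_commute)
  have ReG: "Re (G w) > 0" if "w \<in> ?Q" for w
    using r(2)[of w] that abs_Re_le_cmod[of "G w - complex_of_real G0"] by (auto simp: dist_norm dist_commute norm_minus_commute)
  define R where "R w = csqrt (G w / 2)" for w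
  have neX: "w \<noteq> X" if "w \<in> quadrant" for w using that real_not_in_quadrant X_def by auto
  have G_cont: "continuous_on quadrant G"
  proof (rule continuous_on_eq)
    show "continuous_on quadrant (\<lambda>w. (1 - \<sigma> * F w) / (w - X)\<^sup>2)"
      using neX by (intro continuous_intros continuous_on_subset[OF F]) auto
    show "(1 - \<sigma> * F w) / (w - X)\<^sup>2 = G w" if "w \<in> quadrant" for w
      using neX[OF that] FG[of w] that \<sigma> by (auto simp: quadrant_def X_def)
  qed
  have R_cont: "continuous_on ?Q R" unfolding R_def
  proof (rule continuous_on_compose2[OF continuous_on_csqrt])
    show "continuous_on ?Q (\<lambda>w. G w / 2)" by (intro continuous_intros continuous_on_subset[OF G_cont]) auto
    show "(\<lambda>w. G w / 2) ` ?Q \<subseteq> - \<real>\<^sub>\<le>\<^sub>0" using ReG by (force simp: complex_nonpos_Reals_iff)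
  qed
  have R0: "R w \<noteq> 0" if "w \<in> ?Q" for w using ReG[OF that] by (auto simp: R_def)
  \<comment> \<open>The undetermined sign as a function: it is continuous because Re G > 0 keeps
    \<open>R\<close> off the branch cut and away from \<open>0\<close>, and its square is 1.\<close>
  define t where "t w = S w / ((w - X) * R w)" for w
  have t_cases: "t w = 1 \<or> t w = -1" if w: "w \<in> ?Q" for w
  proof -
    have wq: "w \<in> quadrant" using w by simp
    have ne: "((w - X) * R w)\<^sup>2 \<noteq> 0" using R0[OF w] neX[OF wq] by simp
    have "2 * (S w)\<^sup>2 = 2 * ((w - X) * R w)\<^sup>2"
      unfolding S2[OF wq] by (simp add: R_def power_mult_distrib)
    hence "(S w)\<^sup>2 = ((w - X) * R w)\<^sup>2" by simp
    hence "(t w)\<^sup>2 = 1" unfolding t_def power_divide using ne by simp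
    thus ?thesis by (simp add: power2_eq_1_iff)
  qed
  have "t constant_on ?Q"
  proof (rule continuous_discrete_range_constant[OF connected_quadrant_ball])
    show "continuous_on ?Q t" unfolding t_def S_def
      using R0 neX by (intro continuous_intros R_cont continuous_on_subset[OF dispersion_continuous]) auto
    show "\<exists>e>0. \<forall>y. y \<in> ?Q \<and> t y \<noteq> t x \<longrightarrow> e \<le> cmod (t y - t x)" if "x \<in> ?Q" for x
      using t_cases[OF that] t_cases by (intro exI[of _ 1]) fastforce
  qed
  then obtain s where s: "\<And>w. w \<in> ?Q \<Longrightarrow> t w = s" unfolding constant_on_def by blast
  have "?Q \<noteq> {}"
    using eventually_happens'[OF quadrant_approaches_real ev[unfolded X_def]] x X_def by auto
  hence s_cases: "s = 1 \<or> s = -1" using t_cases s by fastforce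
  have klim: "((\<lambda>w. k w - k0) \<longlongrightarrow> 0) (at X within quadrant)"
    using dispersion_tendsto[of x] x by (simp add: LIM_zero k0_def X_def)
  have "DERIV (\<lambda>u. sin (u / 2)) (0::complex) :> 1/2" by (auto intro!: derivative_eq_intros)
  then obtain c where c: "\<And>u. sin (u / 2) - sin (0 / 2) = c u * (u - (0::complex))" "isCont c 0" "c 0 = 1/2"
    unfolding CARAT_DERIV by blast
  have clim: "((\<lambda>w. c (k w - k0)) \<longlongrightarrow> 1/2) (at X within quadrant)"
    using isCont_tendsto_compose[OF c(2) klim] c(3) by simp
  have cne: "\<forall>\<^sub>F w in at X within quadrant. c (k w - k0) \<noteq> 0"
    by (rule tendsto_imp_eventually_ne[OF clim]) simp
  have Rlim: "(R \<longlongrightarrow> complex_of_real (sqrt (G0/2))) (at X within quadrant)"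
  proof -
    have "((\<lambda>w. G w / 2) \<longlongrightarrow> complex_of_real (G0/2)) (at X within quadrant)"
      using tendsto_divide[OF tendsto_within_subset[OF G, of quadrant] tendsto_const, of 2] by (simp add: X_def)
    moreover have "isCont csqrt (complex_of_real (G0/2))"
      using G0 by (intro continuous_at_csqrt) (auto simp: complex_nonpos_Reals_iff)
    ultimately have "(R \<longlongrightarrow> csqrt (complex_of_real (G0/2))) (at X within quadrant)"
      unfolding R_def by (rule isCont_tendsto_compose[rotated])
    thus ?thesis using G0 by (simp add: csqrt_of_real_nonneg del: of_real_divide)
  qed
  define Qt where "Qt w = (k w - k0) / (w - X)" for w
  define d where "d = s * complex_of_real (sqrt (2 * G0))"
  have d_eq: "s * complex_of_real (sqrt (G0/2)) / (1/2) = d"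
  proof -
    have "sqrt (2 * G0) = sqrt (4 * (G0 / 2))" by simp
    also have "\<dots> = 2 * sqrt (G0/2)" by (subst real_sqrt_mult) simp
    finally show ?thesis by (simp add: d_def)
  qed
  have "((\<lambda>w. s * R w / c (k w - k0)) \<longlongrightarrow> d) (at X within quadrant)"
    unfolding d_eq[symmetric] by (intro tendsto_intros Rlim clim) simp
  moreover have "\<forall>\<^sub>F w in at X within quadrant. s * R w / c (k w - k0) = Qt w"
    using ev cne
  proof eventually_elim
    case (elim w)
    have "S w = c (k w - k0) * (k w - k0)" using c(1)[of "k w - k0"] by (simp add: S_def)
    moreover have "S w = s * ((w - X) * R w)"
      using s[OF elim(1)] R0[OF elim(1)] neX elim(1) by (auto simp: t_def field_simps)
    ultimately have "c (k w - k0) * (k w - k0) = s * R w * (w - X)" by (simp add: mult_ac)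
    thus ?case using elim neX[of w] by (simp add: Qt_def frac_eq_eq mult_ac)
  qed
  ultimately have Qtlim: "(Qt \<longlongrightarrow> d) (at X within quadrant)" by (rule Lim_transform_eventually)
  have "s = 1"
  proof (rule ccontr)
    assume "s \<noteq> 1"
    hence "s = -1" using s_cases by simp
    hence "Re d < 0" using G0 by (simp add: d_def)
    hence "\<forall>\<^sub>F w in at X within quadrant. Re (Qt w) < 0"
      by (intro order_tendstoD(2)[OF tendsto_Re[OF Qtlim]])
    then obtain e where e: "e > 0" "\<And>w. w \<in> quadrant \<Longrightarrow> dist w X < e \<Longrightarrow> Re (Qt w) < 0"
      unfolding X_def eventually_at_within_notin[OF real_not_in_quadrant] by auto
    \<comment> \<open>Test point straight above \<open>X\<close>. There Im (k - k0) equals the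
      height times the real part of the quotient, and k0 is real, so a negative sign would make Im k
      negative.\<close>
    define w where "w = X + \<i> * complex_of_real (e/2)"
    have w: "w \<in> quadrant" using x e(1) by (simp add: w_def X_def quadrant_def)
    have "dist w X < e" using e(1) by (simp add: w_def dist_norm norm_mult)
    hence "Re (Qt w) < 0" using e(2) w by simp
    moreover have "k w - k0 = Qt w * (\<i> * complex_of_real (e/2))"
      using e(1) by (simp add: Qt_def w_def)
    hence "Im (k w - k0) = Im (Qt w * (\<i> * complex_of_real (e/2)))" by (simp only:)
    hence "Im (k w - k0) = Re (Qt w) * (e/2)" by (simp del: of_real_divide)
    moreover have "e / 2 > 0" using e(1) by simp
    ultimately have "Im (k w - k0) < 0" by (simp only: mult_neg_pos)
    thus False using dispersion_quadrant(1)[OF w] Imk0 by simp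
  qed
  have "((\<lambda>y. Qt (complex_of_real y)) \<longlongrightarrow> d) (at x)"
  proof (rule tendsto_quadrant_imp_real[OF x])
    show "(Qt \<longlongrightarrow> d) (at (complex_of_real x) within quadrant)" using Qtlim by (simp add: X_def)
    show "(Qt \<longlongrightarrow> Qt (complex_of_real y)) (at (complex_of_real y) within quadrant)" if "y > 0" "y \<noteq> x" for y
      unfolding Qt_def using that by (intro tendsto_intros dispersion_tendsto) (auto simp: X_def)
  qed
  thus ?thesis
    by (intro has_vector_derivative_quotientI) (simp add: Qt_def X_def k0_def d_def \<open>s = 1\<close>)
qed

end

section \<open>Fundamental solutions and the discriminant\<close>

lemma integral_complex_of_real_Icc:
  fixes f :: "real \<Rightarrow> real"
  assumes "continuous_on {a..b} f"
  shows "integral {a..b} (\<lambda>t. complex_of_real (f t)) = complex_of_real (integral {a..b} f)"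
  using integral_linear[OF integrable_continuous_real[OF assms] bounded_linear_of_real[where 'a=complex]]
  by (simp add: o_def)

text \<open>Common interface of the piecewise smooth potentials and the delta comb. No regularity in
  \<open>E\<close> is assumed, only boundedness on bounded sets of energies; continuity and
  differentiability in \<open>E\<close> are then derived from the Lagrange identity.\<close>

locale fundamental_family =
  fixes q m :: "real \<Rightarrow> real" and L :: real and \<psi>1 \<phi>1 \<psi>2 \<phi>2 :: "complex \<Rightarrow> real \<Rightarrow> complex"
  assumes L: "L > 0"
    and sol1: "schroedinger_solution q m L E (\<psi>1 E) (\<phi>1 E)"
    and sol2: "schroedinger_solution q m L E (\<psi>2 E) (\<phi>2 E)"
    and init1 [simp]: "\<psi>1 E 0 = 1" "\<phi>1 E 0 = 0"
    and init2 [simp]: "\<psi>2 E 0 = 0" "\<phi>2 E 0 = 1"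
    and bdd1: "\<exists>B. \<forall>E x. cmod E \<le> R \<longrightarrow> x \<in> {0..L} \<longrightarrow> cmod (\<psi>1 E x) \<le> B"
    and bdd2: "\<exists>B. \<forall>E x. cmod E \<le> R \<longrightarrow> x \<in> {0..L} \<longrightarrow> cmod (\<psi>2 E x) \<le> B"
begin

lemma cont1: "continuous_on {0..L} (\<psi>1 E)" and cont2: "continuous_on {0..L} (\<psi>2 E)"
  using sol1 sol2 by (blast intro: schroedinger_solution_continuous)+

lemma wronskian:
  assumes "x \<in> {0..L}"
  shows "\<psi>1 E x * \<phi>2 E x - \<phi>1 E x * \<psi>2 E x = 1"
  using lagrange_identity[OF sol1 sol2 assms, of E E] by simp

text \<open>The Lagrange identity against \<open>\<psi>1 E\<close> and \<open>\<psi>2 E\<close>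
  gives two linear equations for \<open>\<psi> x\<close> and \<open>\<phi> x\<close>; their
  determinant is the Wronskian 1, and Cramer's rule solves them. For equal energies the integral
  terms drop out, which is uniqueness for the Cauchy problem.\<close>

lemma variation_of_parameters:
  fixes E :: complex
  assumes s: "schroedinger_solution q m L E' \<psi> \<phi>" and x: "x \<in> {0..L}"
  defines "J1 \<equiv> integral {0..x} (\<lambda>t. \<psi>1 E t * \<psi> t)" and "J2 \<equiv> integral {0..x} (\<lambda>t. \<psi>2 E t * \<psi> t)"
  shows "\<psi> x = \<psi> 0 * \<psi>1 E x + \<phi> 0 * \<psi>2 E x + (E - E') * (\<psi>2 E x * J1 - \<psi>1 E x * J2)"
    and "\<phi> x = \<psi> 0 * \<phi>1 E x + \<phi> 0 * \<phi>2 E x + (E - E') * (\<phi>2 E x * J1 - \<phi>1 E x * J2)"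
proof -
  have e1: "(E - E') * J1 = \<psi>1 E x * \<phi> x - \<phi>1 E x * \<psi> x - \<phi> 0"
    using lagrange_identity[OF sol1[of E] s x] by (simp add: J1_def)
  have e2: "(E - E') * J2 = \<psi>2 E x * \<phi> x - \<phi>2 E x * \<psi> x + \<psi> 0"
    using lagrange_identity[OF sol2[of E] s x] by (simp add: J2_def)
  have w: "\<psi>1 E x * \<phi>2 E x = 1 + \<phi>1 E x * \<psi>2 E x" using wronskian[OF x, of E] by (simp add: algebra_simps)
  have "\<psi> x = \<psi> x * (\<psi>1 E x * \<phi>2 E x - \<phi>1 E x * \<psi>2 E x)" by (simp only: wronskian[OF x] mult_1_right)
  also have "\<dots> = \<psi> 0 * \<psi>1 E x + \<phi> 0 * \<psi>2 E x + \<psi>2 E x * ((E - E') * J1) - \<psi>1 E x * ((E - E') * J2)"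
    unfolding e1 e2 by (simp add: algebra_simps)
  finally show "\<psi> x = \<psi> 0 * \<psi>1 E x + \<phi> 0 * \<psi>2 E x + (E - E') * (\<psi>2 E x * J1 - \<psi>1 E x * J2)"
    by (simp add: algebra_simps)
  have "\<phi> x = \<phi> x * (\<psi>1 E x * \<phi>2 E x - \<phi>1 E x * \<psi>2 E x)" by (simp only: wronskian[OF x] mult_1_right)
  also have "\<dots> = \<psi> 0 * \<phi>1 E x + \<phi> 0 * \<phi>2 E x + \<phi>2 E x * ((E - E') * J1) - \<phi>1 E x * ((E - E') * J2)"
    unfolding e1 e2 by (simp add: algebra_simps)
  finally show "\<phi> x = \<psi> 0 * \<phi>1 E x + \<phi> 0 * \<phi>2 E x + (E - E') * (\<phi>2 E x * J1 - \<phi>1 E x * J2)"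
    by (simp add: algebra_simps)
qed

lemma solution_unique:
  assumes "schroedinger_solution q m L E \<psi> \<phi>" "x \<in> {0..L}"
  shows "\<psi> x = \<psi> 0 * \<psi>1 E x + \<phi> 0 * \<psi>2 E x" "\<phi> x = \<psi> 0 * \<phi>1 E x + \<phi> 0 * \<phi>2 E x"
  using variation_of_parameters[OF assms, of E] by simp_all

definition "discriminant E = \<psi>1 E L + \<phi>2 E L"

text \<open>Removes the choice operator: linear combinations of the two families show that a chosen
  solution has the required data, and uniqueness determines its values at \<open>L\<close>. The
  factors \<omega> and 1 / \<omega> sit off the diagonal and do not enter the trace.\<close>

lemma half_trace_eq: "half_trace q m L \<omega> = discriminant (\<omega>\<^sup>2) / 2"
proof -
  have c: "schroedinger_solution q m L E (fst (cauchy_solution q m L E a b)) (snd (cauchy_solution q m L E a b)) \<and>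
     fst (cauchy_solution q m L E a b) 0 = a \<and> snd (cauchy_solution q m L E a b) 0 = b" for E a b
    unfolding cauchy_solution_def
    using schroedinger_solution_linear[OF sol1 sol2, of E a b]
    by (intro someI_ex[of "\<lambda>s. schroedinger_solution q m L E (fst s) (snd s) \<and> fst s 0 = a \<and> snd s 0 = b"]
        exI[of _ "(\<lambda>x. a * \<psi>1 E x + b * \<psi>2 E x, \<lambda>x. a * \<phi>1 E x + b * \<phi>2 E x)"]) simp
  have L': "L \<in> {0..L}" using L by simp
  have "fst (cauchy_solution q m L (\<omega>\<^sup>2) 1 0) L = \<psi>1 (\<omega>\<^sup>2) L"
    using solution_unique(1)[OF c[THEN conjunct1] L', of "\<omega>\<^sup>2" 1 0] c[of "\<omega>\<^sup>2" 1 0] by simp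
  moreover have "snd (cauchy_solution q m L (\<omega>\<^sup>2) 0 1) L = \<phi>2 (\<omega>\<^sup>2) L"
    using solution_unique(2)[OF c[THEN conjunct1] L', of "\<omega>\<^sup>2" 0 1] c[of "\<omega>\<^sup>2" 0 1] by simp
  ultimately show ?thesis
    by (simp add: half_trace_def monodromy_matrix_def discriminant_def trace_def sum_2
        case_prod_beta Let_def)
qed

text \<open>Variation of parameters writes the difference of two members as (E - E') times integrals
  of products of solutions, all of which are bounded for energies within distance 1 of
  \<open>E\<close>. The abstract family stands for either of the two fundamental ones.\<close>

lemma family_lipschitz:
  assumes sol: "\<And>E. schroedinger_solution q m L E (\<psi> E) (\<phi> E)"
    and init: "\<And>E. \<psi> E 0 = \<alpha>" "\<And>E. \<phi> E 0 = \<beta>"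
    and bdd: "\<And>R. \<exists>B. \<forall>E x. cmod E \<le> R \<longrightarrow> x \<in> {0..L} \<longrightarrow> cmod (\<psi> E x) \<le> B"
  obtains C where "\<And>E' x. cmod (E' - E) \<le> 1 \<Longrightarrow> x \<in> {0..L} \<Longrightarrow> cmod (\<psi> E' x - \<psi> E x) \<le> C * cmod (E' - E)"
proof -
  let ?R = "cmod E + 1"
  obtain B1 where B1: "\<And>E x. cmod E \<le> ?R \<Longrightarrow> x \<in> {0..L} \<Longrightarrow> cmod (\<psi>1 E x) \<le> B1" using bdd1 by metis
  obtain B2 where B2: "\<And>E x. cmod E \<le> ?R \<Longrightarrow> x \<in> {0..L} \<Longrightarrow> cmod (\<psi>2 E x) \<le> B2" using bdd2 by metis
  obtain B where B: "\<And>E x. cmod E \<le> ?R \<Longrightarrow> x \<in> {0..L} \<Longrightarrow> cmod (\<psi> E x) \<le> B" using bdd by metis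
  have nonneg: "0 \<le> B1" "0 \<le> B2" "0 \<le> B"
    using order_trans[OF norm_ge_zero B1[of E 0]] order_trans[OF norm_ge_zero B2[of E 0]]
      order_trans[OF norm_ge_zero B[of E 0]] L by simp_all
  have "cmod (\<psi> E' x - \<psi> E x) \<le> (B2 * (B1 * B * L) + B1 * (B2 * B * L)) * cmod (E' - E)"
    if E': "cmod (E' - E) \<le> 1" and x: "x \<in> {0..L}" for E' x
  proof -
    have E'R: "cmod E' \<le> ?R" using norm_triangle_sub[of E' E] E' by simp
    have cont: "continuous_on {0..x} (\<psi> E')" "continuous_on {0..x} (\<psi>1 E)" "continuous_on {0..x} (\<psi>2 E)"
      by (rule continuous_on_subset[OF schroedinger_solution_continuous[OF sol]] continuous_on_subset[OF cont1]
          continuous_on_subset[OF cont2], use x in auto)+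
    have J: "cmod (integral {0..x} (\<lambda>t. \<psi>1 E t * \<psi> E' t)) \<le> B1 * B * L"
      "cmod (integral {0..x} (\<lambda>t. \<psi>2 E t * \<psi> E' t)) \<le> B2 * B * L"
    proof -
      have "cmod (integral {0..x} (\<lambda>t. \<psi>1 E t * \<psi> E' t)) \<le> B1 * B * (x - 0)"
        using x E'R by (intro integral_bound continuous_intros cont)
          (auto simp: norm_mult intro!: mult_mono B1 B nonneg)
      also have "\<dots> \<le> B1 * B * L" using x nonneg by (intro mult_left_mono) auto
      finally show "cmod (integral {0..x} (\<lambda>t. \<psi>1 E t * \<psi> E' t)) \<le> B1 * B * L" .
      have "cmod (integral {0..x} (\<lambda>t. \<psi>2 E t * \<psi> E' t)) \<le> B2 * B * (x - 0)"
        using x E'R by (intro integral_bound continuous_intros cont)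
          (auto simp: norm_mult intro!: mult_mono B2 B nonneg)
      also have "\<dots> \<le> B2 * B * L" using x nonneg by (intro mult_left_mono) auto
      finally show "cmod (integral {0..x} (\<lambda>t. \<psi>2 E t * \<psi> E' t)) \<le> B2 * B * L" .
    qed
    have "\<psi> E' x - \<psi> E x = (E - E') * (\<psi>2 E x * integral {0..x} (\<lambda>t. \<psi>1 E t * \<psi> E' t)
        - \<psi>1 E x * integral {0..x} (\<lambda>t. \<psi>2 E t * \<psi> E' t))"
      using variation_of_parameters(1)[OF sol[of E'] x, of E] solution_unique(1)[OF sol[of E] x]
      by (simp add: init)
    also have "cmod \<dots> \<le> cmod (E - E') * (B2 * (B1 * B * L) + B1 * (B2 * B * L))"
      unfolding norm_mult
    proof (intro mult_left_mono order_trans[OF norm_triangle_ineq4] add_mono)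
      show "cmod (\<psi>2 E x * integral {0..x} (\<lambda>t. \<psi>1 E t * \<psi> E' t)) \<le> B2 * (B1 * B * L)"
        unfolding norm_mult using nonneg L x by (intro mult_mono J B2) auto
      show "cmod (\<psi>1 E x * integral {0..x} (\<lambda>t. \<psi>2 E t * \<psi> E' t)) \<le> B1 * (B2 * B * L)"
        unfolding norm_mult using nonneg L x by (intro mult_mono J B1) auto
    qed auto
    finally show ?thesis by (simp add: norm_minus_commute mult.commute)
  qed
  thus ?thesis by (rule that)
qed

lemma mixed_integral_tendsto:
  assumes sol: "\<And>E. schroedinger_solution q m L E (\<psi> E) (\<phi> E)"
    and init: "\<And>E. \<psi> E 0 = \<alpha>" "\<And>E. \<phi> E 0 = \<beta>"
    and bdd: "\<And>R. \<exists>B. \<forall>E x. cmod E \<le> R \<longrightarrow> x \<in> {0..L} \<longrightarrow> cmod (\<psi> E x) \<le> B"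
    and u: "continuous_on {0..L} u"
  shows "((\<lambda>E'. integral {0..L} (\<lambda>t. u t * \<psi> E' t)) \<longlongrightarrow> integral {0..L} (\<lambda>t. u t * \<psi> E t)) (at E)"
proof -
  obtain C where C: "\<And>E' x. cmod (E' - E) \<le> 1 \<Longrightarrow> x \<in> {0..L} \<Longrightarrow> cmod (\<psi> E' x - \<psi> E x) \<le> C * cmod (E' - E)"
    using family_lipschitz[OF sol init bdd] by metis
  have "bounded (u ` {0..L})" by (intro compact_imp_bounded compact_continuous_image u) auto
  then obtain U where U: "U > 0" "\<And>x. x \<in> {0..L} \<Longrightarrow> cmod (u x) \<le> U" unfolding bounded_pos by auto
  have cont: "continuous_on {0..L} (\<psi> E)" for E by (rule schroedinger_solution_continuous[OF sol])
  have "((\<lambda>E'. integral {0..L} (\<lambda>t. u t * \<psi> E' t) - integral {0..L} (\<lambda>t. u t * \<psi> E t)) \<longlongrightarrow> 0) (at E)"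
  proof (rule Lim_null_comparison)
    have "((\<lambda>E'. U * (C * cmod (E' - E)) * L) \<longlongrightarrow> U * (C * cmod (E - E)) * L) (at E)"
      by (intro tendsto_intros)
    thus "((\<lambda>E'. U * (C * cmod (E' - E)) * L) \<longlongrightarrow> 0) (at E)" by simp
    have "norm (integral {0..L} (\<lambda>t. u t * \<psi> E' t) - integral {0..L} (\<lambda>t. u t * \<psi> E t)) \<le> U * (C * cmod (E' - E)) * L"
      if "dist E' E < 1" for E'
    proof -
      have "integral {0..L} (\<lambda>t. u t * \<psi> E' t) - integral {0..L} (\<lambda>t. u t * \<psi> E t)
          = integral {0..L} (\<lambda>t. u t * (\<psi> E' t - \<psi> E t))"
        unfolding right_diff_distrib
        by (intro Henstock_Kurzweil_Integration.integral_diff[symmetric] integrable_continuous_real continuous_intros u cont)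
      also have "cmod \<dots> \<le> U * (C * cmod (E' - E)) * (L - 0)"
        using L that U by (intro integral_bound continuous_intros u cont)
          (auto simp: norm_mult dist_norm intro!: mult_mono C)
      finally show ?thesis by simp
    qed
    thus "\<forall>\<^sub>F E' in at E. norm (integral {0..L} (\<lambda>t. u t * \<psi> E' t) - integral {0..L} (\<lambda>t. u t * \<psi> E t))
        \<le> U * (C * cmod (E' - E)) * L"
      unfolding eventually_at by (intro exI[of _ 1]) auto
  qed
  thus ?thesis by (simp add: LIM_zero_iff)
qed

text \<open>Mixed Gram integrals without conjugation, as the Lagrange identity produces them.
  \<open>I12\<close> and \<open>I21\<close> need not agree when the two energies differ.\<close>

definition "I11 E E' = integral {0..L} (\<lambda>t. \<psi>1 E t * \<psi>1 E' t)"
definition "I12 E E' = integral {0..L} (\<lambda>t. \<psi>1 E t * \<psi>2 E' t)"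
definition "I21 E E' = integral {0..L} (\<lambda>t. \<psi>2 E t * \<psi>1 E' t)"
definition "I22 E E' = integral {0..L} (\<lambda>t. \<psi>2 E t * \<psi>2 E' t)"

lemma I_tendsto:
  "(I11 E \<longlongrightarrow> I11 E E) (at E)" "(I12 E \<longlongrightarrow> I12 E E) (at E)"
  "(I21 E \<longlongrightarrow> I21 E E) (at E)" "(I22 E \<longlongrightarrow> I22 E E) (at E)"
  unfolding I11_def I12_def I21_def I22_def
  by (rule mixed_integral_tendsto[OF sol1 init1 bdd1 cont1] mixed_integral_tendsto[OF sol2 init2 bdd2 cont1]
           mixed_integral_tendsto[OF sol1 init1 bdd1 cont2] mixed_integral_tendsto[OF sol2 init2 bdd2 cont2])+

lemma endpoint_difference:
  "\<psi>1 E' L = \<psi>1 E L + (E - E') * (\<psi>2 E L * I11 E E' - \<psi>1 E L * I21 E E')"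
  "\<phi>1 E' L = \<phi>1 E L + (E - E') * (\<phi>2 E L * I11 E E' - \<phi>1 E L * I21 E E')"
  "\<psi>2 E' L = \<psi>2 E L + (E - E') * (\<psi>2 E L * I12 E E' - \<psi>1 E L * I22 E E')"
  "\<phi>2 E' L = \<phi>2 E L + (E - E') * (\<phi>2 E L * I12 E E' - \<phi>1 E L * I22 E E')"
  using variation_of_parameters[OF sol1[of E'], of L E] variation_of_parameters[OF sol2[of E'], of L E] L
  by (simp_all add: I11_def I12_def I21_def I22_def)

text \<open>By \<open>endpoint_difference\<close> the difference quotient is exactly this expression
  with \<open>E'\<close> in the second slot of the integrals, so the continuity of these integrals
  is all that remains.\<close>

lemma discriminant_has_derivative:
  "(discriminant has_field_derivative
     - (\<psi>2 E L * I11 E E - \<psi>1 E L * I21 E E + \<phi>2 E L * I12 E E - \<phi>1 E L * I22 E E)) (at E)"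
proof -
  let ?d = "\<lambda>E'. - (\<psi>2 E L * I11 E E' - \<psi>1 E L * I21 E E' + \<phi>2 E L * I12 E E' - \<phi>1 E L * I22 E E')"
  have "(?d \<longlongrightarrow> ?d E) (at E)" by (intro tendsto_intros I_tendsto)
  moreover have "\<forall>\<^sub>F E' in at E. ?d E' = (discriminant E' - discriminant E) / (E' - E)"
  proof (intro eventually_at_filter[THEN iffD2] always_eventually allI impI)
    fix E' assume "E' \<noteq> E"
    have "discriminant E' - discriminant E = (E' - E) * ?d E'"
      unfolding discriminant_def endpoint_difference[of E' E] by (simp add: algebra_simps)
    thus "?d E' = (discriminant E' - discriminant E) / (E' - E)" using \<open>E' \<noteq> E\<close> by simp
  qed
  ultimately show ?thesis unfolding has_field_derivative_iff by (rule Lim_transform_eventually)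
qed

lemma half_trace_holomorphic: "half_trace q m L holomorphic_on UNIV"
proof -
  have "discriminant holomorphic_on UNIV"
    using discriminant_has_derivative by (auto simp: holomorphic_on_def field_differentiable_def)
  hence "(\<lambda>\<omega>. discriminant (\<omega>\<^sup>2)) holomorphic_on UNIV"
    using holomorphic_on_compose_gen[of "\<lambda>\<omega>. \<omega>\<^sup>2" UNIV discriminant UNIV]
    by (simp add: o_def holomorphic_intros)
  thus ?thesis unfolding half_trace_eq[abs_def] by (intro holomorphic_intros) auto
qed

lemma solution_nonzero_integral:
  assumes ab: "\<alpha> \<noteq> 0 \<or> \<beta> \<noteq> 0"
  shows "integral {0..L} (\<lambda>t. (cmod (\<alpha> * \<psi>1 E t + \<beta> * \<psi>2 E t))\<^sup>2) > 0"
proof -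
  let ?u = "\<lambda>t. \<alpha> * \<psi>1 E t + \<beta> * \<psi>2 E t"
  have c: "continuous_on {0..L} (\<lambda>t. (cmod (?u t))\<^sup>2)" by (intro continuous_intros cont1 cont2)
  have "integral {0..L} (\<lambda>t. (cmod (?u t))\<^sup>2) \<noteq> 0"
  proof
    assume "integral {0..L} (\<lambda>t. (cmod (?u t))\<^sup>2) = 0"
    hence z: "?u t = 0" if "t \<in> {0..L}" for t
      using integral_eq_0_iff[OF c L] that by auto
    have "\<alpha> * \<phi>1 E 0 + \<beta> * \<phi>2 E 0 = 0"
      by (rule schroedinger_solution_zero[OF schroedinger_solution_linear[OF sol1 sol2] L z])
    moreover have "?u 0 = 0" using z[of 0] L by simp
    ultimately show False using ab by simp
  qed
  moreover have "integral {0..L} (\<lambda>t. (cmod (?u t))\<^sup>2) \<ge> 0"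
    by (intro Henstock_Kurzweil_Integration.integral_nonneg integrable_continuous_real c) auto
  ultimately show ?thesis by simp
qed

text \<open>A discriminant in \<open>[-2, 2]\<close> gives a Floquet multiplier of modulus one, so the energy is real by self-adjointness.\<close>

lemma discriminant_avoids:
  assumes E: "Im E \<noteq> 0" and t: "\<bar>t\<bar> \<le> 1"
  shows "discriminant E \<noteq> 2 * complex_of_real t"
proof
  assume D: "discriminant E = 2 * complex_of_real t"
  \<comment> \<open>A root of \<mu>^2 - 2 t \<mu> + 1; for real t in [-1, 1] its modulus is
    1.\<close>
  define \<mu> where "\<mu> = Complex t (sqrt (1 - t\<^sup>2))"
  have t2: "t\<^sup>2 \<le> 1" using t by (simp add: abs_square_le_1)
  have "(cmod \<mu>)\<^sup>2 = 1" using t2 by (simp add: \<mu>_def cmod_power2)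
  hence \<mu>1: "\<mu> * cnj \<mu> = 1" by (simp add: complex_norm_square[symmetric])
  have \<mu>eq: "\<mu> * \<mu> - 2 * complex_of_real t * \<mu> + 1 = 0"
  proof -
    have "sqrt (1 - t\<^sup>2) * sqrt (1 - t\<^sup>2) = 1 - t * t" using t2 by (simp add: power2_eq_square)
    thus ?thesis by (simp add: \<mu>_def complex_eq_iff algebra_simps)
  qed
  define p r s u where "p = \<psi>1 E L" and "r = \<psi>2 E L" and "s = \<phi>1 E L" and "u = \<phi>2 E L"
  have w: "p * u - s * r = 1" using wronskian[of L E] L by (simp add: p_def r_def s_def u_def)
  have tr: "p + u = 2 * complex_of_real t" using D by (simp add: discriminant_def p_def u_def)
  have char: "\<mu> * \<mu> - (p + u) * \<mu> + (p * u - s * r) = 0" using \<mu>eq by (simp add: w tr)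
  have "\<exists>\<alpha> \<beta>. (\<alpha> \<noteq> 0 \<or> \<beta> \<noteq> 0) \<and> p * \<alpha> + r * \<beta> = \<mu> * \<alpha> \<and> s * \<alpha> + u * \<beta> = \<mu> * \<beta>"
  proof (cases "r = 0")
    case False
    \<comment> \<open>The vector (r, \<mu> - p) satisfies the first eigenvector equation
      identically, and the characteristic equation is the second one.\<close>
    have "s * r + u * (\<mu> - p) = \<mu> * (\<mu> - p)" using char by (simp add: algebra_simps)
    moreover have "p * r + r * (\<mu> - p) = \<mu> * r" by (simp add: algebra_simps)
    ultimately show ?thesis using False by (intro exI[of _ r] exI[of _ "\<mu> - p"]) simp
  next
    case True
    hence "(\<mu> - p) * (\<mu> - u) = 0" using char by (simp add: algebra_simps)
    then consider "\<mu> = u" | "\<mu> = p" "p \<noteq> u" by auto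
    then show ?thesis
    proof cases
      case 1
      thus ?thesis using True by (intro exI[of _ 0] exI[of _ 1]) simp
    next
      case 2
      thus ?thesis using True by (intro exI[of _ "p - u"] exI[of _ s]) (simp add: algebra_simps)
    qed
  qed
  then obtain \<alpha> \<beta> where ab: "\<alpha> \<noteq> 0 \<or> \<beta> \<noteq> 0" "p * \<alpha> + r * \<beta> = \<mu> * \<alpha>" "s * \<alpha> + u * \<beta> = \<mu> * \<beta>" by blast
  let ?v = "\<lambda>t. \<alpha> * \<psi>1 E t + \<beta> * \<psi>2 E t" and ?v' = "\<lambda>t. \<alpha> * \<phi>1 E t + \<beta> * \<phi>2 E t"
  have sol: "schroedinger_solution q m L E ?v ?v'" by (rule schroedinger_solution_linear[OF sol1 sol2])
  have vL: "?v L = \<mu> * \<alpha>" "?v' L = \<mu> * \<beta>"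
    using ab(2,3) by (simp_all add: p_def r_def s_def u_def mult.commute)
  \<comment> \<open>The Floquet solution is paired with its own conjugate. The boundary term at
    \<open>L\<close> is |\<mu>|^2 times the one at \<open>0\<close>, so the two cancel.\<close>
  have "(E - cnj E) * integral {0..L} (\<lambda>t. ?v t * cnj (?v t)) =
      (?v L * cnj (?v' L) - ?v' L * cnj (?v L)) - (?v 0 * cnj (?v' 0) - ?v' 0 * cnj (?v 0))"
    by (rule lagrange_identity[OF sol schroedinger_solution_cnj[OF sol]]) (use L in auto)
  also have "\<dots> = (\<mu> * cnj \<mu> - 1) * (\<alpha> * cnj \<beta> - \<beta> * cnj \<alpha>)"
    unfolding vL by (simp add: algebra_simps)
  also have "\<dots> = 0" by (simp add: \<mu>1)
  finally have "integral {0..L} (\<lambda>t. ?v t * cnj (?v t)) = 0"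
    using E by (auto simp: complex_eq_iff)
  also have "(\<lambda>t. ?v t * cnj (?v t)) = (\<lambda>t. complex_of_real ((cmod (?v t))\<^sup>2))"
    by (simp only: complex_norm_square[symmetric] of_real_power)
  also have "integral {0..L} \<dots> = complex_of_real (integral {0..L} (\<lambda>t. (cmod (?v t))\<^sup>2))"
    by (intro integral_complex_of_real_Icc continuous_intros cont1 cont2)
  finally show False using solution_nonzero_integral[OF ab(1), of E] by simp
qed

lemma half_trace_avoids:
  assumes "w \<in> quadrant" "\<bar>t\<bar> \<le> 1"
  shows "half_trace q m L w \<noteq> complex_of_real t"
proof -
  have "Im (w\<^sup>2) \<noteq> 0" using assms(1) by (simp add: quadrant_def power2_eq_square)
  from discriminant_avoids[OF this assms(2)] show ?thesis by (auto simp: half_trace_eq)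
qed

lemma dispersion_relation_half_trace: "\<exists>k. dispersion_relation (half_trace q m L) k"
  by (rule dispersion_relation_exists[OF half_trace_holomorphic half_trace_avoids])

section \<open>The fundamental solutions at real energies\<close>

lemma real_solutions:
  assumes "x \<in> {0..L}"
  shows "\<psi>1 (complex_of_real e) x \<in> \<real>" "\<phi>1 (complex_of_real e) x \<in> \<real>"
    "\<psi>2 (complex_of_real e) x \<in> \<real>" "\<phi>2 (complex_of_real e) x \<in> \<real>"
proof -
  let ?E = "complex_of_real e"
  have "schroedinger_solution q m L ?E (\<lambda>x. cnj (\<psi>1 ?E x)) (\<lambda>x. cnj (\<phi>1 ?E x))"
    "schroedinger_solution q m L ?E (\<lambda>x. cnj (\<psi>2 ?E x)) (\<lambda>x. cnj (\<phi>2 ?E x))"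
    using schroedinger_solution_cnj[OF sol1, of ?E] schroedinger_solution_cnj[OF sol2, of ?E] by simp_all
  \<comment> \<open>The conjugates solve the same equation with the same real Cauchy data, so by
    uniqueness they coincide with the originals.\<close>
  note u = this[THEN solution_unique(1)[OF _ assms]] this[THEN solution_unique(2)[OF _ assms]]
  show "\<psi>1 ?E x \<in> \<real>" "\<phi>1 ?E x \<in> \<real>" "\<psi>2 ?E x \<in> \<real>" "\<phi>2 ?E x \<in> \<real>"
    using u by (simp_all add: Reals_cnj_iff)
qed

lemma half_trace_real: "half_trace q m L (complex_of_real x) = complex_of_real (Re (half_trace q m L (complex_of_real x)))"
proof -
  have "half_trace q m L (complex_of_real x) \<in> \<real>"
    using real_solutions[of L "x\<^sup>2"] L unfolding half_trace_eq discriminant_def by (auto intro!: Reals_divide)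
  thus ?thesis by (simp add: complex_is_Real_iff complex_eq_iff)
qed

context
  fixes e :: real
begin

definition "real_gram11 = integral {0..L} (\<lambda>t. (Re (\<psi>1 (complex_of_real e) t))\<^sup>2)"
definition "real_gram12 = integral {0..L} (\<lambda>t. Re (\<psi>1 (complex_of_real e) t) * Re (\<psi>2 (complex_of_real e) t))"
definition "real_gram22 = integral {0..L} (\<lambda>t. (Re (\<psi>2 (complex_of_real e) t))\<^sup>2)"

lemma I_real:
  "I11 (complex_of_real e) (complex_of_real e) = complex_of_real real_gram11"
  "I12 (complex_of_real e) (complex_of_real e) = complex_of_real real_gram12"
  "I21 (complex_of_real e) (complex_of_real e) = complex_of_real real_gram12"
  "I22 (complex_of_real e) (complex_of_real e) = complex_of_real real_gram22"
proof -
  let ?E = "complex_of_real e"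
  have r: "\<psi>1 ?E t = complex_of_real (Re (\<psi>1 ?E t))" "\<psi>2 ?E t = complex_of_real (Re (\<psi>2 ?E t))"
    if "t \<in> {0..L}" for t
    using real_solutions[OF that, of e] by (simp_all add: complex_is_Real_iff complex_eq_iff)
  have c: "continuous_on {0..L} (\<lambda>t. Re (\<psi>1 ?E t))" "continuous_on {0..L} (\<lambda>t. Re (\<psi>2 ?E t))"
    by (intro continuous_intros cont1 cont2)+
  have "I11 ?E ?E = integral {0..L} (\<lambda>t. complex_of_real ((Re (\<psi>1 ?E t))\<^sup>2))" unfolding I11_def
    by (rule Henstock_Kurzweil_Integration.integral_cong) (metis r(1) of_real_mult power2_eq_square)
  thus "I11 ?E ?E = complex_of_real real_gram11" unfolding real_gram11_def
    by (simp only: integral_complex_of_real_Icc continuous_on_power[OF c(1)])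
  have "I22 ?E ?E = integral {0..L} (\<lambda>t. complex_of_real ((Re (\<psi>2 ?E t))\<^sup>2))" unfolding I22_def
    by (rule Henstock_Kurzweil_Integration.integral_cong) (metis r(2) of_real_mult power2_eq_square)
  thus "I22 ?E ?E = complex_of_real real_gram22" unfolding real_gram22_def
    by (simp only: integral_complex_of_real_Icc continuous_on_power[OF c(2)])
  have "I12 ?E ?E = integral {0..L} (\<lambda>t. complex_of_real (Re (\<psi>1 ?E t) * Re (\<psi>2 ?E t)))" unfolding I12_def
    by (rule Henstock_Kurzweil_Integration.integral_cong) (metis r of_real_mult)
  thus *: "I12 ?E ?E = complex_of_real real_gram12" unfolding real_gram12_def
    by (simp only: integral_complex_of_real_Icc continuous_on_mult[OF c(1) c(2)])
  have "I21 ?E ?E = I12 ?E ?E" unfolding I12_def I21_def by (simp add: mult.commute)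
  thus "I21 ?E ?E = complex_of_real real_gram12" using * by simp
qed

lemma real_gram_form_pos:
  assumes "\<alpha> \<noteq> 0 \<or> \<beta> \<noteq> 0"
  shows "0 < \<alpha>\<^sup>2 * real_gram11 + 2 * \<alpha> * \<beta> * real_gram12 + \<beta>\<^sup>2 * real_gram22"
proof -
  let ?E = "complex_of_real e"
  let ?u = "\<lambda>t. Re (\<psi>1 ?E t)" and ?v = "\<lambda>t. Re (\<psi>2 ?E t)"
  have c: "continuous_on {0..L} ?u" "continuous_on {0..L} ?v"
    by (intro continuous_intros cont1 cont2)+
  have r: "\<psi>1 ?E t = complex_of_real (?u t)" "\<psi>2 ?E t = complex_of_real (?v t)"
    if "t \<in> {0..L}" for t
    using real_solutions[OF that, of e] by (simp_all add: complex_is_Real_iff complex_eq_iff)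
  have "0 < integral {0..L} (\<lambda>t. (cmod (complex_of_real \<alpha> * \<psi>1 ?E t + complex_of_real \<beta> * \<psi>2 ?E t))\<^sup>2)"
    by (rule solution_nonzero_integral) (use assms in auto)
  also have "\<dots> = integral {0..L} (\<lambda>t. \<alpha>\<^sup>2 * (?u t)\<^sup>2 + 2 * \<alpha> * \<beta> * (?u t * ?v t) + \<beta>\<^sup>2 * (?v t)\<^sup>2)"
  proof (rule Henstock_Kurzweil_Integration.integral_cong)
    fix t assume t: "t \<in> {0..L}"
    have "complex_of_real \<alpha> * \<psi>1 ?E t + complex_of_real \<beta> * \<psi>2 ?E t = complex_of_real (\<alpha> * ?u t + \<beta> * ?v t)"
      by (subst r[OF t], subst r[OF t]) simp
    hence "(cmod (complex_of_real \<alpha> * \<psi>1 ?E t + complex_of_real \<beta> * \<psi>2 ?E t))\<^sup>2 = (\<alpha> * ?u t + \<beta> * ?v t)\<^sup>2"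
      by (simp only: norm_of_real power2_abs)
    thus "(cmod (complex_of_real \<alpha> * \<psi>1 ?E t + complex_of_real \<beta> * \<psi>2 ?E t))\<^sup>2
        = \<alpha>\<^sup>2 * (?u t)\<^sup>2 + 2 * \<alpha> * \<beta> * (?u t * ?v t) + \<beta>\<^sup>2 * (?v t)\<^sup>2"
      by (simp add: power2_eq_square algebra_simps)
  qed
  also have "\<dots> = \<alpha>\<^sup>2 * real_gram11 + 2 * \<alpha> * \<beta> * real_gram12 + \<beta>\<^sup>2 * real_gram22"
  proof (rule integral_unique)
    have "((\<lambda>t. (?u t)\<^sup>2) has_integral real_gram11) {0..L}"
      "((\<lambda>t. ?u t * ?v t) has_integral real_gram12) {0..L}"
      "((\<lambda>t. (?v t)\<^sup>2) has_integral real_gram22) {0..L}"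
      unfolding real_gram11_def real_gram12_def real_gram22_def
      by (intro integrable_integral integrable_continuous_real continuous_intros cont1 cont2)+
    thus "((\<lambda>t. \<alpha>\<^sup>2 * (?u t)\<^sup>2 + 2 * \<alpha> * \<beta> * (?u t * ?v t) + \<beta>\<^sup>2 * (?v t)\<^sup>2) has_integral
        (\<alpha>\<^sup>2 * real_gram11 + 2 * \<alpha> * \<beta> * real_gram12 + \<beta>\<^sup>2 * real_gram22)) {0..L}"
      by (intro has_integral_add has_integral_mult_right)
  qed
  finally show ?thesis .
qed

lemma real_gram_det_pos: "0 < real_gram11 * real_gram22 - real_gram12\<^sup>2"
proof -
  have b: "0 < real_gram22" using real_gram_form_pos[of 0 1] by simp
  \<comment> \<open>At the vector (\<open>real_gram22\<close>, - \<open>real_gram12\<close>) the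
    quadratic form equals \<open>real_gram22\<close> times the determinant.\<close>
  have "0 < real_gram22 * (real_gram11 * real_gram22 - real_gram12\<^sup>2)"
    using real_gram_form_pos[of real_gram22 "- real_gram12"] b by (simp add: power2_eq_square algebra_simps)
  thus ?thesis using b by (simp add: zero_less_mult_iff)
qed

text \<open>
  If \<open>M\<close> has the double eigenvalue \<open>\<sigma>\<close> but is not \<open>\<sigma> I\<close>, then the derivative of the discriminant is,
  up to a nonzero factor, the integral of the square of a nonzero solution.
\<close>

lemma critical_energy_monodromy:
  assumes \<sigma>: "\<sigma> = 1 \<or> \<sigma> = -1" and D: "discriminant (complex_of_real e) = 2 * complex_of_real \<sigma>"
    and D': "(discriminant has_field_derivative 0) (at (complex_of_real e))"
  shows "\<psi>1 (complex_of_real e) L = complex_of_real \<sigma>" "\<psi>2 (complex_of_real e) L = 0"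
    "\<phi>1 (complex_of_real e) L = 0" "\<phi>2 (complex_of_real e) L = complex_of_real \<sigma>"
proof -
  let ?E = "complex_of_real e"
  define p r s u where "p = Re (\<psi>1 ?E L)" and "r = Re (\<psi>2 ?E L)" and "s = Re (\<phi>1 ?E L)" and "u = Re (\<phi>2 ?E L)"
  have c: "\<psi>1 ?E L = complex_of_real p" "\<psi>2 ?E L = complex_of_real r"
    "\<phi>1 ?E L = complex_of_real s" "\<phi>2 ?E L = complex_of_real u"
    using real_solutions[of L e] L
    by (simp_all add: complex_is_Real_iff complex_eq_iff p_def r_def s_def u_def)
  have "complex_of_real (p * u - s * r) = complex_of_real 1"
    using wronskian[of L ?E] L by (simp add: c)
  hence w: "p * u - s * r = 1" by (simp only: of_real_eq_iff)
  have "complex_of_real (p + u) = complex_of_real (2 * \<sigma>)" using D by (simp add: discriminant_def c)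
  hence tr: "p + u = 2 * \<sigma>" by (simp only: of_real_eq_iff)
  have "complex_of_real (r * real_gram11 - p * real_gram12 + u * real_gram12 - s * real_gram22) = 0"
    using DERIV_unique[OF discriminant_has_derivative D'] by (simp add: c I_real algebra_simps)
  hence d: "r * real_gram11 + (u - p) * real_gram12 - s * real_gram22 = 0"
    by (simp only: of_real_eq_0_iff) (simp add: algebra_simps)
  have "(p + u)\<^sup>2 = 4" using \<sigma> by (auto simp: tr)
  \<comment> \<open>The vanishing discriminant of the characteristic polynomial: (p + u)^2 = 4
    together with det M = 1.\<close>
  hence disc: "- s * r = ((u - p)/2)\<^sup>2"
    using w by (simp add: power2_eq_square field_simps)
  have r0: "r = 0"
  proof (rule ccontr)
    assume "r \<noteq> 0"
    \<comment> \<open>(r, (u - p) / 2) is the eigenvector of M for \<sigma> = (p + u) / 2. By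
      \<open>disc\<close> the Gram form at this vector is \<open>r\<close> times the left side of
      \<open>d\<close>, hence zero, against definiteness.\<close>
    hence "0 < r\<^sup>2 * real_gram11 + 2 * r * ((u - p)/2) * real_gram12 + ((u - p)/2)\<^sup>2 * real_gram22"
      by (intro real_gram_form_pos) simp
    also have "\<dots> = r * (r * real_gram11 + (u - p) * real_gram12 - s * real_gram22)"
      unfolding disc[symmetric] by (simp add: power2_eq_square field_simps)
    finally show False using d by simp
  qed
  have up: "u = p" using disc r0 by simp
  have "0 < real_gram22" using real_gram_form_pos[of 0 1] by simp
  hence s0: "s = 0" using d r0 up by simp
  have "p = \<sigma>" using tr up by simp
  thus "\<psi>1 ?E L = complex_of_real \<sigma>" "\<psi>2 ?E L = 0" "\<phi>1 ?E L = 0" "\<phi>2 ?E L = complex_of_real \<sigma>"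
    using c r0 s0 up by simp_all
qed

end

text \<open>Expanding the trace leaves the linear term (E - E') (I12 - I21), and the mixed integrals
  are not symmetric. The condition det M(E') = 1 says that this term equals - (E - E')^2 (I11 I22 -
  I12 I21), so it is converted into a quadratic one with no remainder.\<close>

lemma discriminant_near_identity_monodromy:
  assumes M: "\<psi>1 E L = \<sigma>" "\<psi>2 E L = 0" "\<phi>1 E L = 0" "\<phi>2 E L = \<sigma>" and \<sigma>: "\<sigma> = 1 \<or> \<sigma> = (-1::complex)"
  shows "discriminant E' = 2 * \<sigma> - \<sigma> * (E - E')\<^sup>2 * (I11 E E' * I22 E E' - I12 E E' * I21 E E')"
proof -
  define \<epsilon> where "\<epsilon> = E - E'"
  define a b c d where "a = I11 E E'" and "b = I12 E E'" and "c = I21 E E'" and "d = I22 E E'"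
  have e: "\<psi>1 E' L = \<sigma> * (1 - \<epsilon> * c)" "\<phi>1 E' L = \<sigma> * (\<epsilon> * a)" "\<psi>2 E' L = - \<sigma> * (\<epsilon> * d)" "\<phi>2 E' L = \<sigma> * (1 + \<epsilon> * b)"
    unfolding endpoint_difference[of E' E] M by (simp_all add: \<epsilon>_def a_def b_def c_def d_def algebra_simps)
  have "\<sigma> * \<sigma> = 1" using \<sigma> by auto
  moreover have "\<psi>1 E' L * \<phi>2 E' L - \<phi>1 E' L * \<psi>2 E' L = 1" using wronskian[of L E'] L by simp
  hence "\<sigma> * \<sigma> * ((1 - \<epsilon> * c) * (1 + \<epsilon> * b) + \<epsilon>\<^sup>2 * (a * d)) = 1"
    unfolding e by (simp add: power2_eq_square algebra_simps)
  ultimately have k: "\<epsilon> * (b - c) = - \<epsilon>\<^sup>2 * (a * d - b * c)" by (simp add: power2_eq_square algebra_simps)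
  have "discriminant E' = 2 * \<sigma> + \<sigma> * (\<epsilon> * (b - c))"
    unfolding discriminant_def e by (simp add: algebra_simps)
  also have "\<dots> = 2 * \<sigma> - \<sigma> * \<epsilon>\<^sup>2 * (a * d - b * c)" unfolding k by (simp add: algebra_simps)
  finally show ?thesis by (simp only: \<epsilon>_def a_def b_def c_def d_def)
qed

end

section \<open>Bands and band edges\<close>

text \<open>A connected set missing \<omega> lies on one side of it; points of the set arbitrarily
  close to \<omega> and one fixed member enclose the whole interval between that member and
  \<omega>.\<close>

lemma connected_accumulates_at_side:
  fixes C :: "real set"
  assumes C: "connected C" and w: "\<omega> \<notin> C" "\<omega> \<in> closure C"
  shows "(\<exists>c<\<omega>. {c<..<\<omega>} \<subseteq> C) \<or> (\<exists>c>\<omega>. {\<omega><..<c} \<subseteq> C)"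
proof -
  have "C \<noteq> {}" using w(2) by auto
  then obtain c where c: "c \<in> C" by blast
  hence "c \<noteq> \<omega>" using w by auto
  have sides: "(\<forall>x\<in>C. x < \<omega>) \<or> (\<forall>x\<in>C. \<omega> < x)"
    using connected_image_avoids_value[of "\<lambda>x. x" C \<omega>] C w by simp
  have near: "\<exists>z\<in>C. \<bar>z - \<omega>\<bar> < e" if "e > 0" for e
    using w(2) that by (auto simp: closure_approachable dist_real_def)
  show ?thesis
  proof (cases "c < \<omega>")
    case True
    have "y \<in> C" if y: "c < y" "y < \<omega>" for y
    proof -
      obtain z where z: "z \<in> C" "\<bar>z - \<omega>\<bar> < \<omega> - y" using near[of "\<omega> - y"] y by auto
      thus ?thesis using connectedD_interval[OF C c z(1), of y] y by auto
    qed
    thus ?thesis using True by auto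
  next
    case False
    hence cw: "\<omega> < c" using \<open>c \<noteq> \<omega>\<close> by simp
    have "y \<in> C" if y: "\<omega> < y" "y < c" for y
    proof -
      obtain z where z: "z \<in> C" "\<bar>z - \<omega>\<bar> < y - \<omega>" using near[of "y - \<omega>"] y by auto
      thus ?thesis using connectedD_interval[OF C z(1) c, of y] y by auto
    qed
    thus ?thesis using cw by auto
  qed
qed

text \<open>Both frontiers are recorded because bands are closures of components while gaps are the
  components themselves. Taking the closure cannot swallow the edge, since the component lies on one
  side of it.\<close>

lemma component_at_edge:
  fixes U J :: "real set"
  assumes w: "\<omega> \<notin> U" and J: "connected J" "J \<noteq> {}" "J \<subseteq> U" "\<omega> \<in> closure J"
  shows "\<exists>C\<in>components U. J \<subseteq> C \<and> (C \<subseteq> {..<\<omega>} \<or> C \<subseteq> {\<omega><..}) \<and>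
    \<omega> \<in> frontier C \<and> \<omega> \<in> frontier (closure C)"
proof -
  obtain x where x: "x \<in> J" using J(2) by blast
  define C where "C = connected_component_set U x"
  have C: "C \<in> components U" using x J(3) by (auto simp: C_def components_def)
  have sub: "J \<subseteq> C"
    unfolding C_def by (rule connected_component_maximal[OF x J(1,3)])
  have nin: "\<omega> \<notin> C" using in_components_subset[OF C] w by auto
  have sides: "C \<subseteq> {..<\<omega>} \<or> C \<subseteq> {\<omega><..}"
    using connected_image_avoids_value[of "\<lambda>x. x" C \<omega>] in_components_connected[OF C] nin by auto
  have cl: "\<omega> \<in> closure C" using J(4) closure_mono[OF sub] by blast
  have "\<omega> \<notin> interior (closure C)"
  proof -
    have "closure C \<subseteq> {..\<omega>} \<or> closure C \<subseteq> {\<omega>..}"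
      using sides closure_mono[of C "{..<\<omega>}"] closure_mono[of C "{\<omega><..}"] by auto
    thus ?thesis
      using interior_mono[of "closure C" "{..\<omega>}"] interior_mono[of "closure C" "{\<omega>..}"] by auto
  qed
  hence "\<omega> \<in> frontier (closure C)" using cl by (simp add: frontier_def)
  moreover have "\<omega> \<in> frontier C"
    using cl nin interior_subset[of C] by (auto simp: frontier_def)
  ultimately show ?thesis using C sides sub by blast
qed

lemma in_gapI:
  assumes "\<omega> \<ge> 0" "cmod (F (complex_of_real \<omega>)) > 1"
  shows "in_gap F \<omega>"
  unfolding in_gap_def is_gap_def
  using assms by (intro exI[of _ "connected_component_set {x. 0 \<le> x \<and> cmod (F (complex_of_real x)) > 1} \<omega>"])
    (auto simp: components_def)

context
  fixes F :: "complex \<Rightarrow> complex"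
  assumes F: "continuous_on UNIV F"
begin

lemma continuous_on_cmod_real: "continuous_on S (\<lambda>x. cmod (F (complex_of_real x)))"
  by (intro continuous_intros continuous_on_compose2[OF F]) auto

lemma in_band_imp:
  assumes "in_band F \<omega>"
  shows "\<omega> \<ge> 0" "cmod (F (complex_of_real \<omega>)) \<le> 1"
proof -
  obtain C where C: "C \<in> components {x. 0 \<le> x \<and> cmod (F (complex_of_real x)) < 1}" "\<omega> \<in> closure C"
    using assms by (auto simp: in_band_def is_band_def)
  have "closed ({0..} \<inter> {x. cmod (F (complex_of_real x)) \<le> 1})"
    by (intro closed_Int closed_Collect_le continuous_on_cmod_real continuous_intros)
  moreover have "C \<subseteq> {0..} \<inter> {x. cmod (F (complex_of_real x)) \<le> 1}"
    using in_components_subset[OF C(1)] by auto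
  ultimately have "closure C \<subseteq> {0..} \<inter> {x. cmod (F (complex_of_real x)) \<le> 1}"
    by (rule closure_minimal[rotated])
  thus "\<omega> \<ge> 0" "cmod (F (complex_of_real \<omega>)) \<le> 1" using C(2) by auto
qed

text \<open>If |F| < 1 held at \<omega>, a ball around it would lie inside a single component and
  \<omega> would be interior to the band. So \<omega> is outside both components and adherent to
  each; being disjoint, they must come from opposite sides, and together they fill a punctured
  neighbourhood.\<close>

lemma degenerate_band_edge_imp:
  assumes w: "\<omega> > 0" and deg: "degenerate_band_edge F \<omega>"
  shows "\<exists>\<epsilon>>0. \<forall>x. x \<noteq> \<omega> \<longrightarrow> \<bar>x - \<omega>\<bar> < \<epsilon> \<longrightarrow> cmod (F (complex_of_real x)) < 1"
    and "cmod (F (complex_of_real \<omega>)) = 1"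
proof -
  let ?f = "\<lambda>x. cmod (F (complex_of_real x))"
  let ?U = "{x. 0 \<le> x \<and> ?f x < 1}"
  obtain C C' where C: "C \<in> components ?U" "C' \<in> components ?U" "closure C \<noteq> closure C'"
    and fr: "\<omega> \<in> frontier (closure C)" "\<omega> \<in> frontier (closure C')"
    using deg by (auto simp: degenerate_band_edge_def is_band_def)
  have cl: "\<omega> \<in> closure C" "\<omega> \<in> closure C'" using fr by (auto simp: frontier_def)
  have ge: "?f \<omega> \<ge> 1"
  proof (rule ccontr)
    assume "\<not> ?thesis"
    moreover have "open {x. ?f x < 1}" by (intro open_Collect_less continuous_on_cmod_real continuous_intros)
    hence "open ({0<..} \<inter> {x. ?f x < 1})" by (intro open_Int) auto
    ultimately obtain r where r: "r > 0" "ball \<omega> r \<subseteq> {0<..} \<inter> {x. ?f x < 1}"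
      using w unfolding open_contains_ball by (metis (no_types, lifting) IntI greaterThan_iff linorder_not_le mem_Collect_eq)
    obtain z where z: "z \<in> C" "dist z \<omega> < r" using cl(1) r(1) unfolding closure_approachable by blast
    have "ball \<omega> r \<subseteq> C"
    proof (rule components_maximal[OF C(1)])
      show "ball \<omega> r \<subseteq> ?U" using r(2) by auto
      show "C \<inter> ball \<omega> r \<noteq> {}" using z by (auto simp: dist_commute)
    qed (rule connected_ball)
    hence "ball \<omega> r \<subseteq> closure C" using closure_subset by blast
    hence "\<omega> \<in> interior (closure C)" using r(1) by (auto simp: mem_interior)
    thus False using fr(1) by (simp add: frontier_def)
  qed
  hence nin: "\<omega> \<notin> C" "\<omega> \<notin> C'" using in_components_subset[OF C(1)] in_components_subset[OF C(2)] by auto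
  have dis: "C \<inter> C' = {}" using components_nonoverlap[OF C(1,2)] C(3) by auto
  have overlap_l: "\<not> ({c<..<\<omega>} \<subseteq> C \<and> {d<..<\<omega>} \<subseteq> C')" if "c < \<omega>" "d < \<omega>" for c d
  proof
    assume "{c<..<\<omega>} \<subseteq> C \<and> {d<..<\<omega>} \<subseteq> C'"
    moreover have "(max c d + \<omega>)/2 \<in> {c<..<\<omega>} \<inter> {d<..<\<omega>}" using that by auto
    ultimately show False using dis by blast
  qed
  have overlap_r: "\<not> ({\<omega><..<c} \<subseteq> C \<and> {\<omega><..<d} \<subseteq> C')" if "c > \<omega>" "d > \<omega>" for c d
  proof
    assume "{\<omega><..<c} \<subseteq> C \<and> {\<omega><..<d} \<subseteq> C'"
    moreover have "(min c d + \<omega>)/2 \<in> {\<omega><..<c} \<inter> {\<omega><..<d}" using that by auto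
    ultimately show False using dis by blast
  qed
  obtain c d where cd: "c < \<omega>" "\<omega> < d" "{c<..<\<omega>} \<subseteq> C \<union> C'" "{\<omega><..<d} \<subseteq> C \<union> C'"
    using connected_accumulates_at_side[OF in_components_connected[OF C(1)] nin(1) cl(1)]
      connected_accumulates_at_side[OF in_components_connected[OF C(2)] nin(2) cl(2)]
      overlap_l overlap_r by (metis (no_types, opaque_lifting) le_supI1 le_supI2)
  have CU: "C \<union> C' \<subseteq> ?U" using in_components_subset[OF C(1)] in_components_subset[OF C(2)] by simp
  define \<epsilon> where "\<epsilon> = min (\<omega> - c) (d - \<omega>)"
  have \<epsilon>: "\<epsilon> > 0" using cd by (simp add: \<epsilon>_def)
  have punct: "?f x < 1" if "x \<noteq> \<omega>" "\<bar>x - \<omega>\<bar> < \<epsilon>" for x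
  proof -
    have "x \<in> {c<..<\<omega>} \<or> x \<in> {\<omega><..<d}" using that by (auto simp: \<epsilon>_def)
    thus ?thesis using cd CU by blast
  qed
  thus "\<exists>\<epsilon>>0. \<forall>x. x \<noteq> \<omega> \<longrightarrow> \<bar>x - \<omega>\<bar> < \<epsilon> \<longrightarrow> ?f x < 1" using \<epsilon> by blast
  have "?f \<midarrow>\<omega>\<rightarrow> ?f \<omega>" using continuous_on_cmod_real[of UNIV] by (auto simp: continuous_on_def)
  moreover have "\<forall>\<^sub>F x in at \<omega>. ?f x \<le> 1"
    unfolding eventually_at using punct \<epsilon> by (auto simp: dist_real_def intro!: exI[of _ \<epsilon>] less_imp_le)
  ultimately have "?f \<omega> \<le> 1" by (rule tendsto_upperbound) simp
  thus "?f \<omega> = 1" using ge by simp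
qed

text \<open>Rules out the branch in which \<open>group_velocity\<close> is \<open>0\<close> by
  definition.\<close>

lemma degenerate_imp_not_nondegenerate:
  assumes "\<omega> > 0" "degenerate_band_edge F \<omega>"
  shows "\<not> nondegenerate_band_edge F \<omega>"
proof
  assume "nondegenerate_band_edge F \<omega>"
  then obtain G where G: "G \<in> components {x. 0 \<le> x \<and> cmod (F (complex_of_real x)) > 1}" "\<omega> \<in> closure G"
    by (auto simp: nondegenerate_band_edge_def is_gap_def frontier_def)
  obtain \<epsilon> where e: "\<epsilon> > 0" "\<And>x. x \<noteq> \<omega> \<Longrightarrow> \<bar>x - \<omega>\<bar> < \<epsilon> \<Longrightarrow> cmod (F (complex_of_real x)) < 1"
    using degenerate_band_edge_imp(1)[OF assms] by blast
  obtain z where z: "z \<in> G" "dist z \<omega> < \<epsilon>" using G(2) e(1) unfolding closure_approachable by blast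
  have "cmod (F (complex_of_real z)) > 1" using in_components_subset[OF G(1)] z(1) by auto
  moreover have "cmod (F (complex_of_real z)) \<le> 1"
    using e(2)[of z] z(2) degenerate_band_edge_imp(2)[OF assms] by (cases "z = \<omega>") (auto simp: dist_real_def)
  ultimately show False by simp
qed

end

lemma degenerate_band_edgeI:
  assumes w: "\<omega> > 0" and f: "cmod (F (complex_of_real \<omega>)) = 1" and \<epsilon>: "\<epsilon> > 0"
    and punct: "\<And>x. x \<noteq> \<omega> \<Longrightarrow> \<bar>x - \<omega>\<bar> < \<epsilon> \<Longrightarrow> cmod (F (complex_of_real x)) < 1"
  shows "degenerate_band_edge F \<omega>"
proof -
  let ?U = "{x. 0 \<le> x \<and> cmod (F (complex_of_real x)) < 1}"
  \<comment> \<open>The bound by \<omega> keeps the left interval among the nonnegative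
    frequencies.\<close>
  define \<delta> where "\<delta> = min \<epsilon> \<omega>"
  have \<delta>: "\<delta> > 0" using \<epsilon> w by (simp add: \<delta>_def)
  have nin: "\<omega> \<notin> ?U" using f by simp
  have sub: "{\<omega> - \<delta><..<\<omega>} \<subseteq> ?U" "{\<omega><..<\<omega> + \<delta>} \<subseteq> ?U" using punct w by (auto simp: \<delta>_def)
  have cl: "\<omega> \<in> closure {\<omega> - \<delta><..<\<omega>}" "\<omega> \<in> closure {\<omega><..<\<omega> + \<delta>}" using \<delta> by auto
  have mid: "\<omega> - \<delta>/2 \<in> {\<omega> - \<delta><..<\<omega>}" "\<omega> + \<delta>/2 \<in> {\<omega><..<\<omega> + \<delta>}" using \<delta> by auto
  obtain C where C: "C \<in> components ?U" "{\<omega> - \<delta><..<\<omega>} \<subseteq> C" "\<omega> \<in> frontier (closure C)"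
    using component_at_edge[OF nin _ _ sub(1) cl(1)] mid by (auto simp: connected_Ioo)
  obtain C' where C': "C' \<in> components ?U" "{\<omega><..<\<omega> + \<delta>} \<subseteq> C'" "\<omega> \<in> frontier (closure C')"
      "C' \<subseteq> {..<\<omega>} \<or> C' \<subseteq> {\<omega><..}"
    using component_at_edge[OF nin _ _ sub(2) cl(2)] mid by (auto simp: connected_Ioo)
  have "\<omega> - \<delta>/2 \<in> closure C" using C(2) mid closure_subset[of C] by blast
  moreover have "C' \<subseteq> {\<omega><..}"
  proof -
    have "\<omega> + \<delta>/2 \<in> C'" using C'(2) mid by blast
    thus ?thesis using C'(4) \<delta> by fastforce
  qed
  hence "closure C' \<subseteq> {\<omega>..}" using closure_mono[of C' "{\<omega><..}"] by simp
  ultimately have "closure C \<noteq> closure C'" using \<delta> by fastforce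
  thus ?thesis using C C' unfolding degenerate_band_edge_def is_band_def by blast
qed

text \<open>A nonzero derivative makes \<open>f\<close> cross the value -1, which puts a band on one
  side and a gap on the other. The value -1 is the relevant one because the discriminant of the comb
  reaches 1 at positive frequencies only where the sine vanishes, and its derivative vanishes there
  too.\<close>

lemma nondegenerate_band_edgeI:
  assumes w: "\<omega> > 0" and f: "\<And>x. x > 0 \<Longrightarrow> F (complex_of_real x) = complex_of_real (f x)"
    and fw: "f \<omega> = -1" and f': "(f has_real_derivative f') (at \<omega>)" "f' \<noteq> 0"
  shows "nondegenerate_band_edge F \<omega>"
proof -
  let ?U = "{x. 0 \<le> x \<and> cmod (F (complex_of_real x)) < 1}"
  let ?V = "{x. 0 \<le> x \<and> cmod (F (complex_of_real x)) > 1}"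
  have nin: "\<omega> \<notin> ?U" "\<omega> \<notin> ?V" using f[OF w] fw by simp_all
  have "f \<midarrow>\<omega>\<rightarrow> f \<omega>" using DERIV_isCont[OF f'(1)] by (simp add: isCont_def)
  hence "\<forall>\<^sub>F x in at \<omega>. f x < 1" using fw by (intro order_tendstoD(2)[of f "f \<omega>"]) auto
  \<comment> \<open>\<open>d0\<close> keeps \<open>f\<close> below 1, so that f > -1 really means
    |f| < 1 on the band side.\<close>
  then obtain d0 where d0: "d0 > 0" "\<And>x. x \<noteq> \<omega> \<Longrightarrow> \<bar>x - \<omega>\<bar> < d0 \<Longrightarrow> f x < 1"
    unfolding eventually_at by (auto simp: dist_real_def)
  have inU: "x \<in> ?U" if "x > 0" "f x > -1" "x \<noteq> \<omega>" "\<bar>x - \<omega>\<bar> < d0" for x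
    using f[OF that(1)] d0(2)[OF that(3,4)] that by simp
  have inV: "x \<in> ?V" if "x > 0" "f x < -1" for x
    using f[OF that(1)] that by simp
  have key: ?thesis if "J \<subseteq> ?U" "J' \<subseteq> ?V" "connected J" "connected J'" "\<omega> \<in> closure J" "\<omega> \<in> closure J'" for J J'
  proof -
    have "J \<noteq> {}" "J' \<noteq> {}" using that(5,6) by auto
    thus ?thesis
      using component_at_edge[OF nin(1) that(3) _ that(1,5)] component_at_edge[OF nin(2) that(4) _ that(2,6)]
      unfolding nondegenerate_band_edge_def is_band_def is_gap_def by blast
  qed
  consider "f' > 0" | "f' < 0" using f'(2) by linarith
  then show ?thesis
  proof cases
    case 1
    obtain d where d: "d > 0" "\<And>h. h > 0 \<Longrightarrow> h < d \<Longrightarrow> f \<omega> < f (\<omega> + h)"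
      using DERIV_pos_inc_right[OF f'(1) 1] by blast
    obtain e where e: "e > 0" "\<And>h. h > 0 \<Longrightarrow> h < e \<Longrightarrow> f (\<omega> - h) < f \<omega>"
      using DERIV_pos_inc_left[OF f'(1) 1] by blast
    show ?thesis
    proof (rule key[of "{\<omega><..<\<omega> + min d d0}" "{\<omega> - min e \<omega><..<\<omega>}"])
      show "{\<omega><..<\<omega> + min d d0} \<subseteq> ?U"
      proof
        fix x assume "x \<in> {\<omega><..<\<omega> + min d d0}"
        thus "x \<in> ?U" using d(2)[of "x - \<omega>"] w fw by (intro inU) auto
      qed
      show "{\<omega> - min e \<omega><..<\<omega>} \<subseteq> ?V"
      proof
        fix x assume "x \<in> {\<omega> - min e \<omega><..<\<omega>}"
        thus "x \<in> ?V" using e(2)[of "\<omega> - x"] w fw by (intro inV) auto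
      qed
    qed (use d(1) d0(1) e(1) w in \<open>auto simp: connected_Ioo\<close>)
  next
    case 2
    obtain d where d: "d > 0" "\<And>h. h > 0 \<Longrightarrow> h < d \<Longrightarrow> f \<omega> > f (\<omega> + h)"
      using DERIV_neg_dec_right[OF f'(1) 2] by blast
    obtain e where e: "e > 0" "\<And>h. h > 0 \<Longrightarrow> h < e \<Longrightarrow> f (\<omega> - h) > f \<omega>"
      using DERIV_neg_dec_left[OF f'(1) 2] by blast
    show ?thesis
    proof (rule key[of "{\<omega> - min (min e d0) \<omega><..<\<omega>}" "{\<omega><..<\<omega> + d}"])
      show "{\<omega> - min (min e d0) \<omega><..<\<omega>} \<subseteq> ?U"
      proof
        fix x assume "x \<in> {\<omega> - min (min e d0) \<omega><..<\<omega>}"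
        thus "x \<in> ?U" using e(2)[of "\<omega> - x"] w fw by (intro inU) auto
      qed
      show "{\<omega><..<\<omega> + d} \<subseteq> ?V"
      proof
        fix x assume "x \<in> {\<omega><..<\<omega> + d}"
        thus "x \<in> ?V" using d(2)[of "x - \<omega>"] w fw by (intro inV) auto
      qed
    qed (use d(1) d0(1) e(1) w in \<open>auto simp: connected_Ioo\<close>)
  qed
qed

section \<open>Energy estimates\<close>

lemma continuous_extension_Icc:
  fixes f :: "real \<Rightarrow> real"
  assumes "a < b" and f: "continuous_on {a<..<b} f" and y: "(f \<longlongrightarrow> y) (at_right a)" and z: "(f \<longlongrightarrow> z) (at_left b)"
  obtains g where "continuous_on {a..b} g" "\<And>x. x \<in> {a<..<b} \<Longrightarrow> g x = f x"
proof -
  define g where "g x = (if x \<le> a then y else if x \<ge> b then z else f x)" for x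
  have g_ends: "g a = y" "g b = z" using \<open>a < b\<close> by (auto simp: g_def)
  have g_in: "g x = f x" if "x \<in> {a<..<b}" for x using that by (auto simp: g_def)
  have ev: "\<forall>\<^sub>F x in at_right a. f x = g x"
    using eventually_at_right_real[OF \<open>a < b\<close>] by eventually_elim (auto simp: g_def)
  have ev': "\<forall>\<^sub>F x in at_left b. f x = g x"
    using eventually_at_left_real[OF \<open>a < b\<close>] by eventually_elim (auto simp: g_def)
  have "continuous_on {a..b} g"
  proof (rule continuous_on_IccI)
    show "(g \<longlongrightarrow> g a) (at_right a)"
      using Lim_transform_eventually[OF y ev] g_ends by simp
    show "(g \<longlongrightarrow> g b) (at_left b)"
      using Lim_transform_eventually[OF z ev'] g_ends by simp
    fix x assume x: "a < x" "x < b"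
    have "isCont f x" using f x by (simp add: continuous_on_eq_continuous_at)
    moreover have "\<forall>\<^sub>F t in at x. f t = g t"
      using eventually_at_in_open'[of "{a<..<b}" x] x g_in by (auto elim!: eventually_mono)
    ultimately show "g \<midarrow>x\<rightarrow> g x"
      using x g_in Lim_transform_eventually[of f "f x" "at x" g] by (simp add: isCont_def)
  qed fact
  thus ?thesis using that g_in by blast
qed

text \<open>One-sided limits at the ends extend \<open>v\<close> and its derivative continuously to
  the compact interval, where they are bounded. The bound \<open>K\<close> for the derivative is
  what later makes the energy estimate uniform in A.\<close>

lemma smooth_piece_extension:
  assumes v: "smooth_piece a b v" and "a < b"
  obtains w K where "continuous_on {a..b} w" "\<And>x. x \<in> {a<..<b} \<Longrightarrow> w x = v x"
    "K \<ge> 0" "\<And>x. x \<in> {a<..<b} \<Longrightarrow> \<exists>d. (w has_real_derivative d) (at x) \<and> \<bar>d\<bar> \<le> K"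
proof -
  have sm: "(deriv ^^ n) v differentiable_on {a<..<b}" "\<exists>y. ((deriv ^^ n) v \<longlongrightarrow> y) (at_right a)"
    "\<exists>y. ((deriv ^^ n) v \<longlongrightarrow> y) (at_left b)" for n
    using v by (auto simp: smooth_piece_def)
  have ext: "\<exists>g. continuous_on {a..b} g \<and> (\<forall>x\<in>{a<..<b}. g x = (deriv ^^ n) v x)" for n
  proof -
    obtain y z where "((deriv ^^ n) v \<longlongrightarrow> y) (at_right a)" "((deriv ^^ n) v \<longlongrightarrow> z) (at_left b)"
      using sm by blast
    from continuous_extension_Icc[OF \<open>a < b\<close> differentiable_imp_continuous_on[OF sm(1)] this]
    show ?thesis by (metis (no_types))
  qed
  obtain w where w: "continuous_on {a..b} w" "\<And>x. x \<in> {a<..<b} \<Longrightarrow> w x = v x"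
    using ext[of 0] by auto
  obtain g where g: "continuous_on {a..b} g" "\<And>x. x \<in> {a<..<b} \<Longrightarrow> g x = deriv v x"
    using ext[of 1] by auto
  have "bounded (g ` {a..b})" by (intro compact_imp_bounded compact_continuous_image g) auto
  then obtain K where K: "K > 0" "\<And>x. x \<in> {a..b} \<Longrightarrow> \<bar>g x\<bar> \<le> K" unfolding bounded_pos by auto
  show ?thesis
  proof (rule that[OF w, of K])
    fix x assume x: "x \<in> {a<..<b}"
    have "v differentiable (at x)"
      using sm(1)[of 0] x by (simp add: differentiable_on_eq_differentiable_at)
    hence "(v has_real_derivative deriv v x) (at x)" by (simp add: DERIV_deriv_iff_real_differentiable)
    hence "(w has_real_derivative deriv v x) (at x)"
      by (rule has_field_derivative_transform_within_open[of _ _ _ "{a<..<b}"]) (use x w in auto)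
    thus "\<exists>d. (w has_real_derivative d) (at x) \<and> \<bar>d\<bar> \<le> K"
      using K(2)[of x] g(2)[OF x] x by auto
  qed (use K in auto)
qed

lemma schroedinger_solutionI_no_mass:
  assumes "continuous_on {0..L} \<psi>" "continuous_on {0..L} \<phi>" "finite S"
    "\<And>x. x \<in> {0<..<L} - S \<Longrightarrow> (\<psi> has_vector_derivative \<phi> x) (at x) \<and>
        (\<phi> has_vector_derivative (complex_of_real (q x) - E) * \<psi> x) (at x)"
  shows "schroedinger_solution q (\<lambda>x. 0) L E \<psi> \<phi>"
proof -
  have "(\<phi> \<longlongrightarrow> \<phi> x) (at_left x)" if "x \<in> {0<..L}" for x
  proof -
    have "continuous_on {0..x} \<phi>" using assms(2) that by (auto intro: continuous_on_subset)
    thus ?thesis using that continuous_on_Icc_at_leftD[of 0 x \<phi>] by auto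
  qed
  moreover have "(\<phi> \<longlongrightarrow> \<phi> x + complex_of_real 0 * \<psi> x) (at_right x)" if "x \<in> {0..<L}" for x
  proof -
    have "continuous_on {x..L} \<phi>" using assms(2) that by (auto intro: continuous_on_subset)
    thus ?thesis using that continuous_on_Icc_at_rightD[of x L \<phi>] by auto
  qed
  ultimately show ?thesis unfolding schroedinger_solution_def
    using assms by (intro conjI ballI exI[of _ S]) simp_all
qed

text \<open>Two continuous pieces meeting at \<open>a\<close>; taking \<open>a = L\<close> covers a
  potential without interior break point. The explicit bound from the Picard iteration supplies the
  boundedness in the energy.\<close>

lemma fundamental_family_exists:
  fixes q w1 w2 :: "real \<Rightarrow> real"
  assumes a: "0 < a" "a \<le> L" and w: "continuous_on {0..a} w1" "continuous_on {a..L} w2"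
    and q: "\<And>x. x \<in> {0<..<a} \<Longrightarrow> q x = w1 x" "\<And>x. x \<in> {a<..<L} \<Longrightarrow> q x = w2 x"
  shows "\<exists>\<psi>1 \<phi>1 \<psi>2 \<phi>2. fundamental_family q (\<lambda>x. 0) L \<psi>1 \<phi>1 \<psi>2 \<phi>2"
proof -
  have L: "L > 0" using a by simp
  \<comment> \<open>Built from the continuous pieces instead of \<open>q\<close>, whose values at
    \<open>0\<close>, \<open>a\<close> and \<open>L\<close> are unconstrained. The value of
    \<open>g\<close> at \<open>a\<close> is a convention, and \<open>a\<close> becomes the
    exceptional point of the solution.\<close>
  define g where "g E t = complex_of_real (if t < a then w1 t else w2 t) - E" for E t
  have "bounded (w1 ` {0..a})" "bounded (w2 ` {a..L})"
    by (intro compact_imp_bounded compact_continuous_image w; simp)+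
  then obtain Q1 Q2 where Q: "\<And>t. t \<in> {0..a} \<Longrightarrow> \<bar>w1 t\<bar> \<le> Q1" "\<And>t. t \<in> {a..L} \<Longrightarrow> \<bar>w2 t\<bar> \<le> Q2"
    unfolding bounded_pos by fastforce
  define Q where "Q = max Q1 Q2"
  have g_le: "cmod (g E t) \<le> Q + cmod E" if "t \<in> {0..L}" for E t
  proof -
    have "cmod (g E t) \<le> cmod (complex_of_real (if t < a then w1 t else w2 t)) + cmod E"
      unfolding g_def by (rule norm_triangle_ineq4)
    also have "cmod (complex_of_real (if t < a then w1 t else w2 t)) \<le> Q"
      using Q(1)[of t] Q(2)[of t] that unfolding norm_of_real Q_def by auto
    finally show ?thesis by simp
  qed
  have g_int: "(\<lambda>t. g E t * z t) integrable_on {0..L}" if z: "continuous_on {0..L} z" for E z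
  proof (rule Henstock_Kurzweil_Integration.integrable_combine)
    show "(\<lambda>t. g E t * z t) integrable_on {0..a}"
    proof (rule integrable_spike_finite[of "{a}"])
      show "(\<lambda>t. (complex_of_real (w1 t) - E) * z t) integrable_on {0..a}"
        using a by (intro integrable_continuous_real continuous_intros w continuous_on_subset[OF z]) auto
    qed (auto simp: g_def)
    show "(\<lambda>t. g E t * z t) integrable_on {a..L}"
    proof (rule integrable_spike_finite[of "{}"])
      show "(\<lambda>t. (complex_of_real (w2 t) - E) * z t) integrable_on {a..L}"
        using a by (intro integrable_continuous_real continuous_intros w continuous_on_subset[OF z]) auto
    qed (auto simp: g_def)
  qed (use a in auto)
  have g_cont: "isCont (g E) t" if t: "t \<in> {0<..<L} - {a}" for E t
  proof (cases "t < a")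
    case True
    have "continuous_on {0<..<a} (g E)"
      by (rule continuous_on_eq[of _ "\<lambda>t. complex_of_real (w1 t) - E"])
         (auto simp: g_def intro!: continuous_intros continuous_on_subset[OF w(1)])
    thus ?thesis using True t by (simp add: continuous_on_eq_continuous_at)
  next
    case False
    have "continuous_on {a<..<L} (g E)"
      by (rule continuous_on_eq[of _ "\<lambda>t. complex_of_real (w2 t) - E"])
         (auto simp: g_def intro!: continuous_intros continuous_on_subset[OF w(2)])
    thus ?thesis using False t by (simp add: continuous_on_eq_continuous_at)
  qed
  have ex: "\<exists>s. schroedinger_solution q (\<lambda>x. 0) L E (fst s) (snd s) \<and> fst s 0 = \<alpha> \<and> snd s 0 = \<beta> \<and>
     (\<forall>x\<in>{0..L}. cmod (fst s x) \<le> 2 * (cmod \<alpha> + cmod \<beta>) * exp (2 * (1 + (Q + cmod E)) * L))" for E \<alpha> \<beta>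
  proof -
    obtain \<psi> \<phi> where s: "continuous_on {0..L} \<psi>" "continuous_on {0..L} \<phi>" "\<psi> 0 = \<alpha>" "\<phi> 0 = \<beta>"
      "\<And>x. x \<in> {0<..<L} - {a} \<Longrightarrow>
         (\<psi> has_vector_derivative \<phi> x) (at x) \<and> (\<phi> has_vector_derivative g E x * \<psi> x) (at x)"
      "\<And>x. x \<in> {0..L} \<Longrightarrow> cmod (\<psi> x) \<le> 2 * (cmod \<alpha> + cmod \<beta>) * exp (2 * (1 + (Q + cmod E)) * L)"
      using linear_ode_exists[OF L g_le[where E=E] g_int[where E=E] g_cont[where E=E], where a=\<alpha> and b=\<beta>] by metis
    have "g E x = complex_of_real (q x) - E" if "x \<in> {0<..<L} - {a}" for x
      using q that by (auto simp: g_def)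
    hence "schroedinger_solution q (\<lambda>x. 0) L E \<psi> \<phi>"
      using s(1,2,5) by (intro schroedinger_solutionI_no_mass[of _ _ _ "{a}"]) auto
    thus ?thesis using s(3,4,6) by (intro exI[of _ "(\<psi>, \<phi>)"]) auto
  qed
  define sol where "sol \<alpha> \<beta> E = (SOME s. schroedinger_solution q (\<lambda>x. 0) L E (fst s) (snd s) \<and> fst s 0 = \<alpha> \<and> snd s 0 = \<beta> \<and>
     (\<forall>x\<in>{0..L}. cmod (fst s x) \<le> 2 * (cmod \<alpha> + cmod \<beta>) * exp (2 * (1 + (Q + cmod E)) * L)))"
    for \<alpha> \<beta> E
  note sol = someI_ex[OF ex, folded sol_def]
  have bdd: "\<exists>B. \<forall>E x. cmod E \<le> R \<longrightarrow> x \<in> {0..L} \<longrightarrow> cmod (fst (sol \<alpha> \<beta> E) x) \<le> B" for R \<alpha> \<beta>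
  proof (intro exI[of _ "2 * (cmod \<alpha> + cmod \<beta>) * exp (2 * (1 + (Q + R)) * L)"] allI impI)
    fix E x assume E: "cmod E \<le> R" and x: "x \<in> {0..L}"
    have "cmod (fst (sol \<alpha> \<beta> E) x) \<le> 2 * (cmod \<alpha> + cmod \<beta>) * exp (2 * (1 + (Q + cmod E)) * L)"
      using sol x by blast
    also have "\<dots> \<le> 2 * (cmod \<alpha> + cmod \<beta>) * exp (2 * (1 + (Q + R)) * L)"
      using E L by (intro mult_left_mono) auto
    finally show "cmod (fst (sol \<alpha> \<beta> E) x) \<le> 2 * (cmod \<alpha> + cmod \<beta>) * exp (2 * (1 + (Q + R)) * L)" .
  qed
  have "fundamental_family q (\<lambda>x. 0) L (\<lambda>E. fst (sol 1 0 E)) (\<lambda>E. snd (sol 1 0 E))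
      (\<lambda>E. fst (sol 0 1 E)) (\<lambda>E. snd (sol 0 1 E))"
    by unfold_locales (use L sol bdd in \<open>simp_all\<close>)
  thus ?thesis by blast
qed

text \<open>With the weight 1 / p the terms containing both \<phi> and \<psi> cancel in the
  derivative, leaving H' = - p' |\<phi>|^2 / p^2. Since |p'| is at most K p, this is bounded by K H,
  so exp (- K x) H decreases and exp (K x) H increases: a Gronwall bound in both directions, which
  allows data at either end to be used.\<close>

lemma energy_exponential_bounds:
  fixes \<psi> \<phi> :: "real \<Rightarrow> complex" and p :: "real \<Rightarrow> real"
  assumes "\<alpha> \<le> \<beta>" and cont: "continuous_on {\<alpha>..\<beta>} \<psi>" "continuous_on {\<alpha>..\<beta>} \<phi>" "continuous_on {\<alpha>..\<beta>} p"
    and S: "finite S" and pos: "\<And>x. x \<in> {\<alpha>..\<beta>} \<Longrightarrow> p x > 0"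
    and ode: "\<And>x. x \<in> {\<alpha><..<\<beta>} - S \<Longrightarrow> (\<psi> has_vector_derivative \<phi> x) (at x)"
      "\<And>x. x \<in> {\<alpha><..<\<beta>} - S \<Longrightarrow> (\<phi> has_vector_derivative - complex_of_real (p x) * \<psi> x) (at x)"
    and p': "\<And>x. x \<in> {\<alpha><..<\<beta>} \<Longrightarrow> \<exists>d. (p has_real_derivative d) (at x) \<and> \<bar>d\<bar> \<le> K * p x"
  defines "H \<equiv> \<lambda>x. (cmod (\<phi> x))\<^sup>2 / p x + (cmod (\<psi> x))\<^sup>2"
  shows "H \<beta> \<le> exp (K * (\<beta> - \<alpha>)) * H \<alpha>" "H \<alpha> \<le> exp (K * (\<beta> - \<alpha>)) * H \<beta>"
proof -
  have H_eq: "H x = ((Re (\<phi> x))\<^sup>2 + (Im (\<phi> x))\<^sup>2) / p x + (Re (\<psi> x))\<^sup>2 + (Im (\<psi> x))\<^sup>2" for x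
    by (simp add: H_def cmod_power2)
  have H_cont: "continuous_on {\<alpha>..\<beta>} H"
    unfolding H_def using pos by (intro continuous_intros cont) (auto simp: less_imp_neq[symmetric])
  have H_deriv: "\<exists>h. (H has_real_derivative h) (at x) \<and> \<bar>h\<bar> \<le> K * H x" if x: "x \<in> {\<alpha><..<\<beta>} - S" for x
  proof -
    obtain d where d: "(p has_real_derivative d) (at x)" "\<bar>d\<bar> \<le> K * p x" using p' x by blast
    have px: "p x > 0" using pos x by auto
    have r: "((\<lambda>x. Re (\<psi> x)) has_real_derivative Re (\<phi> x)) (at x)"
      "((\<lambda>x. Im (\<psi> x)) has_real_derivative Im (\<phi> x)) (at x)"
      "((\<lambda>x. Re (\<phi> x)) has_real_derivative - p x * Re (\<psi> x)) (at x)"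
      "((\<lambda>x. Im (\<phi> x)) has_real_derivative - p x * Im (\<psi> x)) (at x)"
      using bounded_linear.has_vector_derivative[OF bounded_linear_Re ode(1)[OF x]]
        bounded_linear.has_vector_derivative[OF bounded_linear_Im ode(1)[OF x]]
        bounded_linear.has_vector_derivative[OF bounded_linear_Re ode(2)[OF x]]
        bounded_linear.has_vector_derivative[OF bounded_linear_Im ode(2)[OF x]]
      by (simp_all add: has_real_derivative_iff_has_vector_derivative)
    define N where "N = (Re (\<phi> x))\<^sup>2 + (Im (\<phi> x))\<^sup>2"
    have "(H has_real_derivative - d * N / (p x)\<^sup>2) (at x)"
    proof -
      define X where "X = Re (\<phi> x) * Re (\<psi> x) + Im (\<phi> x) * Im (\<psi> x)"
      have 1: "((\<lambda>x. (Re (\<phi> x))\<^sup>2 + (Im (\<phi> x))\<^sup>2) has_real_derivative - 2 * p x * X) (at x)"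
        by (rule derivative_eq_intros r refl)+ (simp add: X_def algebra_simps)
      have 2: "((\<lambda>x. (Re (\<psi> x))\<^sup>2 + (Im (\<psi> x))\<^sup>2) has_real_derivative 2 * X) (at x)"
        by (rule derivative_eq_intros r refl)+ (simp add: X_def algebra_simps)
      have "H = (\<lambda>x. ((Re (\<phi> x))\<^sup>2 + (Im (\<phi> x))\<^sup>2) / p x + ((Re (\<psi> x))\<^sup>2 + (Im (\<psi> x))\<^sup>2))"
        by (auto simp: H_eq)
      moreover have "(- 2 * p x * X * p x - N * d) / (p x * p x) + 2 * X = - d * N / (p x)\<^sup>2"
        using px by (simp add: power2_eq_square field_simps)
      ultimately show ?thesis
        using DERIV_add[OF DERIV_divide[OF 1 d(1)] 2] px by (simp add: N_def)
    qed
    moreover have "\<bar>- d * N / (p x)\<^sup>2\<bar> \<le> K * H x"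
    proof -
      have N0: "N \<ge> 0" by (simp add: N_def)
      have "0 \<le> K * p x" using d(2) by linarith
      hence K0: "K \<ge> 0" using px by (simp add: zero_le_mult_iff)
      have "\<bar>- d * N / (p x)\<^sup>2\<bar> = \<bar>d\<bar> * (N / (p x)\<^sup>2)" using N0 by (simp add: abs_mult)
      also have "\<dots> \<le> (K * p x) * (N / (p x)\<^sup>2)" using N0 d(2) by (intro mult_right_mono) auto
      also have "\<dots> = K * (N / p x)" using px by (simp add: power2_eq_square)
      also have "\<dots> \<le> K * H x" using K0 by (intro mult_left_mono) (auto simp: H_eq N_def)
      finally show ?thesis .
    qed
    ultimately show ?thesis by blast
  qed
  have "- (exp (- K * \<alpha>) * H \<alpha>) \<le> - (exp (- K * \<beta>) * H \<beta>)"
  proof (rule deriv_nonneg_imp_le[where f = "\<lambda>x. - (exp (- K * x) * H x)", OF \<open>\<alpha> \<le> \<beta>\<close> _ S])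
    show "continuous_on {\<alpha>..\<beta>} (\<lambda>x. - (exp (- K * x) * H x))" by (intro continuous_intros H_cont)
    fix x assume x: "x \<in> {\<alpha><..<\<beta>} - S"
    obtain h where h: "(H has_real_derivative h) (at x)" "\<bar>h\<bar> \<le> K * H x" using H_deriv[OF x] by blast
    have "((\<lambda>x. - (exp (- K * x) * H x)) has_real_derivative exp (- K * x) * (K * H x - h)) (at x)"
      by (rule derivative_eq_intros h(1) refl)+ (simp add: algebra_simps)
    moreover have "exp (- K * x) * (K * H x - h) \<ge> 0" using h(2) by (intro mult_nonneg_nonneg) auto
    ultimately show "\<exists>d\<ge>0. ((\<lambda>x. - (exp (- K * x) * H x)) has_real_derivative d) (at x)" by blast
  qed
  hence "exp (K * \<beta>) * (exp (- K * \<beta>) * H \<beta>) \<le> exp (K * \<beta>) * (exp (- K * \<alpha>) * H \<alpha>)"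
    by (intro mult_left_mono) auto
  thus "H \<beta> \<le> exp (K * (\<beta> - \<alpha>)) * H \<alpha>"
    by (simp add: mult_exp_exp right_diff_distrib flip: mult.assoc)
  have "exp (K * \<alpha>) * H \<alpha> \<le> exp (K * \<beta>) * H \<beta>"
  proof (rule deriv_nonneg_imp_le[where f = "\<lambda>x. exp (K * x) * H x", OF \<open>\<alpha> \<le> \<beta>\<close> _ S])
    show "continuous_on {\<alpha>..\<beta>} (\<lambda>x. exp (K * x) * H x)" by (intro continuous_intros H_cont)
    fix x assume x: "x \<in> {\<alpha><..<\<beta>} - S"
    obtain h where h: "(H has_real_derivative h) (at x)" "\<bar>h\<bar> \<le> K * H x" using H_deriv[OF x] by blast
    have "((\<lambda>x. exp (K * x) * H x) has_real_derivative exp (K * x) * (K * H x + h)) (at x)"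
      by (rule derivative_eq_intros h(1) refl)+ (simp add: algebra_simps)
    moreover have "exp (K * x) * (K * H x + h) \<ge> 0" using h(2) by (intro mult_nonneg_nonneg) auto
    ultimately show "\<exists>d\<ge>0. ((\<lambda>x. exp (K * x) * H x) has_real_derivative d) (at x)" by blast
  qed
  hence "exp (- K * \<alpha>) * (exp (K * \<alpha>) * H \<alpha>) \<le> exp (- K * \<alpha>) * (exp (K * \<beta>) * H \<beta>)"
    by (intro mult_left_mono) auto
  thus "H \<alpha> \<le> exp (K * (\<beta> - \<alpha>)) * H \<beta>"
    by (simp add: mult_exp_exp right_diff_distrib flip: mult.assoc)
qed

section \<open>The hyperbolic regime, where the potential exceeds the energy\<close>

context
  fixes u w r :: "real \<Rightarrow> real" and \<alpha> \<beta> \<kappa> :: real and S :: "real set"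
  assumes cont: "continuous_on {\<alpha>..\<beta>} u" "continuous_on {\<alpha>..\<beta>} w" and S: "finite S" and \<kappa>: "\<kappa> \<ge> 0"
    and ode: "\<And>x. x \<in> {\<alpha><..<\<beta>} - S \<Longrightarrow> (u has_real_derivative w x) (at x)"
      "\<And>x. x \<in> {\<alpha><..<\<beta>} - S \<Longrightarrow> (w has_real_derivative r x * u x) (at x)"
    and r: "\<And>x. x \<in> {\<alpha><..<\<beta>} - S \<Longrightarrow> r x \<ge> \<kappa>"
    and start: "u \<alpha> * w \<alpha> = 0"
begin

text \<open>The derivative of u w is w^2 + r u^2. The product is the right quantity to follow
  because (u^2)' = 2 u w and (w^2)' = 2 r u w, so its sign controls both squares.\<close>

lemma hyperbolic_product_nonneg:
  assumes x: "x \<in> {\<alpha>..\<beta>}"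
  shows "u x * w x \<ge> 0"
proof -
  have "u \<alpha> * w \<alpha> \<le> u x * w x"
  proof (rule deriv_nonneg_imp_le[where f = "\<lambda>x. u x * w x", OF _ _ S])
    show "continuous_on {\<alpha>..x} (\<lambda>x. u x * w x)"
      using x by (intro continuous_intros continuous_on_subset[OF cont(1)] continuous_on_subset[OF cont(2)]) auto
    fix y assume y: "y \<in> {\<alpha><..<x} - S"
    hence y': "y \<in> {\<alpha><..<\<beta>} - S" using x by auto
    have "((\<lambda>x. u x * w x) has_real_derivative w y * w y + r y * (u y * u y)) (at y)"
      by (rule derivative_eq_intros ode y' refl)+ (simp add: algebra_simps)
    moreover have "w y * w y + r y * (u y * u y) \<ge> 0" using r[OF y'] \<kappa> by simp
    ultimately show "\<exists>d\<ge>0. ((\<lambda>x. u x * w x) has_real_derivative d) (at y)" by blast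
  qed (use x in auto)
  thus ?thesis using start by simp
qed

lemma hyperbolic_squares_mono:
  assumes x: "x \<in> {\<alpha>..\<beta>}"
  shows "(u \<alpha>)\<^sup>2 \<le> (u x)\<^sup>2" "(w \<alpha>)\<^sup>2 \<le> (w x)\<^sup>2"
proof -
  show "(u \<alpha>)\<^sup>2 \<le> (u x)\<^sup>2"
  proof (rule deriv_nonneg_imp_le[where f = "\<lambda>x. (u x)\<^sup>2", OF _ _ S])
    show "continuous_on {\<alpha>..x} (\<lambda>x. (u x)\<^sup>2)"
      using x by (intro continuous_intros continuous_on_subset[OF cont(1)]) auto
    fix y assume y: "y \<in> {\<alpha><..<x} - S"
    hence y': "y \<in> {\<alpha><..<\<beta>} - S" using x by auto
    have "((\<lambda>x. (u x)\<^sup>2) has_real_derivative 2 * (u y * w y)) (at y)"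
      by (rule derivative_eq_intros ode y' refl)+ simp
    thus "\<exists>d\<ge>0. ((\<lambda>x. (u x)\<^sup>2) has_real_derivative d) (at y)"
      using hyperbolic_product_nonneg[of y] y' by (intro exI[of _ "2 * (u y * w y)"]) auto
  qed (use x in auto)
  show "(w \<alpha>)\<^sup>2 \<le> (w x)\<^sup>2"
  proof (rule deriv_nonneg_imp_le[where f = "\<lambda>x. (w x)\<^sup>2", OF _ _ S])
    show "continuous_on {\<alpha>..x} (\<lambda>x. (w x)\<^sup>2)"
      using x by (intro continuous_intros continuous_on_subset[OF cont(2)]) auto
    fix y assume y: "y \<in> {\<alpha><..<x} - S"
    hence y': "y \<in> {\<alpha><..<\<beta>} - S" using x by auto
    have "((\<lambda>x. (w x)\<^sup>2) has_real_derivative 2 * (r y * (u y * w y))) (at y)"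
      by (rule derivative_eq_intros ode y' refl)+ simp
    moreover have "2 * (r y * (u y * w y)) \<ge> 0"
      using hyperbolic_product_nonneg[of y] y' r[OF y'] \<kappa> by auto
    ultimately show "\<exists>d\<ge>0. ((\<lambda>x. (w x)\<^sup>2) has_real_derivative d) (at y)" by blast
  qed (use x in auto)
qed

text \<open>From u^2 >= 1 one gets (u w)' >= \<kappa>, then u w >= \<kappa> (x - \<alpha>), and then
  (u^2)' >= 2 \<kappa> (x - \<alpha>). This quadratic bound stands in for a hyperbolic cosine; it is
  unbounded in \<kappa>, and that is what large A exploits.\<close>

lemma hyperbolic_growth:
  assumes u: "u \<alpha> = 1" and "\<alpha> \<le> \<beta>"
  shows "(u \<beta>)\<^sup>2 \<ge> 1 + \<kappa> * (\<beta> - \<alpha>)\<^sup>2"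
proof -
  have uw: "u x * w x - \<kappa> * (x - \<alpha>) \<ge> 0" if x: "x \<in> {\<alpha>..\<beta>}" for x
  proof -
    have "u \<alpha> * w \<alpha> - \<kappa> * (\<alpha> - \<alpha>) \<le> u x * w x - \<kappa> * (x - \<alpha>)"
    proof (rule deriv_nonneg_imp_le[where f = "\<lambda>x. u x * w x - \<kappa> * (x - \<alpha>)", OF _ _ S])
      show "continuous_on {\<alpha>..x} (\<lambda>x. u x * w x - \<kappa> * (x - \<alpha>))"
        using x by (intro continuous_intros continuous_on_subset[OF cont(1)] continuous_on_subset[OF cont(2)]) auto
      fix y assume y: "y \<in> {\<alpha><..<x} - S"
      hence y': "y \<in> {\<alpha><..<\<beta>} - S" using x by auto
      have "((\<lambda>x. u x * w x - \<kappa> * (x - \<alpha>)) has_real_derivative w y * w y + r y * (u y)\<^sup>2 - \<kappa>) (at y)"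
        by (rule derivative_eq_intros ode y' refl)+ (simp add: algebra_simps power2_eq_square)
      moreover have "w y * w y + r y * (u y)\<^sup>2 - \<kappa> \<ge> 0"
      proof -
        have "1 \<le> (u y)\<^sup>2" using hyperbolic_squares_mono(1)[of y] y' u by simp
        hence "\<kappa> * 1 \<le> r y * (u y)\<^sup>2" using r[OF y'] \<kappa> by (intro mult_mono) auto
        thus ?thesis using zero_le_square[of "w y"] by linarith
      qed
      ultimately show "\<exists>d\<ge>0. ((\<lambda>x. u x * w x - \<kappa> * (x - \<alpha>)) has_real_derivative d) (at y)" by blast
    qed (use x in auto)
    thus ?thesis using start by simp
  qed
  have "(u \<alpha>)\<^sup>2 - \<kappa> * (\<alpha> - \<alpha>)\<^sup>2 \<le> (u \<beta>)\<^sup>2 - \<kappa> * (\<beta> - \<alpha>)\<^sup>2"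
  proof (rule deriv_nonneg_imp_le[where f = "\<lambda>x. (u x)\<^sup>2 - \<kappa> * (x - \<alpha>)\<^sup>2", OF \<open>\<alpha> \<le> \<beta>\<close> _ S])
    show "continuous_on {\<alpha>..\<beta>} (\<lambda>x. (u x)\<^sup>2 - \<kappa> * (x - \<alpha>)\<^sup>2)" by (intro continuous_intros cont)
    fix y assume y: "y \<in> {\<alpha><..<\<beta>} - S"
    have "((\<lambda>x. (u x)\<^sup>2 - \<kappa> * (x - \<alpha>)\<^sup>2) has_real_derivative 2 * (u y * w y - \<kappa> * (y - \<alpha>))) (at y)"
      by (rule derivative_eq_intros ode y refl)+ (simp add: algebra_simps)
    thus "\<exists>d\<ge>0. ((\<lambda>x. (u x)\<^sup>2 - \<kappa> * (x - \<alpha>)\<^sup>2) has_real_derivative d) (at y)"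
      using uw[of y] y by (intro exI[of _ "2 * (u y * w y - \<kappa> * (y - \<alpha>))"]) auto
  qed
  thus ?thesis using u by simp
qed

end

section \<open>Large smooth potentials\<close>

context fundamental_family
begin

lemma half_trace_continuous: "continuous_on UNIV (half_trace q m L)"
  by (rule holomorphic_on_imp_continuous_on[OF half_trace_holomorphic])

text \<open>On a punctured neighbourhood |F| < 1, so \<sigma> F has a local maximum at \<omega> and
  its derivative vanishes. As \<omega> is nonzero, the chain rule passes this to the derivative in
  the energy \<omega>^2, where \<open>critical_energy_monodromy\<close> applies.\<close>

lemma degenerate_edge_monodromy:
  assumes w: "\<omega> > 0" and deg: "degenerate_band_edge (half_trace q m L) \<omega>"
  obtains \<sigma> :: real where "\<sigma> = 1 \<or> \<sigma> = -1"
    "\<psi>1 (complex_of_real (\<omega>\<^sup>2)) L = complex_of_real \<sigma>" "\<psi>2 (complex_of_real (\<omega>\<^sup>2)) L = 0"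
    "\<phi>1 (complex_of_real (\<omega>\<^sup>2)) L = 0" "\<phi>2 (complex_of_real (\<omega>\<^sup>2)) L = complex_of_real \<sigma>"
proof -
  let ?F = "half_trace q m L"
  let ?E = "complex_of_real (\<omega>\<^sup>2)"
  define f where "f x = Re (?F (complex_of_real x))" for x
  have F_f: "?F (complex_of_real x) = complex_of_real (f x)" for x
    unfolding f_def by (rule half_trace_real)
  obtain \<epsilon> where e: "\<epsilon> > 0" "\<And>x. x \<noteq> \<omega> \<Longrightarrow> \<bar>x - \<omega>\<bar> < \<epsilon> \<Longrightarrow> cmod (?F (complex_of_real x)) < 1"
    using degenerate_band_edge_imp(1)[OF half_trace_continuous assms] by blast
  define \<sigma> where "\<sigma> = f \<omega>"
  have "\<bar>\<sigma>\<bar> = 1"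
    using degenerate_band_edge_imp(2)[OF half_trace_continuous assms] by (simp add: F_f \<sigma>_def)
  hence \<sigma>: "\<sigma> = 1 \<or> \<sigma> = -1" by linarith
  obtain \<delta> where \<delta>: "(discriminant has_field_derivative \<delta>) (at ?E)"
    using discriminant_has_derivative by blast
  have "((\<lambda>w. discriminant (w\<^sup>2)) has_field_derivative \<delta> * (2 * complex_of_real \<omega>)) (at (complex_of_real \<omega>))"
    using \<delta> by (intro DERIV_chain2[of discriminant]) (auto intro!: derivative_eq_intros)
  from DERIV_cdivide[OF this, of 2]
  have "(?F has_field_derivative \<delta> * complex_of_real \<omega>) (at (complex_of_real \<omega>))"
    unfolding half_trace_eq[abs_def] by simp
  hence "((\<lambda>x. ?F (complex_of_real x)) has_vector_derivative \<delta> * complex_of_real \<omega>) (at \<omega>)"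
    by (rule has_vector_derivative_real_field)
  hence vd: "((\<lambda>x. complex_of_real (f x)) has_vector_derivative \<delta> * complex_of_real \<omega>) (at \<omega>)"
    by (simp only: F_f)
  have "((\<lambda>x. f x) has_real_derivative Re (\<delta> * complex_of_real \<omega>)) (at \<omega>)"
    using bounded_linear.has_vector_derivative[OF bounded_linear_Re vd]
    by (simp add: has_real_derivative_iff_has_vector_derivative)
  hence "((\<lambda>x. \<sigma> * f x) has_real_derivative \<sigma> * Re (\<delta> * complex_of_real \<omega>)) (at \<omega>)"
    by (rule DERIV_cmult)
  moreover have "\<forall>y. \<bar>\<omega> - y\<bar> < \<epsilon> \<longrightarrow> \<sigma> * f y \<le> \<sigma> * f \<omega>"
  proof (intro allI impI)
    fix y assume "\<bar>\<omega> - y\<bar> < \<epsilon>"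
    hence "\<bar>f y\<bar> < 1" if "y \<noteq> \<omega>" using e(2)[OF that] by (simp add: F_f abs_minus_commute)
    thus "\<sigma> * f y \<le> \<sigma> * f \<omega>" using \<sigma> by (cases "y = \<omega>") (auto simp: \<sigma>_def[symmetric])
  qed
  ultimately have "\<sigma> * Re (\<delta> * complex_of_real \<omega>) = 0" by (rule DERIV_local_max[OF _ e(1)])
  hence Re0: "Re \<delta> = 0" using \<sigma> w by auto
  \<comment> \<open>The maximum only controls the real part of the complex derivative; the imaginary
    part vanishes because the trace is real along the axis.\<close>
  have "((\<lambda>x. 0) has_vector_derivative Im (\<delta> * complex_of_real \<omega>)) (at \<omega>)"
    using bounded_linear.has_vector_derivative[OF bounded_linear_Im vd] by simp
  hence "Im (\<delta> * complex_of_real \<omega>) = 0"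
    by (rule vector_derivative_unique_at[OF _ has_vector_derivative_const])
  hence "\<delta> = 0" using Re0 w by (simp add: complex_eq_iff)
  hence D': "(discriminant has_field_derivative 0) (at ?E)" using \<delta> by simp
  have D: "discriminant ?E = 2 * complex_of_real \<sigma>"
    using F_f[of \<omega>] by (simp add: half_trace_eq \<sigma>_def)
  show ?thesis by (rule that[OF \<sigma>]; rule critical_energy_monodromy[OF \<sigma> D D'])
qed

lemma group_velocity_degenerate_edge:
  assumes w: "\<omega> > 0" and deg: "degenerate_band_edge (half_trace q m L) \<omega>"
  defines "D \<equiv> real_gram11 (\<omega>\<^sup>2) * real_gram22 (\<omega>\<^sup>2) - (real_gram12 (\<omega>\<^sup>2))\<^sup>2"
  shows "group_velocity L (half_trace q m L) \<omega> = L / (2 * \<omega> * sqrt D)"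
proof -
  let ?F = "half_trace q m L"
  let ?E = "complex_of_real (\<omega>\<^sup>2)"
  define k where "k = (SOME k. dispersion_relation ?F k)"
  have k: "dispersion_relation ?F k"
    unfolding k_def by (rule someI_ex[OF dispersion_relation_half_trace])
  obtain \<sigma> :: real where \<sigma>: "\<sigma> = 1 \<or> \<sigma> = -1"
    and M: "\<psi>1 ?E L = complex_of_real \<sigma>" "\<psi>2 ?E L = 0" "\<phi>1 ?E L = 0" "\<phi>2 ?E L = complex_of_real \<sigma>"
    using degenerate_edge_monodromy[OF w deg] by blast
  have \<sigma>': "complex_of_real \<sigma> = 1 \<or> complex_of_real \<sigma> = -1" using \<sigma> by auto
  define det where "det E' = I11 ?E E' * I22 ?E E' - I12 ?E E' * I21 ?E E'" for E'
  \<comment> \<open>From (\<omega>^2 - z^2)^2 = (z - \<omega>)^2 (z + \<omega>)^2 and the 1 / 2 of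
    the determinant formula. At z = \<omega> the value is 2 \<omega>^2 D, so the derivative of
    \<open>k\<close> is the root of 4 \<omega>^2 D.\<close>
  define G where "G z = (z + complex_of_real \<omega>)\<^sup>2 * det (z\<^sup>2) / 2" for z
  have FG: "?F z = complex_of_real \<sigma> * (1 - (z - complex_of_real \<omega>)\<^sup>2 * G z)" for z
  proof -
    have "(?E - z\<^sup>2)\<^sup>2 = (z - complex_of_real \<omega>)\<^sup>2 * (z + complex_of_real \<omega>)\<^sup>2"
      by (simp add: power2_eq_square algebra_simps)
    thus ?thesis
      unfolding half_trace_eq discriminant_near_identity_monodromy[OF M \<sigma>'] G_def det_def[symmetric]
      by (simp add: field_simps)
  qed
  have det_E: "det ?E = complex_of_real D"
    unfolding det_def I_real D_def by (simp add: power2_eq_square)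
  have "(det \<longlongrightarrow> det ?E) (at ?E)" unfolding det_def by (intro tendsto_intros I_tendsto)
  hence c: "isCont det ((complex_of_real \<omega>)\<^sup>2)" by (simp add: isCont_def)
  have "isCont (\<lambda>z. det (z\<^sup>2)) (complex_of_real \<omega>)"
    by (rule isCont_o2[where f = "\<lambda>z. z\<^sup>2" and g = det, OF _ c]) simp
  hence "((\<lambda>z. det (z\<^sup>2)) \<longlongrightarrow> complex_of_real D) (at (complex_of_real \<omega>))"
    using det_E by (simp add: isCont_def)
  hence "(G \<longlongrightarrow> (complex_of_real \<omega> + complex_of_real \<omega>)\<^sup>2 * complex_of_real D / 2) (at (complex_of_real \<omega>))"
    unfolding G_def by (intro tendsto_intros) auto
  moreover have "(complex_of_real \<omega> + complex_of_real \<omega>)\<^sup>2 * complex_of_real D / 2 = complex_of_real (2 * \<omega>\<^sup>2 * D)"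
    by (simp add: power2_eq_square)
  ultimately have G: "(G \<longlongrightarrow> complex_of_real (2 * \<omega>\<^sup>2 * D)) (at (complex_of_real \<omega>))"
    by (simp only:)
  have D: "D > 0" unfolding D_def by (rule real_gram_det_pos)
  have "((\<lambda>y. k (complex_of_real y)) has_vector_derivative
      complex_of_real (sqrt (2 * (2 * \<omega>\<^sup>2 * D)))) (at \<omega>)"
    by (rule dispersion_derivative_degenerate_edge[OF k w half_trace_continuous \<sigma>' FG G]) (use w D in simp)
  moreover have "sqrt (2 * (2 * \<omega>\<^sup>2 * D)) = 2 * \<omega> * sqrt D"
  proof -
    have "2 * (2 * \<omega>\<^sup>2 * D) = (2 * \<omega>)\<^sup>2 * D" by (simp add: power2_eq_square)
    thus ?thesis using w by (simp add: real_sqrt_mult)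
  qed
  moreover have "(\<lambda>y. k (complex_of_real y)) = dispersion ?F"
    by (simp add: dispersion_def[abs_def] k_def)
  ultimately have "vector_derivative (dispersion ?F) (at \<omega>) = complex_of_real (2 * \<omega> * sqrt D)"
    by (simp add: vector_derivative_at)
  thus ?thesis
    using degenerate_imp_not_nondegenerate[OF half_trace_continuous w deg] by (simp add: group_velocity_def)
qed

end

lemma schroedinger_solution_Re:
  assumes "schroedinger_solution q m L (complex_of_real e) \<psi> \<phi>"
  obtains S where "finite S"
    "\<And>x. x \<in> {0<..<L} - S \<Longrightarrow> ((\<lambda>x. Re (\<psi> x)) has_real_derivative Re (\<phi> x)) (at x)"
    "\<And>x. x \<in> {0<..<L} - S \<Longrightarrow> ((\<lambda>x. Re (\<phi> x)) has_real_derivative (q x - e) * Re (\<psi> x)) (at x)"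
proof -
  obtain S where S: "finite S"
    "\<And>x. x \<in> {0<..<L} - S \<Longrightarrow> (\<psi> has_vector_derivative \<phi> x) (at x)"
    "\<And>x. x \<in> {0<..<L} - S \<Longrightarrow>
      (\<phi> has_vector_derivative (complex_of_real (q x) - complex_of_real e) * \<psi> x) (at x)"
    using assms unfolding schroedinger_solution_def by blast
  have "((\<lambda>x. Re (\<psi> x)) has_real_derivative Re (\<phi> x)) (at x)"
    "((\<lambda>x. Re (\<phi> x)) has_real_derivative (q x - e) * Re (\<psi> x)) (at x)"
    if "x \<in> {0<..<L} - S" for x
    using bounded_linear.has_vector_derivative[OF bounded_linear_Re S(2)[OF that]]
      bounded_linear.has_vector_derivative[OF bounded_linear_Re S(3)[OF that]]
    by (simp_all add: has_real_derivative_iff_has_vector_derivative)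
  thus ?thesis using that[OF S(1)] by blast
qed

text \<open>The growth bound only speaks about squares. The second and third conclusions keep the
  function out of (-1, 1) along the whole interval, so that continuity can determine its sign at the
  far end.\<close>

lemma schroedinger_growth_interval:
  assumes s: "schroedinger_solution q (\<lambda>x. 0) L (complex_of_real e) \<psi> \<phi>"
    and ab: "0 \<le> \<alpha>" "\<alpha> \<le> \<beta>" "\<beta> \<le> L" and q: "\<And>x. x \<in> {\<alpha><..<\<beta>} \<Longrightarrow> q x \<ge> e + \<kappa>" and "\<kappa> \<ge> 0"
  shows "\<psi> \<alpha> = 1 \<Longrightarrow> \<phi> \<alpha> = 0 \<Longrightarrow> 1 + \<kappa> * (\<beta> - \<alpha>)\<^sup>2 \<le> (Re (\<psi> \<beta>))\<^sup>2"
    and "\<psi> \<alpha> = 1 \<Longrightarrow> \<phi> \<alpha> = 0 \<Longrightarrow> x \<in> {\<alpha>..\<beta>} \<Longrightarrow> 1 \<le> (Re (\<psi> x))\<^sup>2"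
    and "\<psi> \<alpha> = 0 \<Longrightarrow> \<phi> \<alpha> = 1 \<Longrightarrow> x \<in> {\<alpha>..\<beta>} \<Longrightarrow> 1 \<le> (Re (\<phi> x))\<^sup>2"
proof -
  obtain S where S: "finite S"
    "\<And>x. x \<in> {0<..<L} - S \<Longrightarrow> ((\<lambda>x. Re (\<psi> x)) has_real_derivative Re (\<phi> x)) (at x)"
    "\<And>x. x \<in> {0<..<L} - S \<Longrightarrow> ((\<lambda>x. Re (\<phi> x)) has_real_derivative (q x - e) * Re (\<psi> x)) (at x)"
    using schroedinger_solution_Re[OF s] by blast
  have c: "continuous_on {\<alpha>..\<beta>} (\<lambda>x. Re (\<psi> x))" "continuous_on {\<alpha>..\<beta>} (\<lambda>x. Re (\<phi> x))"
    using ab by (intro continuous_intros continuous_on_subset[OF schroedinger_solution_continuous[OF s]]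
      continuous_on_subset[OF schroedinger_solution_no_mass_continuous[OF s]]; simp)+
  have d: "\<And>x. x \<in> {\<alpha><..<\<beta>} - S \<Longrightarrow> ((\<lambda>x. Re (\<psi> x)) has_real_derivative Re (\<phi> x)) (at x)"
    "\<And>x. x \<in> {\<alpha><..<\<beta>} - S \<Longrightarrow> ((\<lambda>x. Re (\<phi> x)) has_real_derivative (q x - e) * Re (\<psi> x)) (at x)"
    using S ab by auto
  have r: "\<And>x. x \<in> {\<alpha><..<\<beta>} - S \<Longrightarrow> \<kappa> \<le> q x - e" using q by force
  note growth = hyperbolic_growth[OF c S(1) \<open>\<kappa> \<ge> 0\<close> d r] and mono = hyperbolic_squares_mono[OF c S(1) \<open>\<kappa> \<ge> 0\<close> d r]
  show "\<psi> \<alpha> = 1 \<Longrightarrow> \<phi> \<alpha> = 0 \<Longrightarrow> 1 + \<kappa> * (\<beta> - \<alpha>)\<^sup>2 \<le> (Re (\<psi> \<beta>))\<^sup>2"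
    using growth ab by simp
  show "\<psi> \<alpha> = 1 \<Longrightarrow> \<phi> \<alpha> = 0 \<Longrightarrow> x \<in> {\<alpha>..\<beta>} \<Longrightarrow> 1 \<le> (Re (\<psi> x))\<^sup>2"
    using mono(1)[of x] by simp
  show "\<psi> \<alpha> = 0 \<Longrightarrow> \<phi> \<alpha> = 1 \<Longrightarrow> x \<in> {\<alpha>..\<beta>} \<Longrightarrow> 1 \<le> (Re (\<phi> x))\<^sup>2"
    using mono(2)[of x] by simp
qed

text \<open>The constant \<open>C\<close> does not depend on \<open>A\<close>, because \<open>\<bar>p'\<bar> / p\<close> is bounded by \<open>sup \<bar>v'\<bar> / c\<close> for \<open>p = e - A v\<close>.\<close>

lemma negative_piece_energy_bound:
  assumes v: "smooth_piece \<alpha> \<beta> v" and ab: "0 \<le> \<alpha>" "\<alpha> < \<beta>" "\<beta> \<le> L"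
    and c: "c > 0" "\<And>x. x \<in> {\<alpha><..<\<beta>} \<Longrightarrow> v x \<le> - c"
  shows "\<exists>C>0. \<forall>A>0. \<forall>e\<ge>0. \<forall>\<psi> \<phi>.
    schroedinger_solution (\<lambda>x. A * v x) (\<lambda>x. 0) L (complex_of_real e) \<psi> \<phi> \<longrightarrow>
    (\<forall>x\<in>{\<alpha>..\<beta>}. \<forall>y\<in>{\<alpha>..\<beta>}. (cmod (\<psi> x))\<^sup>2 \<le> C * ((cmod (\<phi> y))\<^sup>2 / (A * c) + (cmod (\<psi> y))\<^sup>2))"
proof -
  obtain w K where w: "continuous_on {\<alpha>..\<beta>} w" "\<And>x. x \<in> {\<alpha><..<\<beta>} \<Longrightarrow> w x = v x"
    "K \<ge> 0" "\<And>x. x \<in> {\<alpha><..<\<beta>} \<Longrightarrow> \<exists>d. (w has_real_derivative d) (at x) \<and> \<bar>d\<bar> \<le> K"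
    using smooth_piece_extension[OF v ab(2)] by metis
  have wc: "w x \<le> - c" if "x \<in> {\<alpha>..\<beta>}" for x
    by (rule continuous_le_on_closure[of "{\<alpha><..<\<beta>}" w]) (use w c that ab in auto)
  define C where "C = exp (K / c * (\<beta> - \<alpha>))"
  have "(cmod (\<psi> x))\<^sup>2 \<le> C * ((cmod (\<phi> y))\<^sup>2 / (A * c) + (cmod (\<psi> y))\<^sup>2)"
    if A: "A > 0" and e: "e \<ge> 0" and s: "schroedinger_solution (\<lambda>x. A * v x) (\<lambda>x. 0) L (complex_of_real e) \<psi> \<phi>"
      and xy: "x \<in> {\<alpha>..\<beta>}" "y \<in> {\<alpha>..\<beta>}" for A e \<psi> \<phi> x y
  proof -
    define p where "p x = e - A * w x" for x
    define H where "H x = (cmod (\<phi> x))\<^sup>2 / p x + (cmod (\<psi> x))\<^sup>2" for x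
    have Ac: "A * c > 0" using A c by simp
    have p_ge: "p x \<ge> A * c" if "x \<in> {\<alpha>..\<beta>}" for x
      using mult_left_mono[of c "- w x" A] wc[OF that] A e unfolding p_def by simp
    have p_pos: "p x > 0" if "x \<in> {\<alpha>..\<beta>}" for x using p_ge[OF that] Ac by linarith
    have p': "\<exists>d. (p has_real_derivative d) (at x) \<and> \<bar>d\<bar> \<le> K / c * p x" if x: "x \<in> {\<alpha><..<\<beta>}" for x
    proof -
      obtain d where d: "(w has_real_derivative d) (at x)" "\<bar>d\<bar> \<le> K" using w(4)[OF x] by blast
      have "(p has_real_derivative - A * d) (at x)"
        unfolding p_def[abs_def] by (rule derivative_eq_intros d refl)+ simp
      moreover have "\<bar>- A * d\<bar> \<le> K / c * p x"
      proof -
        have "K / c * (A * c) \<le> K / c * p x" using w(3) c p_ge[of x] x by (intro mult_left_mono) auto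
        moreover have "\<bar>- A * d\<bar> \<le> A * K" using A d(2) by (simp add: abs_mult)
        ultimately show ?thesis using c by (simp add: mult.commute)
      qed
      ultimately show ?thesis by blast
    qed
    obtain S where S: "finite S"
      "\<And>x. x \<in> {0<..<L} - S \<Longrightarrow> (\<psi> has_vector_derivative \<phi> x) (at x)"
      "\<And>x. x \<in> {0<..<L} - S \<Longrightarrow>
        (\<phi> has_vector_derivative (complex_of_real (A * v x) - complex_of_real e) * \<psi> x) (at x)"
      using s unfolding schroedinger_solution_def by blast
    have H_le: "H b \<le> C * H a \<and> H a \<le> C * H b" if "\<alpha> \<le> a" "a \<le> b" "b \<le> \<beta>" for a b
    proof -
      have c': "continuous_on {a..b} \<psi>" "continuous_on {a..b} \<phi>" "continuous_on {a..b} p"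
        unfolding p_def using ab that
        by (intro continuous_intros continuous_on_subset[OF schroedinger_solution_continuous[OF s]]
          continuous_on_subset[OF schroedinger_solution_no_mass_continuous[OF s]] continuous_on_subset[OF w(1)]; simp)+
      have d: "(\<psi> has_vector_derivative \<phi> x) (at x)" "(\<phi> has_vector_derivative - complex_of_real (p x) * \<psi> x) (at x)"
        if x: "x \<in> {a<..<b} - S" for x
      proof -
        have x': "x \<in> {0<..<L} - S" "x \<in> {\<alpha><..<\<beta>}" using x ab \<open>\<alpha> \<le> a\<close> \<open>b \<le> \<beta>\<close> by auto
        show "(\<psi> has_vector_derivative \<phi> x) (at x)" by (rule S(2)[OF x'(1)])
        have "complex_of_real (A * v x) - complex_of_real e = - complex_of_real (p x)"
          using w(2)[OF x'(2)] by (simp add: p_def)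
        thus "(\<phi> has_vector_derivative - complex_of_real (p x) * \<psi> x) (at x)" using S(3)[OF x'(1)] by simp
      qed
      have pp: "\<And>x. x \<in> {a..b} \<Longrightarrow> p x > 0" using p_pos that by auto
      have pd: "\<And>x. x \<in> {a<..<b} \<Longrightarrow> \<exists>d. (p has_real_derivative d) (at x) \<and> \<bar>d\<bar> \<le> K / c * p x"
        using p' that by auto
      have H0: "H a \<ge> 0" "H b \<ge> 0" using pp[of a] pp[of b] that by (auto simp: H_def)
      have "exp (K / c * (b - a)) \<le> C"
        unfolding C_def exp_le_cancel_iff using w(3) c that by (intro mult_left_mono) auto
      note C_le = mult_right_mono[OF this H0(1)] mult_right_mono[OF this H0(2)]
      show ?thesis
        using energy_exponential_bounds[OF that(2) c' S(1) pp d pd, folded H_def] C_le by linarith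
    qed
    have "(cmod (\<psi> x))\<^sup>2 \<le> H x" using p_pos[OF xy(1)] by (simp add: H_def)
    also have "H x \<le> C * H y" using H_le[of x y] H_le[of y x] xy by (cases "x \<le> y") auto
    \<comment> \<open>Only p >= A c is used at \<open>y\<close>, so the Cauchy data there enter with
      an explicit power of A.\<close>
    also have "\<dots> \<le> C * ((cmod (\<phi> y))\<^sup>2 / (A * c) + (cmod (\<psi> y))\<^sup>2)"
      unfolding H_def using p_ge[OF xy(2)] p_pos[OF xy(2)] Ac
      by (intro mult_left_mono add_right_mono divide_left_mono) (auto simp: C_def)
    finally show ?thesis .
  qed
  moreover have "C > 0" by (simp add: C_def)
  ultimately show ?thesis by blast
qed

text \<open>\<open>\<psi>1\<close> exceeds 1 and \<open>\<phi>2\<close> is at least 1 at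
  \<open>L\<close>, so half their sum exceeds 1. The threshold for A makes the potential exceed the
  energy by \<kappa> = 1, which is enough: strictness comes from the positive length
  \<open>L\<close>.\<close>

lemma positive_potential_in_gap:
  assumes L: "L > 0" and w: "\<omega> > 0" and v: "smooth_piece 0 L v" and c: "c > 0" "\<And>x. x \<in> {0<..<L} \<Longrightarrow> v x \<ge> c"
  shows "\<forall>\<^sub>F A in at_top. in_gap (half_trace (\<lambda>x. A * v x) (\<lambda>x. 0) L) \<omega>"
  using eventually_gt_at_top[of "(\<omega>\<^sup>2 + 1) / c"]
proof eventually_elim
  case (elim A)
  hence A: "\<omega>\<^sup>2 + 1 < A * c" using c by (simp add: pos_divide_less_eq)
  have "0 \<le> \<omega>\<^sup>2" by simp
  hence "0 < A * c" using A by linarith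
  hence A0: "A > 0" using c by (simp add: zero_less_mult_iff)
  obtain u where u: "continuous_on {0..L} u" "\<And>x. x \<in> {0<..<L} \<Longrightarrow> u x = v x"
    using smooth_piece_extension[OF v L] by metis
  have "\<exists>\<psi>1 \<phi>1 \<psi>2 \<phi>2. fundamental_family (\<lambda>x. A * v x) (\<lambda>x. 0) L \<psi>1 \<phi>1 \<psi>2 \<phi>2"
    using L u by (intro fundamental_family_exists[of L L "\<lambda>x. A * u x" "\<lambda>x. 0"] continuous_intros) auto
  then obtain \<psi>1 \<phi>1 \<psi>2 \<phi>2 where "fundamental_family (\<lambda>x. A * v x) (\<lambda>x. 0) L \<psi>1 \<phi>1 \<psi>2 \<phi>2" by blast
  then interpret fundamental_family "\<lambda>x. A * v x" "\<lambda>x. 0" L \<psi>1 \<phi>1 \<psi>2 \<phi>2 .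
  let ?E = "complex_of_real (\<omega>\<^sup>2)"
  have q: "A * v x \<ge> \<omega>\<^sup>2 + 1" if "x \<in> {0<..<L}" for x
    using mult_left_mono[OF c(2)[OF that], of A] A A0 by linarith
  note g1 = schroedinger_growth_interval[OF sol1[of ?E] order_refl less_imp_le[OF L] order_refl q]
  note g2 = schroedinger_growth_interval[OF sol2[of ?E] order_refl less_imp_le[OF L] order_refl q]
  \<comment> \<open>A function that starts at 1 and never enters (-1, 1) cannot change sign.\<close>
  have pos: "f L \<ge> 1" if "continuous_on {0..L} f" "f 0 = 1" "\<And>x. x \<in> {0..L} \<Longrightarrow> 1 \<le> (f x)\<^sup>2" for f :: "real \<Rightarrow> real"
  proof -
    have "(\<forall>x\<in>{0..L}. f x < 0) \<or> (\<forall>x\<in>{0..L}. 0 < f x)"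
      using that(3) by (intro connected_image_avoids_value connected_continuous_image that(1)) force+
    hence "f L > 0" using that(2) L by force
    thus ?thesis using that(3)[of L] L power2_le_imp_le[of 1 "f L"] by simp
  qed
  have 1: "Re (\<psi>1 ?E L) \<ge> 1"
    by (rule pos) (auto intro!: continuous_intros cont1 g1(2) simp del: of_real_power)
  have "(Re (\<psi>1 ?E L))\<^sup>2 \<ge> 1 + 1 * (L - 0)\<^sup>2" by (rule g1(1)) auto
  moreover have "(L - 0)\<^sup>2 > 0" using L by simp
  ultimately have "(Re (\<psi>1 ?E L))\<^sup>2 > 1" by linarith
  hence "Re (\<psi>1 ?E L) \<noteq> 1" by auto
  hence 1: "Re (\<psi>1 ?E L) > 1" using 1 by simp
  have 2: "Re (\<phi>2 ?E L) \<ge> 1"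
    by (rule pos) (auto intro!: continuous_intros schroedinger_solution_no_mass_continuous[OF sol2] g2(3) simp del: of_real_power)
  have "1 < Re (half_trace (\<lambda>x. A * v x) (\<lambda>x. 0) L (complex_of_real \<omega>))"
    using 1 2 by (simp add: half_trace_eq discriminant_def)
  also have "\<dots> \<le> cmod (half_trace (\<lambda>x. A * v x) (\<lambda>x. 0) L (complex_of_real \<omega>))" by (rule complex_Re_le_cmod)
  finally show ?case using w by (intro in_gapI) auto
qed

text \<open>Measured at x = 0 with weight 1 / (A c), the solution \<open>\<psi>1\<close> has energy
  1 and \<open>\<psi>2\<close> has energy 1 / (A c). These bound the diagonal Gram entries by L C
  and L C / (A c), so the Gram determinant is at most (L C)^2 / (A c), and the velocity is at least
  sqrt (A c) / (2 \<omega> C).\<close>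

lemma negative_potential_group_velocity:
  assumes L: "L > 0" and w: "\<omega> > 0" and v: "smooth_piece 0 L v" and c: "c > 0" "\<And>x. x \<in> {0<..<L} \<Longrightarrow> v x \<le> - c"
  shows "filterlim (\<lambda>A. group_velocity L (half_trace (\<lambda>x. A * v x) (\<lambda>x. 0) L) \<omega>) at_top
          (inf at_top (principal {A. degenerate_band_edge (half_trace (\<lambda>x. A * v x) (\<lambda>x. 0) L) \<omega>}))"
proof -
  obtain u where u: "continuous_on {0..L} u" "\<And>x. x \<in> {0<..<L} \<Longrightarrow> u x = v x"
    using smooth_piece_extension[OF v L] by metis
  obtain C where C: "C > 0" and energy: "\<forall>A>0. \<forall>e\<ge>0. \<forall>\<psi> \<phi>.
    schroedinger_solution (\<lambda>x. A * v x) (\<lambda>x. 0) L (complex_of_real e) \<psi> \<phi> \<longrightarrow>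
    (\<forall>x\<in>{0..L}. \<forall>y\<in>{0..L}. (cmod (\<psi> x))\<^sup>2 \<le> C * ((cmod (\<phi> y))\<^sup>2 / (A * c) + (cmod (\<psi> y))\<^sup>2))"
    using negative_piece_energy_bound[OF v order_refl L order_refl c] by blast
  have bound: "sqrt (A * c) / (2 * \<omega> * C) \<le> group_velocity L (half_trace (\<lambda>x. A * v x) (\<lambda>x. 0) L) \<omega>"
    if A: "A > 0" and deg: "degenerate_band_edge (half_trace (\<lambda>x. A * v x) (\<lambda>x. 0) L) \<omega>" for A
  proof -
    have "\<exists>\<psi>1 \<phi>1 \<psi>2 \<phi>2. fundamental_family (\<lambda>x. A * v x) (\<lambda>x. 0) L \<psi>1 \<phi>1 \<psi>2 \<phi>2"
      using L u by (intro fundamental_family_exists[of L L "\<lambda>x. A * u x" "\<lambda>x. 0"] continuous_intros) auto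
    then obtain \<psi>1 \<phi>1 \<psi>2 \<phi>2 where "fundamental_family (\<lambda>x. A * v x) (\<lambda>x. 0) L \<psi>1 \<phi>1 \<psi>2 \<phi>2" by blast
    then interpret fundamental_family "\<lambda>x. A * v x" "\<lambda>x. 0" L \<psi>1 \<phi>1 \<psi>2 \<phi>2 .
    let ?E = "complex_of_real (\<omega>\<^sup>2)"
    have Ac: "A * c > 0" using A c by simp
    note energy' = energy[rule_format, OF A zero_le_power2[of \<omega>]]
    have Re2: "(Re z)\<^sup>2 \<le> (cmod z)\<^sup>2" for z by (simp add: cmod_power2)
    have b1: "real_gram11 (\<omega>\<^sup>2) \<le> L * C"
    proof -
      have "real_gram11 (\<omega>\<^sup>2) \<le> integral {0..L} (\<lambda>t. C)" unfolding real_gram11_def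
      proof (rule Henstock_Kurzweil_Integration.integral_le)
        show "(\<lambda>t. (Re (\<psi>1 ?E t))\<^sup>2) integrable_on {0..L}"
          by (intro integrable_continuous_real continuous_intros cont1)
        show "(Re (\<psi>1 ?E t))\<^sup>2 \<le> C" if "t \<in> {0..L}" for t
          using energy'[OF sol1 that, of 0] L Re2[of "\<psi>1 ?E t"] by (simp del: of_real_power)
      qed auto
      thus ?thesis using L by simp
    qed
    have b2: "real_gram22 (\<omega>\<^sup>2) \<le> L * (C / (A * c))"
    proof -
      have "real_gram22 (\<omega>\<^sup>2) \<le> integral {0..L} (\<lambda>t. C / (A * c))" unfolding real_gram22_def
      proof (rule Henstock_Kurzweil_Integration.integral_le)
        show "(\<lambda>t. (Re (\<psi>2 ?E t))\<^sup>2) integrable_on {0..L}"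
          by (intro integrable_continuous_real continuous_intros cont2)
        show "(Re (\<psi>2 ?E t))\<^sup>2 \<le> C / (A * c)" if "t \<in> {0..L}" for t
          using energy'[OF sol2 that, of 0] L Re2[of "\<psi>2 ?E t"] by (simp del: of_real_power)
      qed auto
      thus ?thesis using L by simp
    qed
    define D where "D = real_gram11 (\<omega>\<^sup>2) * real_gram22 (\<omega>\<^sup>2) - (real_gram12 (\<omega>\<^sup>2))\<^sup>2"
    have D0: "D > 0" unfolding D_def by (rule real_gram_det_pos)
    have "D \<le> real_gram11 (\<omega>\<^sup>2) * real_gram22 (\<omega>\<^sup>2)" by (simp add: D_def)
    also have "\<dots> \<le> (L * C) * (L * (C / (A * c)))"
      using b1 b2 real_gram_form_pos[of 0 1 "\<omega>\<^sup>2"] L C by (intro mult_mono) auto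
    also have "\<dots> = (L * C)\<^sup>2 / (A * c)" by (simp add: power2_eq_square)
    finally have "sqrt D \<le> sqrt ((L * C)\<^sup>2 / (A * c))" by (rule real_sqrt_le_mono)
    also have "\<dots> = L * C / sqrt (A * c)" using L C by (simp add: real_sqrt_divide)
    finally have sD: "sqrt D \<le> L * C / sqrt (A * c)" .
    have "sqrt (A * c) / (2 * \<omega> * C) = L / (2 * \<omega> * (L * C / sqrt (A * c)))"
      using L C w Ac by (simp add: field_simps)
    also have "\<dots> \<le> L / (2 * \<omega> * sqrt D)"
      using L C w Ac D0 sD by (intro divide_left_mono mult_left_mono mult_pos_pos divide_pos_pos) auto
    also have "\<dots> = group_velocity L (half_trace (\<lambda>x. A * v x) (\<lambda>x. 0) L) \<omega>"
      unfolding D_def by (rule group_velocity_degenerate_edge[OF w deg, symmetric])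
    finally show ?thesis .
  qed
  have "filterlim (\<lambda>A. sqrt (A * c)) at_top at_top"
    by (intro filterlim_compose[OF sqrt_at_top] filterlim_at_top_mult_tendsto_pos[OF tendsto_const c(1) filterlim_ident])
  hence "filterlim (\<lambda>A. sqrt (A * c) / (2 * \<omega> * C)) at_top at_top"
    using w C filterlim_at_top_mult_tendsto_pos[OF tendsto_const, of "1 / (2 * \<omega> * C)" "\<lambda>A. sqrt (A * c)" at_top] by simp
  hence "filterlim (\<lambda>A. sqrt (A * c) / (2 * \<omega> * C)) at_top
     (inf at_top (principal {A. degenerate_band_edge (half_trace (\<lambda>x. A * v x) (\<lambda>x. 0) L) \<omega>}))"
    by (rule filterlim_mono) auto
  moreover have "\<forall>\<^sub>F A in inf at_top (principal {A. degenerate_band_edge (half_trace (\<lambda>x. A * v x) (\<lambda>x. 0) L) \<omega>}).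
     sqrt (A * c) / (2 * \<omega> * C) \<le> group_velocity L (half_trace (\<lambda>x. A * v x) (\<lambda>x. 0) L) \<omega>"
    unfolding eventually_inf_principal using eventually_gt_at_top[of 0] by eventually_elim (use bound in auto)
  ultimately show ?thesis by (rule filterlim_at_top_mono)
qed

text \<open>A solution with data (1, 0) at the left end of the positive interval is large, of order
  \<kappa>, in square at the right end. If M = \<sigma> I, the modulus returns after a period, so
  the negative interval connects the large value with data of energy 1, against the bound
  \<open>C\<close>, which does not depend on A.\<close>

lemma sign_changing_potential_not_degenerate:
  assumes w: "\<omega> > 0" and a: "0 < a" "a < L" and v: "smooth_piece 0 a v" "smooth_piece a L v" and c: "c > 0"
    and sgn: "(\<forall>x\<in>{0<..<a}. v x \<ge> c) \<and> (\<forall>x\<in>{a<..<L}. v x \<le> - c) \<or>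
         (\<forall>x\<in>{0<..<a}. v x \<le> - c) \<and> (\<forall>x\<in>{a<..<L}. v x \<ge> c)"
  shows "\<forall>\<^sub>F A in at_top. \<not> degenerate_band_edge (half_trace (\<lambda>x. A * v x) (\<lambda>x. 0) L) \<omega>"
proof -
  have fam: "\<exists>\<psi>1 \<phi>1 \<psi>2 \<phi>2. fundamental_family (\<lambda>x. A * v x) (\<lambda>x. 0) L \<psi>1 \<phi>1 \<psi>2 \<phi>2" for A
  proof -
    obtain u where u: "continuous_on {0..a} u" "\<And>x. x \<in> {0<..<a} \<Longrightarrow> u x = v x"
      using smooth_piece_extension[OF v(1) a(1)] by metis
    obtain u' where u': "continuous_on {a..L} u'" "\<And>x. x \<in> {a<..<L} \<Longrightarrow> u' x = v x"
      using smooth_piece_extension[OF v(2) a(2)] by metis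
    show ?thesis
      using a u u' by (intro fundamental_family_exists[of a L "\<lambda>x. A * u x" "\<lambda>x. A * u' x"] continuous_intros) auto
  qed
  have L: "L > 0" using a by simp
  \<comment> \<open>Here A c - \<omega>^2 is the excess \<kappa> over the energy on the positive
    interval of length \<open>d\<close>; the threshold gives \<kappa> d^2 >= X. Later
    \<open>X\<close> is the energy constant \<open>C\<close>.\<close>
  have large: "\<forall>\<^sub>F A in at_top. A > 0 \<and> A * c - \<omega>\<^sup>2 \<ge> 0 \<and> 1 + (A * c - \<omega>\<^sup>2) * d\<^sup>2 > X" if "d > 0" "X > 0" for d X :: real
    using eventually_ge_at_top[of "(X / d\<^sup>2 + \<omega>\<^sup>2) / c"]
  proof eventually_elim
    case (elim A)
    have pos: "X / d\<^sup>2 > 0" using that by simp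
    have "X / d\<^sup>2 + \<omega>\<^sup>2 \<le> A * c" using elim c by (simp add: pos_divide_le_eq)
    hence 1: "X / d\<^sup>2 \<le> A * c - \<omega>\<^sup>2" by linarith
    hence 2: "A * c - \<omega>\<^sup>2 \<ge> 0" using pos by linarith
    have "A * c > 0" using 1 pos w zero_less_power[OF w, of 2] by linarith
    hence "A > 0" using c by (simp add: zero_less_mult_iff)
    moreover have "X \<le> (A * c - \<omega>\<^sup>2) * d\<^sup>2" using 1 that by (simp add: pos_divide_le_eq)
    ultimately show ?case using 2 by linarith
  qed
  have Re2: "(Re z)\<^sup>2 \<le> (cmod z)\<^sup>2" for z by (simp add: cmod_power2)
  let ?E = "complex_of_real (\<omega>\<^sup>2)"
  from sgn show ?thesis
  proof (elim disjE conjE)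
    assume v_pos: "\<forall>x\<in>{0<..<a}. v x \<ge> c" and v_neg: "\<forall>x\<in>{a<..<L}. v x \<le> - c"
    obtain C where C: "C > 0" and energy: "\<forall>A>0. \<forall>e\<ge>0. \<forall>\<psi> \<phi>.
      schroedinger_solution (\<lambda>x. A * v x) (\<lambda>x. 0) L (complex_of_real e) \<psi> \<phi> \<longrightarrow>
      (\<forall>x\<in>{a..L}. \<forall>y\<in>{a..L}. (cmod (\<psi> x))\<^sup>2 \<le> C * ((cmod (\<phi> y))\<^sup>2 / (A * c) + (cmod (\<psi> y))\<^sup>2))"
      using negative_piece_energy_bound[OF v(2) less_imp_le[OF a(1)] a(2) order_refl c v_neg[rule_format]] by blast
    show ?thesis using large[OF a(1) C]
    proof eventually_elim
      case (elim A)
      show ?case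
      proof
        assume deg: "degenerate_band_edge (half_trace (\<lambda>x. A * v x) (\<lambda>x. 0) L) \<omega>"
        obtain \<psi>1 \<phi>1 \<psi>2 \<phi>2 where "fundamental_family (\<lambda>x. A * v x) (\<lambda>x. 0) L \<psi>1 \<phi>1 \<psi>2 \<phi>2" using fam by blast
        then interpret fundamental_family "\<lambda>x. A * v x" "\<lambda>x. 0" L \<psi>1 \<phi>1 \<psi>2 \<phi>2 .
        obtain \<sigma> :: real where \<sigma>: "\<sigma> = 1 \<or> \<sigma> = -1" and M: "\<psi>1 ?E L = complex_of_real \<sigma>" "\<phi>1 ?E L = 0"
          using degenerate_edge_monodromy[OF w deg] by blast
        have "1 + (A * c - \<omega>\<^sup>2) * (a - 0)\<^sup>2 \<le> (Re (\<psi>1 ?E a))\<^sup>2"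
        proof (rule schroedinger_growth_interval(1)[OF sol1])
          show "\<omega>\<^sup>2 + (A * c - \<omega>\<^sup>2) \<le> A * v x" if "x \<in> {0<..<a}" for x
            using v_pos that elim by (simp add: mult_left_mono)
        qed (use a elim in auto)
        also have "\<dots> \<le> (cmod (\<psi>1 ?E a))\<^sup>2" by (rule Re2)
        also have "\<dots> \<le> C * ((cmod (\<phi>1 ?E L))\<^sup>2 / (A * c) + (cmod (\<psi>1 ?E L))\<^sup>2)"
          by (rule energy[rule_format, OF _ zero_le_power2 sol1]) (use elim a in auto)
        also have "\<dots> = C" using \<sigma> by (auto simp: M simp del: of_real_power)
        finally show False using elim by simp
      qed
    qed
  next
    assume v_neg: "\<forall>x\<in>{0<..<a}. v x \<le> - c" and v_pos: "\<forall>x\<in>{a<..<L}. v x \<ge> c"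
    obtain C where C: "C > 0" and energy: "\<forall>A>0. \<forall>e\<ge>0. \<forall>\<psi> \<phi>.
      schroedinger_solution (\<lambda>x. A * v x) (\<lambda>x. 0) L (complex_of_real e) \<psi> \<phi> \<longrightarrow>
      (\<forall>x\<in>{0..a}. \<forall>y\<in>{0..a}. (cmod (\<psi> x))\<^sup>2 \<le> C * ((cmod (\<phi> y))\<^sup>2 / (A * c) + (cmod (\<psi> y))\<^sup>2))"
      using negative_piece_energy_bound[OF v(1) order_refl a(1) less_imp_le[OF a(2)] c v_neg[rule_format]] by blast
    have La: "L - a > 0" using a by simp
    show ?thesis using large[OF La C]
    proof eventually_elim
      case (elim A)
      show ?case
      proof
        assume deg: "degenerate_band_edge (half_trace (\<lambda>x. A * v x) (\<lambda>x. 0) L) \<omega>"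
        obtain \<psi>1 \<phi>1 \<psi>2 \<phi>2 where "fundamental_family (\<lambda>x. A * v x) (\<lambda>x. 0) L \<psi>1 \<phi>1 \<psi>2 \<phi>2" using fam by blast
        then interpret fundamental_family "\<lambda>x. A * v x" "\<lambda>x. 0" L \<psi>1 \<phi>1 \<psi>2 \<phi>2 .
        obtain \<sigma> :: real where \<sigma>: "\<sigma> = 1 \<or> \<sigma> = -1" and M: "\<psi>1 ?E L = complex_of_real \<sigma>" "\<psi>2 ?E L = 0"
          using degenerate_edge_monodromy[OF w deg] by blast
        \<comment> \<open>The solution with data (1, 0) at the break point \<open>a\<close>; its
          coefficients invert the matrix of fundamental solutions at \<open>a\<close>, whose
          determinant is 1.\<close>
        define \<psi> where "\<psi> x = \<phi>2 ?E a * \<psi>1 ?E x + - \<phi>1 ?E a * \<psi>2 ?E x" for x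
        define \<phi> where "\<phi> x = \<phi>2 ?E a * \<phi>1 ?E x + - \<phi>1 ?E a * \<phi>2 ?E x" for x
        have sol: "schroedinger_solution (\<lambda>x. A * v x) (\<lambda>x. 0) L ?E \<psi> \<phi>"
          unfolding \<psi>_def \<phi>_def by (rule schroedinger_solution_linear[OF sol1 sol2])
        have at_a: "\<psi> a = 1" "\<phi> a = 0"
          using wronskian[of a ?E] a by (simp_all add: \<psi>_def \<phi>_def algebra_simps)
        have "cmod (\<psi> L) = cmod (\<psi> 0)" using \<sigma> by (auto simp: \<psi>_def M simp del: of_real_power)
        have "1 + (A * c - \<omega>\<^sup>2) * (L - a)\<^sup>2 \<le> (Re (\<psi> L))\<^sup>2"
        proof (rule schroedinger_growth_interval(1)[OF sol])
          show "\<omega>\<^sup>2 + (A * c - \<omega>\<^sup>2) \<le> A * v x" if "x \<in> {a<..<L}" for x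
            using v_pos that elim by (simp add: mult_left_mono)
        qed (use a elim at_a in auto)
        also have "\<dots> \<le> (cmod (\<psi> L))\<^sup>2" by (rule Re2)
        also have "\<dots> = (cmod (\<psi> 0))\<^sup>2" using \<open>cmod (\<psi> L) = cmod (\<psi> 0)\<close> by simp
        also have "\<dots> \<le> C * ((cmod (\<phi> a))\<^sup>2 / (A * c) + (cmod (\<psi> a))\<^sup>2)"
          by (rule energy[rule_format, OF _ zero_le_power2 sol]) (use elim a in auto)
        also have "\<dots> = C" by (simp add: at_a)
        finally show False using elim by simp
      qed
    qed
  qed
qed

section \<open>The delta comb\<close>

definition cos_energy :: "complex \<Rightarrow> real \<Rightarrow> complex" where
  "cos_energy E x = cos (csqrt E * complex_of_real x)"

text \<open>The case \<open>E = 0\<close> fills in the removable singularity, so the free equation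
  has the solution with data (0, 1) at every complex energy, as the locale demands.\<close>

definition sin_energy :: "complex \<Rightarrow> real \<Rightarrow> complex" where
  "sin_energy E x = (if E = 0 then complex_of_real x else sin (csqrt E * complex_of_real x) / csqrt E)"

lemma cos_sin_energy_0 [simp]: "cos_energy E 0 = 1" "sin_energy E 0 = 0"
  by (simp_all add: cos_energy_def sin_energy_def)

lemma cos_energy_deriv: "(cos_energy E has_vector_derivative - E * sin_energy E x) (at x within S)"
proof (cases "E = 0")
  case True
  hence "cos_energy E = (\<lambda>x. 1)" by (simp add: cos_energy_def[abs_def])
  thus ?thesis using True by simp
next
  case False
  have "((\<lambda>z. cos (csqrt E * z)) has_field_derivative - sin (csqrt E * complex_of_real x) * csqrt E) (at (complex_of_real x))"
    by (rule derivative_eq_intros refl)+ simp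
  hence "((\<lambda>x. cos (csqrt E * complex_of_real x)) has_vector_derivative - sin (csqrt E * complex_of_real x) * csqrt E) (at x within S)"
    by (intro has_vector_derivative_at_within[OF has_vector_derivative_real_field])
  moreover have "- sin (csqrt E * complex_of_real x) * csqrt E = - E * sin_energy E x"
  proof -
    have "E = csqrt E * csqrt E" by (simp flip: power2_eq_square)
    moreover have "csqrt E \<noteq> 0" using False by simp
    ultimately show ?thesis using False by (simp add: sin_energy_def field_simps)
  qed
  ultimately show ?thesis by (simp add: cos_energy_def[abs_def])
qed

lemma sin_energy_deriv: "(sin_energy E has_vector_derivative cos_energy E x) (at x within S)"
proof (cases "E = 0")
  case True
  have "((\<lambda>x. complex_of_real x) has_vector_derivative 1) (at x within S)"
    using has_vector_derivative_of_real[OF DERIV_ident] by simp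
  thus ?thesis using True by (simp add: sin_energy_def[abs_def] cos_energy_def)
next
  case False
  have "((\<lambda>z. sin (csqrt E * z) / csqrt E) has_field_derivative cos (csqrt E * complex_of_real x)) (at (complex_of_real x))"
    using False by (auto intro!: derivative_eq_intros)
  hence "((\<lambda>x. sin (csqrt E * complex_of_real x) / csqrt E) has_vector_derivative cos (csqrt E * complex_of_real x)) (at x within S)"
    by (intro has_vector_derivative_at_within[OF has_vector_derivative_real_field])
  thus ?thesis using False by (simp add: sin_energy_def[abs_def] cos_energy_def)
qed

lemma cos_sin_energy_continuous:
  "continuous_on S (cos_energy E)" "continuous_on S (sin_energy E)"
  by (rule continuous_on_vector_derivative[OF cos_energy_deriv] continuous_on_vector_derivative[OF sin_energy_deriv])+

lemma cmod_cos_le_exp: "cmod (cos z) \<le> exp (cmod z)"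
proof -
  have "cmod (cos z) = cmod (exp (\<i> * z) + exp (- (\<i> * z))) / 2"
    by (simp add: cos_exp_eq norm_divide)
  also have "\<dots> \<le> (cmod (exp (\<i> * z)) + cmod (exp (- (\<i> * z)))) / 2"
    by (intro divide_right_mono norm_triangle_ineq) auto
  also have "\<dots> \<le> (exp (cmod z) + exp (cmod z)) / 2"
    using abs_Im_le_cmod[of z] by (intro divide_right_mono add_mono) auto
  finally show ?thesis by simp
qed

text \<open>The quotient defining the sine gives no uniform estimate near \<open>E = 0\<close>, so
  the sine is bounded as the integral of the cosine.\<close>

lemma cos_sin_energy_bounded:
  obtains B where "B \<ge> 0" "\<And>E x. cmod E \<le> R \<Longrightarrow> x \<in> {0..L} \<Longrightarrow> cmod (cos_energy E x) \<le> B"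
    "\<And>E x. cmod E \<le> R \<Longrightarrow> x \<in> {0..L} \<Longrightarrow> cmod (sin_energy E x) \<le> B"
proof -
  define C where "C = exp (sqrt \<bar>R\<bar> * \<bar>L\<bar>)"
  have c: "cmod (cos_energy E x) \<le> C" if E: "cmod E \<le> R" and x: "x \<in> {0..L}" for E x
  proof -
    have "cmod (csqrt E * complex_of_real x) \<le> sqrt \<bar>R\<bar> * \<bar>L\<bar>"
      unfolding norm_mult using E x by (intro mult_mono) auto
    thus ?thesis unfolding cos_energy_def C_def using cmod_cos_le_exp order_trans exp_le_cancel_iff by blast
  qed
  have s: "cmod (sin_energy E x) \<le> C * \<bar>L\<bar>" if E: "cmod E \<le> R" and x: "x \<in> {0..L}" for E x
  proof -
    have "(cos_energy E has_integral (sin_energy E x - sin_energy E 0)) {0..x}"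
      using x by (intro fundamental_theorem_of_calculus sin_energy_deriv) auto
    hence "sin_energy E x = integral {0..x} (cos_energy E)" by (simp add: integral_unique)
    also have "cmod \<dots> \<le> C * (x - 0)"
      using x by (intro integral_bound cos_sin_energy_continuous c E) auto
    also have "\<dots> \<le> C * \<bar>L\<bar>" using x by (intro mult_left_mono) (auto simp: C_def)
    finally show ?thesis .
  qed
  show ?thesis
  proof (rule that[of "max C (C * \<bar>L\<bar>)"])
    show "0 \<le> max C (C * \<bar>L\<bar>)" by (simp add: C_def le_max_iff_disj)
  qed (use c s in \<open>auto simp: le_max_iff_disj\<close>)
qed

lemma delta_comb_period:
  assumes "l > 0" "0 \<le> x" "x < 2 * l"
  shows "delta_comb l A x = (if x = 0 then - A else if x = l then A else 0)"
proof -
  have 1: "x \<in> range (\<lambda>n::int. (2 * of_int n + 1) * l) \<longleftrightarrow> x = l"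
  proof
    assume "x \<in> range (\<lambda>n::int. (2 * of_int n + 1) * l)"
    then obtain n :: int where n: "x = (2 * of_int n + 1) * l" by blast
    have *: "0 * l \<le> (2 * of_int n + 1) * l" "(2 * of_int n + 1) * l < 2 * l" using assms n by simp_all
    hence "0 \<le> (2 * of_int n + 1 :: real)" "(2 * of_int n + 1 :: real) < 2"
      using mult_right_le_imp_le[OF *(1)] mult_right_less_imp_less[OF *(2)] assms(1) by simp_all
    hence "n = 0" by linarith
    thus "x = l" using n by simp
  next
    assume "x = l" thus "x \<in> range (\<lambda>n::int. (2 * of_int n + 1) * l)" by (intro image_eqI[of _ _ 0]) auto
  qed
  have 2: "x \<in> range (\<lambda>n::int. 2 * of_int n * l) \<longleftrightarrow> x = 0"
  proof
    assume "x \<in> range (\<lambda>n::int. 2 * of_int n * l)"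
    then obtain n :: int where n: "x = 2 * of_int n * l" by blast
    have *: "0 * l \<le> (2 * of_int n) * l" "(2 * of_int n) * l < 2 * l" using assms n by simp_all
    hence "0 \<le> (2 * of_int n :: real)" "(2 * of_int n :: real) < 2"
      using mult_right_le_imp_le[OF *(1)] mult_right_less_imp_less[OF *(2)] assms(1) by simp_all
    hence "n = 0" by linarith
    thus "x = 0" using n by simp
  next
    assume "x = 0" thus "x \<in> range (\<lambda>n::int. 2 * of_int n * l)" by (intro image_eqI[of _ _ 0]) auto
  qed
  show ?thesis unfolding delta_comb_def indicator_def 1 2 using assms(1) by auto
qed

context
  fixes l A :: real
  assumes l: "l > 0"
begin

text \<open>Free propagation after the mass -A at \<open>0\<close>, which changes the initial slope
  from \<beta> to \<beta> - A \<alpha>. \<open>comb_slope\<close> is the slope just after the mass A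
  at \<open>l\<close>, from which the right-hand pieces start.\<close>

definition "comb_psi_left \<alpha> \<beta> E x = \<alpha> * cos_energy E x + (\<beta> - complex_of_real A * \<alpha>) * sin_energy E x"
definition "comb_phi_left \<alpha> \<beta> E x = \<alpha> * (- E * sin_energy E x) + (\<beta> - complex_of_real A * \<alpha>) * cos_energy E x"
definition "comb_slope \<alpha> \<beta> E = comb_phi_left \<alpha> \<beta> E l + complex_of_real A * comb_psi_left \<alpha> \<beta> E l"
definition "comb_psi_right \<alpha> \<beta> E x =
  comb_psi_left \<alpha> \<beta> E l * cos_energy E (x - l) + comb_slope \<alpha> \<beta> E * sin_energy E (x - l)"
definition "comb_phi_right \<alpha> \<beta> E x =
  comb_psi_left \<alpha> \<beta> E l * (- E * sin_energy E (x - l)) + comb_slope \<alpha> \<beta> E * cos_energy E (x - l)"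
definition "comb_psi \<alpha> \<beta> E x = (if x \<le> l then comb_psi_left \<alpha> \<beta> E x else comb_psi_right \<alpha> \<beta> E x)"
text \<open>Left derivatives throughout: at \<open>0\<close> the slope before the mass, hence the
  separate value \<beta>, and at \<open>l\<close> still the left formula.\<close>

definition "comb_phi \<alpha> \<beta> E x =
  (if x \<le> 0 then \<beta> else if x \<le> l then comb_phi_left \<alpha> \<beta> E x else comb_phi_right \<alpha> \<beta> E x)"

lemma comb_simps:
  "x \<le> l \<Longrightarrow> comb_psi \<alpha> \<beta> E x = comb_psi_left \<alpha> \<beta> E x"
  "l < x \<Longrightarrow> comb_psi \<alpha> \<beta> E x = comb_psi_right \<alpha> \<beta> E x"
  "x \<le> 0 \<Longrightarrow> comb_phi \<alpha> \<beta> E x = \<beta>"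
  "0 < x \<Longrightarrow> x \<le> l \<Longrightarrow> comb_phi \<alpha> \<beta> E x = comb_phi_left \<alpha> \<beta> E x"
  "l < x \<Longrightarrow> comb_phi \<alpha> \<beta> E x = comb_phi_right \<alpha> \<beta> E x"
  using l by (auto simp: comb_psi_def comb_phi_def)

lemma comb_deriv:
  "(comb_psi_left \<alpha> \<beta> E has_vector_derivative comb_phi_left \<alpha> \<beta> E x) (at x)"
  "(comb_phi_left \<alpha> \<beta> E has_vector_derivative - E * comb_psi_left \<alpha> \<beta> E x) (at x)"
  "(comb_psi_right \<alpha> \<beta> E has_vector_derivative comb_phi_right \<alpha> \<beta> E x) (at x)"
  "(comb_phi_right \<alpha> \<beta> E has_vector_derivative - E * comb_psi_right \<alpha> \<beta> E x) (at x)"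
proof -
  have shift: "((\<lambda>x. x - l) has_real_derivative 1) (at x)" by (auto intro!: derivative_eq_intros)
  have c: "((\<lambda>x. cos_energy E (x - l)) has_vector_derivative - E * sin_energy E (x - l)) (at x)"
    using vector_diff_chain_at[OF shift[unfolded has_real_derivative_iff_has_vector_derivative] cos_energy_deriv]
    by (simp add: o_def)
  have s: "((\<lambda>x. sin_energy E (x - l)) has_vector_derivative cos_energy E (x - l)) (at x)"
    using vector_diff_chain_at[OF shift[unfolded has_real_derivative_iff_has_vector_derivative] sin_energy_deriv]
    by (simp add: o_def)
  note d = cos_energy_deriv sin_energy_deriv c s
  show "(comb_psi_left \<alpha> \<beta> E has_vector_derivative comb_phi_left \<alpha> \<beta> E x) (at x)"
    unfolding comb_psi_left_def[abs_def] comb_phi_left_def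
    by (rule has_vector_derivative_eq_rhs, (rule derivative_intros d)+) (simp add: algebra_simps)
  show "(comb_phi_left \<alpha> \<beta> E has_vector_derivative - E * comb_psi_left \<alpha> \<beta> E x) (at x)"
    unfolding comb_psi_left_def comb_phi_left_def[abs_def]
    by (rule has_vector_derivative_eq_rhs, (rule derivative_intros d)+) (simp add: algebra_simps)
  show "(comb_psi_right \<alpha> \<beta> E has_vector_derivative comb_phi_right \<alpha> \<beta> E x) (at x)"
    unfolding comb_psi_right_def[abs_def] comb_phi_right_def
    by (rule has_vector_derivative_eq_rhs, (rule derivative_intros d)+) (simp add: algebra_simps)
  show "(comb_phi_right \<alpha> \<beta> E has_vector_derivative - E * comb_psi_right \<alpha> \<beta> E x) (at x)"
    unfolding comb_psi_right_def comb_phi_right_def[abs_def]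
    by (rule has_vector_derivative_eq_rhs, (rule derivative_intros d)+) (simp add: algebra_simps)
qed

lemma comb_solution:
  "schroedinger_solution (\<lambda>x. 0) (delta_comb l A) (2 * l) E (comb_psi \<alpha> \<beta> E) (comb_phi \<alpha> \<beta> E)"
proof -
  have isc: "isCont (comb_psi_left \<alpha> \<beta> E) x" "isCont (comb_phi_left \<alpha> \<beta> E) x"
    "isCont (comb_psi_right \<alpha> \<beta> E) x" "isCont (comb_phi_right \<alpha> \<beta> E) x" for x
    using comb_deriv by (blast intro: has_vector_derivative_continuous)+
  have lim: "(comb_phi_left \<alpha> \<beta> E \<longlongrightarrow> comb_phi_left \<alpha> \<beta> E x) (at x within S)"
    "(comb_phi_right \<alpha> \<beta> E \<longlongrightarrow> comb_phi_right \<alpha> \<beta> E x) (at x within S)" for x S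
    using isc(2,4) by (auto simp: isCont_def intro: tendsto_within_subset)
  have ends: "comb_phi_left \<alpha> \<beta> E 0 = \<beta> - complex_of_real A * \<alpha>" "comb_psi_left \<alpha> \<beta> E 0 = \<alpha>"
    "comb_phi_right \<alpha> \<beta> E l = comb_slope \<alpha> \<beta> E" "comb_psi_right \<alpha> \<beta> E l = comb_psi_left \<alpha> \<beta> E l"
    by (simp_all add: comb_phi_left_def comb_psi_left_def comb_phi_right_def comb_psi_right_def)
  have "continuous_on {0..2 * l} (comb_psi \<alpha> \<beta> E)"
    unfolding comb_psi_def
    by (rule continuous_on_cases_le)
       (use isc ends in \<open>auto intro!: continuous_at_imp_continuous_on continuous_intros\<close>)
  moreover have "(comb_phi \<alpha> \<beta> E \<longlongrightarrow> comb_phi \<alpha> \<beta> E x) (at_left x)" if x: "x \<in> {0<..2 * l}" for x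
  proof (cases "x \<le> l")
    case True
    have "\<forall>\<^sub>F y in at_left x. comb_phi_left \<alpha> \<beta> E y = comb_phi \<alpha> \<beta> E y"
      using eventually_at_left_real[of 0 x] x True by (auto simp: comb_simps elim!: eventually_mono)
    from Lim_transform_eventually[OF lim(1) this] show ?thesis using x True by (simp add: comb_simps)
  next
    case False
    have "\<forall>\<^sub>F y in at_left x. comb_phi_right \<alpha> \<beta> E y = comb_phi \<alpha> \<beta> E y"
      using eventually_at_left_real[of l x] x False l by (auto simp: comb_simps elim!: eventually_mono)
    from Lim_transform_eventually[OF lim(2) this] show ?thesis using x False by (simp add: comb_simps)
  qed
  moreover have "(comb_phi \<alpha> \<beta> E \<longlongrightarrow> comb_phi \<alpha> \<beta> E x + complex_of_real (delta_comb l A x) * comb_psi \<alpha> \<beta> E x) (at_right x)"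
    if x: "x \<in> {0..<2 * l}" for x
  proof (cases "x < l")
    case True
    have "\<forall>\<^sub>F y in at_right x. comb_phi_left \<alpha> \<beta> E y = comb_phi \<alpha> \<beta> E y"
      using eventually_at_right_real[OF True] x by (auto simp: comb_simps elim!: eventually_mono)
    from Lim_transform_eventually[OF lim(1) this] show ?thesis
      using x True l by (cases "x = 0") (auto simp: comb_simps delta_comb_period ends)
  next
    case False
    have "\<forall>\<^sub>F y in at_right x. comb_phi_right \<alpha> \<beta> E y = comb_phi \<alpha> \<beta> E y"
      using eventually_at_right_real[of x "2 * l"] x False l by (auto simp: comb_simps elim!: eventually_mono)
    from Lim_transform_eventually[OF lim(2) this] show ?thesis
      using x False l by (cases "x = l") (auto simp: comb_simps delta_comb_period ends comb_slope_def)
  qed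
  moreover have "(comb_psi \<alpha> \<beta> E has_vector_derivative comb_phi \<alpha> \<beta> E x) (at x) \<and>
      (comb_phi \<alpha> \<beta> E has_vector_derivative (complex_of_real 0 - E) * comb_psi \<alpha> \<beta> E x) (at x)"
    if x: "x \<in> {0<..<2 * l} - {l}" for x
  proof (cases "x < l")
    case True
    have "(comb_psi \<alpha> \<beta> E has_vector_derivative comb_phi_left \<alpha> \<beta> E x) (at x)"
      by (rule has_vector_derivative_transform_within_open[OF comb_deriv(1), of "{0<..<l}"])
         (use x True in \<open>auto simp: comb_simps\<close>)
    moreover have "(comb_phi \<alpha> \<beta> E has_vector_derivative - E * comb_psi_left \<alpha> \<beta> E x) (at x)"
      by (rule has_vector_derivative_transform_within_open[OF comb_deriv(2), of "{0<..<l}"])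
         (use x True in \<open>auto simp: comb_simps\<close>)
    ultimately show ?thesis using x True by (simp add: comb_simps)
  next
    case False
    have "(comb_psi \<alpha> \<beta> E has_vector_derivative comb_phi_right \<alpha> \<beta> E x) (at x)"
      by (rule has_vector_derivative_transform_within_open[OF comb_deriv(3), of "{l<..<2 * l}"])
         (use x False in \<open>auto simp: comb_simps\<close>)
    moreover have "(comb_phi \<alpha> \<beta> E has_vector_derivative - E * comb_psi_right \<alpha> \<beta> E x) (at x)"
      by (rule has_vector_derivative_transform_within_open[OF comb_deriv(4), of "{l<..<2 * l}"])
         (use x False l in \<open>auto simp: comb_simps\<close>)
    ultimately show ?thesis using x False l by (simp add: comb_simps)
  qed
  ultimately show ?thesis unfolding schroedinger_solution_def
    by (intro conjI ballI exI[of _ "{l}"]) simp_all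
qed

lemma comb_bounded:
  "\<exists>B. \<forall>E x. cmod E \<le> R \<longrightarrow> x \<in> {0..2 * l} \<longrightarrow> cmod (comb_psi \<alpha> \<beta> E x) \<le> B"
proof -
  obtain B where B: "B \<ge> 0" "\<And>E x. cmod E \<le> R \<Longrightarrow> x \<in> {0..2 * l} \<Longrightarrow> cmod (cos_energy E x) \<le> B"
    "\<And>E x. cmod E \<le> R \<Longrightarrow> x \<in> {0..2 * l} \<Longrightarrow> cmod (sin_energy E x) \<le> B"
    using cos_sin_energy_bounded by blast
  define P where "P = cmod \<alpha> * B + cmod (\<beta> - complex_of_real A * \<alpha>) * B"
  define Q where "Q = cmod \<alpha> * (\<bar>R\<bar> * B) + cmod (\<beta> - complex_of_real A * \<alpha>) * B"
  have P0: "P \<ge> 0" and Q0: "Q \<ge> 0" using B(1) by (auto simp: P_def Q_def)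
  have left: "cmod (comb_psi_left \<alpha> \<beta> E x) \<le> P" if "cmod E \<le> R" "x \<in> {0..2 * l}" for E x
    unfolding comb_psi_left_def P_def
    by (rule order_trans[OF norm_triangle_ineq]) (use that B in \<open>auto simp: norm_mult intro!: add_mono mult_left_mono\<close>)
  have phi: "cmod (comb_phi_left \<alpha> \<beta> E l) \<le> Q" if "cmod E \<le> R" for E
    unfolding comb_phi_left_def Q_def
    by (rule order_trans[OF norm_triangle_ineq])
       (use that B l in \<open>auto simp: norm_mult intro!: add_mono mult_left_mono mult_mono\<close>)
  have slope: "cmod (comb_slope \<alpha> \<beta> E) \<le> Q + \<bar>A\<bar> * P" if "cmod E \<le> R" for E
    unfolding comb_slope_def
    by (rule order_trans[OF norm_triangle_ineq])
       (use that phi left l in \<open>auto simp: norm_mult intro!: add_mono mult_left_mono\<close>)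
  have right: "cmod (comb_psi_right \<alpha> \<beta> E x) \<le> P * B + (Q + \<bar>A\<bar> * P) * B"
    if "cmod E \<le> R" "x \<in> {l..2 * l}" for E x
    unfolding comb_psi_right_def
    by (rule order_trans[OF norm_triangle_ineq])
       (use that slope left B l P0 Q0 in \<open>auto simp: norm_mult intro!: add_mono mult_mono\<close>)
  have "cmod (comb_psi \<alpha> \<beta> E x) \<le> max P (P * B + (Q + \<bar>A\<bar> * P) * B)"
    if "cmod E \<le> R" "x \<in> {0..2 * l}" for E x
    using left[OF that] right[OF that(1), of x] that(2)
    by (auto simp: comb_psi_def le_max_iff_disj)
  thus ?thesis by blast
qed

lemma comb_fundamental_family:
  "fundamental_family (\<lambda>x. 0) (delta_comb l A) (2 * l) (comb_psi 1 0) (comb_phi 1 0) (comb_psi 0 1) (comb_phi 0 1)"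
proof
  fix R
  show "\<exists>B. \<forall>E x. cmod E \<le> R \<longrightarrow> x \<in> {0..2 * l} \<longrightarrow> cmod (comb_psi 1 0 E x) \<le> B"
    "\<exists>B. \<forall>E x. cmod E \<le> R \<longrightarrow> x \<in> {0..2 * l} \<longrightarrow> cmod (comb_psi 0 1 E x) \<le> B"
    by (rule comb_bounded)+
qed (use l in \<open>simp_all add: comb_solution comb_psi_def comb_phi_def comb_psi_left_def\<close>)

text \<open>The terms linear in A cancel because the two masses of a period add up to zero, so the
  trace depends on A only through its square. Re w > 0 identifies the principal root of w^2 with
  w.\<close>

lemma comb_half_trace:
  assumes "Re w > 0"
  shows "half_trace (\<lambda>x. 0) (delta_comb l A) (2 * l) w =
    1 - (2 + (complex_of_real A)\<^sup>2 / (2 * w\<^sup>2)) * (sin (w * complex_of_real l))\<^sup>2"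
proof -
  interpret fundamental_family "\<lambda>x. 0" "delta_comb l A" "2 * l" "comb_psi 1 0" "comb_phi 1 0" "comb_psi 0 1" "comb_phi 0 1"
    by (rule comb_fundamental_family)
  have w0: "w \<noteq> 0" using assms by auto
  have sq: "csqrt (w\<^sup>2) = w" by (rule csqrt_square) (use assms in auto)
  define c where "c = cos_energy (w\<^sup>2) l"
  define s where "s = sin_energy (w\<^sup>2) l"
  have d: "discriminant (w\<^sup>2) = comb_psi_right 1 0 (w\<^sup>2) (2 * l) + comb_phi_right 0 1 (w\<^sup>2) (2 * l)"
    unfolding discriminant_def using l by (simp add: comb_simps)
  have e: "2 * l - l = l" by simp
  have "discriminant (w\<^sup>2) = 2 * c\<^sup>2 - 2 * w\<^sup>2 * s\<^sup>2 - (complex_of_real A)\<^sup>2 * s\<^sup>2"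
    unfolding d comb_psi_right_def comb_phi_right_def e comb_slope_def comb_psi_left_def comb_phi_left_def
      c_def[symmetric] s_def[symmetric]
    by (simp add: power2_eq_square algebra_simps)
  hence "half_trace (\<lambda>x. 0) (delta_comb l A) (2 * l) w =
      (2 * c\<^sup>2 - 2 * w\<^sup>2 * s\<^sup>2 - (complex_of_real A)\<^sup>2 * s\<^sup>2) / 2"
    by (simp only: half_trace_eq)
  also have "c\<^sup>2 = 1 - (sin (w * complex_of_real l))\<^sup>2"
    by (simp add: c_def cos_energy_def sq cos_squared_eq)
  also have "s = sin (w * complex_of_real l) / w"
    using w0 by (simp add: s_def sin_energy_def sq)
  also have "(2 * (1 - (sin (w * complex_of_real l))\<^sup>2) - 2 * w\<^sup>2 * (sin (w * complex_of_real l) / w)\<^sup>2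
      - (complex_of_real A)\<^sup>2 * (sin (w * complex_of_real l) / w)\<^sup>2) / 2
      = 1 - (2 + (complex_of_real A)\<^sup>2 / (2 * w\<^sup>2)) * (sin (w * complex_of_real l))\<^sup>2"
    using w0 by (simp add: field_simps power2_eq_square)
  finally show ?thesis .
qed

end

section \<open>The comb near a fixed frequency\<close>

context
  fixes l :: real and n :: nat
  assumes l: "l > 0" and n: "n \<ge> 1"
begin

definition "comb_coeff A x = 2 + A\<^sup>2 / (2 * x\<^sup>2)" for A x :: real
definition "comb_F A x = 1 - comb_coeff A x * (sin (x * l))\<^sup>2" for A x :: real
definition "comb_edge = real n * pi / l"

lemma comb_edge_pos: "comb_edge > 0"
  using l n by (simp add: comb_edge_def)

lemma comb_coeff_pos: "comb_coeff A x > 0"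
  by (simp add: comb_coeff_def add_pos_nonneg)

lemma comb_half_trace_real:
  assumes "x > 0"
  shows "half_trace (\<lambda>x. 0) (delta_comb l A) (2 * l) (complex_of_real x) = complex_of_real (comb_F A x)"
  using comb_half_trace[OF l, of "complex_of_real x" A] assms
  by (simp add: comb_F_def comb_coeff_def sin_of_real[symmetric])

lemma sin_comb_edge: "sin (comb_edge * l) = 0"
  using l by (simp add: comb_edge_def)

lemma sin_comb_edge_unique:
  assumes "\<bar>x - comb_edge\<bar> < pi / l" "sin (x * l) = 0"
  shows "x = comb_edge"
proof -
  obtain i :: int where i: "x * l = of_int i * pi" using assms(2) by (auto simp: sin_zero_iff_int2)
  have "\<bar>x * l - comb_edge * l\<bar> = \<bar>x - comb_edge\<bar> * l" using l by (simp add: abs_mult flip: left_diff_distrib)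
  also have "\<dots> < pi" using assms(1) l by (simp add: pos_less_divide_eq)
  also have "x * l - comb_edge * l = (of_int i - of_int (int n)) * pi"
    using i l by (simp add: comb_edge_def left_diff_distrib)
  finally have "\<bar>of_int (i - int n) :: real\<bar> * pi < 1 * pi" by (simp add: abs_mult)
  hence "\<bar>of_int (i - int n) :: real\<bar> < 1" by (rule mult_right_less_imp_less) simp
  hence "\<bar>i - int n\<bar> < 1" by linarith
  hence "i = int n" by simp
  thus ?thesis using i l by (simp add: comb_edge_def field_simps)
qed

text \<open>\<open>comb_F\<close> is 1 minus a positive multiple of a squared sine: it touches 1
  from below at an isolated zero of the sine, and continuity keeps it above -1 on both
  sides.\<close>

lemma comb_edge_degenerate:
  "degenerate_band_edge (half_trace (\<lambda>x. 0) (delta_comb l A) (2 * l)) comb_edge"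
proof -
  let ?F = "half_trace (\<lambda>x. 0) (delta_comb l A) (2 * l)"
  have f1: "comb_F A comb_edge = 1" by (simp add: comb_F_def sin_comb_edge)
  have "isCont (comb_F A) comb_edge"
    unfolding comb_F_def[abs_def] comb_coeff_def using comb_edge_pos by (intro continuous_intros) auto
  hence "comb_F A \<midarrow>comb_edge\<rightarrow> 1" using f1 by (simp add: isCont_def)
  hence "\<forall>\<^sub>F x in at comb_edge. comb_F A x > -1" by (rule order_tendstoD) simp
  then obtain d where d: "d > 0" "\<And>x. x \<noteq> comb_edge \<Longrightarrow> \<bar>x - comb_edge\<bar> < d \<Longrightarrow> comb_F A x > -1"
    unfolding eventually_at by (auto simp: dist_real_def)
  define \<epsilon> where "\<epsilon> = min d (min comb_edge (pi / l))"
  show ?thesis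
  proof (rule degenerate_band_edgeI[OF comb_edge_pos])
    show "cmod (?F (complex_of_real comb_edge)) = 1"
      by (simp add: comb_half_trace_real[OF comb_edge_pos] f1)
    show "\<epsilon> > 0" using d(1) comb_edge_pos l by (simp add: \<epsilon>_def)
    fix x assume x: "x \<noteq> comb_edge" "\<bar>x - comb_edge\<bar> < \<epsilon>"
    have x0: "x > 0" using x(2) by (auto simp: \<epsilon>_def)
    have "sin (x * l) \<noteq> 0" using sin_comb_edge_unique[of x] x by (auto simp: \<epsilon>_def)
    hence "comb_F A x < 1" unfolding comb_F_def using comb_coeff_pos[of A x] by simp
    moreover have "comb_F A x > -1" using d(2)[OF x(1)] x(2) by (simp add: \<epsilon>_def)
    ultimately show "cmod (?F (complex_of_real x)) < 1" by (simp add: comb_half_trace_real[OF x0])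
  qed
qed

text \<open>The factor sin (x l) is split off because the same factor sits in 1 - F^2, against which
  it will cancel.\<close>

lemma comb_F_deriv:
  assumes "x > 0"
  shows "(comb_F A has_real_derivative
    - sin (x * l) * (2 * comb_coeff A x * l * cos (x * l) - A\<^sup>2 / x ^ 3 * sin (x * l))) (at x)"
proof -
  have 1: "(comb_coeff A has_real_derivative - A\<^sup>2 / x ^ 3) (at x)"
    unfolding comb_coeff_def[abs_def] using assms
    by (auto intro!: derivative_eq_intros simp: field_simps power2_eq_square power3_eq_cube)
  have 2: "((\<lambda>x. (sin (x * l))\<^sup>2) has_real_derivative 2 * l * sin (x * l) * cos (x * l)) (at x)"
    by (auto intro!: derivative_eq_intros)
  have "((\<lambda>x. 1 - comb_coeff A x * (sin (x * l))\<^sup>2) has_real_derivative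
      0 - (- A\<^sup>2 / x ^ 3 * (sin (x * l))\<^sup>2 + 2 * l * sin (x * l) * cos (x * l) * comb_coeff A x)) (at x)"
    by (intro DERIV_diff DERIV_const DERIV_mult 1 2)
  thus ?thesis unfolding comb_F_def[abs_def]
    by (rule back_subst[of "\<lambda>d. (_ has_real_derivative d) _"]) (simp add: power2_eq_square algebra_simps)
qed

text \<open>Near the edge, \<open>|sin (x l)| < 1 / A\<close> keeps the cosine away from \<open>0\<close>, and the first term dominates.\<close>

lemma comb_slope_bound:
  assumes A: "A \<ge> 4" and x: "\<bar>x - comb_edge\<bar> < pi / (2 * l)" and s: "A * \<bar>sin (x * l)\<bar> < 1"
  shows "comb_coeff A x * l / 2 \<le> \<bar>2 * comb_coeff A x * l * cos (x * l) - A\<^sup>2 / x ^ 3 * sin (x * l)\<bar>"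
proof -
  define g where "g = comb_coeff A x"
  \<comment> \<open>Since n >= 1, the edge lies at x l >= pi, so half a spacing away x l still
    exceeds pi / 2 > 1.\<close>
  have "comb_edge * l \<ge> pi" using l n by (simp add: comb_edge_def)
  moreover have "\<bar>x - comb_edge\<bar> * l < pi / 2" using x l by (simp add: field_simps)
  moreover have "comb_edge * l - x * l \<le> \<bar>x - comb_edge\<bar> * l"
    using mult_right_mono[of "comb_edge - x" "\<bar>x - comb_edge\<bar>" l] l by (simp add: left_diff_distrib)
  ultimately have "x * l > pi / 2" by linarith
  hence xl: "x * l > 1" using pi_gt3 by linarith
  hence "0 < x * l" by simp
  hence x0: "x > 0" using l by (simp add: zero_less_mult_iff)
  have g0: "g > 0" unfolding g_def by (rule comb_coeff_pos)
  have sA: "\<bar>sin (x * l)\<bar> < 1 / A" using s A by (simp add: field_simps)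
  also have "1 / A \<le> 1 / 2" using A by (simp add: field_simps)
  finally have "\<bar>sin (x * l)\<bar>\<^sup>2 \<le> (1/2)\<^sup>2" by (intro power_mono) auto
  hence "(sin (x * l))\<^sup>2 \<le> 1/4" by (simp add: power_divide)
  hence "1/4 \<le> (cos (x * l))\<^sup>2" using sin_cos_squared_add[of "x * l"] by linarith
  hence "(1/2)\<^sup>2 \<le> (cos (x * l))\<^sup>2" by (simp add: power_divide)
  hence "\<bar>1/2\<bar> \<le> \<bar>cos (x * l)\<bar>" by (simp only: abs_le_square_iff)
  hence c: "\<bar>cos (x * l)\<bar> \<ge> 1/2" by simp
  have "g * l * 1 \<le> g * l * (2 * \<bar>cos (x * l)\<bar>)"
    using c g0 l by (intro mult_left_mono) auto
  hence 1: "g * l \<le> \<bar>2 * g * l * cos (x * l)\<bar>" using g0 l by (simp add: abs_mult)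
  have gA: "A\<^sup>2 / (2 * x\<^sup>2) \<le> g" by (simp add: g_def comb_coeff_def)
  have "\<bar>A\<^sup>2 / x ^ 3 * sin (x * l)\<bar> = A / x ^ 3 * (A * \<bar>sin (x * l)\<bar>)"
    using x0 A by (simp add: abs_mult power2_eq_square)
  also have "\<dots> \<le> A / x ^ 3 * 1" using s x0 A by (intro mult_left_mono) auto
  also have "\<dots> = A\<^sup>2 / (2 * x\<^sup>2) * (2 / (A * x))"
    using x0 A by (simp add: field_simps power2_eq_square power3_eq_cube)
  also have "\<dots> \<le> g * (l / 2)"
  proof (rule mult_mono[OF gA])
    \<comment> \<open>Here the threshold 4 is used: with x l > 1 it gives 2 / (A x) <= l / 2, so the
      second term is at most half of the lower bound g l for the first.\<close>
    have "4 * 1 \<le> A * (x * l)" using A xl by (intro mult_mono) auto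
    thus "2 / (A * x) \<le> l / 2" using x0 A by (simp add: field_simps)
  qed (use g0 x0 A in auto)
  finally have 2: "\<bar>A\<^sup>2 / x ^ 3 * sin (x * l)\<bar> \<le> g * l / 2" by simp
  show ?thesis using 1 2 unfolding g_def by linarith
qed

text \<open>In a band there are three cases. Where the sine vanishes, the second-order formula for a
  degenerate edge applies; for |F| < 1, implicit differentiation; for F = -1 the edge is
  non-degenerate and the velocity is 0 by definition. The first two share a lower bound for
  k'.\<close>

lemma comb_group_velocity:
  assumes A: "A \<ge> 4" and x: "\<bar>x - comb_edge\<bar> < pi / (2 * l)" and s: "A * \<bar>sin (x * l)\<bar> < 1"
    and band: "in_band (half_trace (\<lambda>x. 0) (delta_comb l A) (2 * l)) x"
  defines "F \<equiv> half_trace (\<lambda>x. 0) (delta_comb l A) (2 * l)"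
  shows "\<bar>group_velocity (2 * l) F x\<bar> \<le> 16 * comb_edge / A \<and>
    (nondegenerate_band_edge F x \<or> finite_group_velocity F x)"
proof -
  interpret fundamental_family "\<lambda>x. 0" "delta_comb l A" "2 * l" "comb_psi l A 1 0" "comb_phi l A 1 0"
    "comb_psi l A 0 1" "comb_phi l A 0 1"
    by (rule comb_fundamental_family[OF l])
  define k where "k = (SOME k. dispersion_relation F k)"
  have k: "dispersion_relation F k"
    unfolding k_def F_def by (rule someI_ex[OF dispersion_relation_half_trace])
  have disp: "dispersion F = (\<lambda>y. k (complex_of_real y))"
    by (simp add: dispersion_def[abs_def] k_def)
  have Fc: "continuous_on UNIV F" unfolding F_def by (rule half_trace_continuous)
  have F_real: "F (complex_of_real y) = complex_of_real (comb_F A y)" if "y > 0" for y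
    unfolding F_def by (rule comb_half_trace_real[OF that])
  have half: "pi / (2 * l) \<le> comb_edge / 2" using l n by (simp add: comb_edge_def field_simps)
  have xb: "comb_edge / 2 < x" "x < 2 * comb_edge" using x half comb_edge_pos by (auto simp: abs_less_iff)
  have x0: "x > 0" using xb(1) comb_edge_pos by simp
  define g where "g = comb_coeff A x"
  have g0: "g > 0" unfolding g_def by (rule comb_coeff_pos)
  have gA: "A\<^sup>2 / (2 * x\<^sup>2) \<le> g" by (simp add: g_def comb_coeff_def)
  \<comment> \<open>From D^2 >= g l^2 / 8 and g >= A^2 / (2 x^2) follows |D| >= A l / (4 x). Hence 2
    l / |D| is at most 8 x / A, and x < 2 \<open>comb_edge\<close> gives the constant 16.\<close>
  have concl: ?thesis if D: "(dispersion F has_vector_derivative complex_of_real D) (at x)" and D2: "g * l\<^sup>2 / 8 \<le> D\<^sup>2" for D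
  proof -
    have "(A * l / (4 * x))\<^sup>2 = A\<^sup>2 / (2 * x\<^sup>2) * (l\<^sup>2 / 8)"
      by (simp add: power_divide power_mult_distrib)
    also have "\<dots> \<le> g * (l\<^sup>2 / 8)" using gA by (intro mult_right_mono) auto
    also have "\<dots> \<le> D\<^sup>2" using D2 by simp
    finally have "\<bar>A * l / (4 * x)\<bar> \<le> \<bar>D\<bar>" by (simp only: abs_le_square_iff)
    hence Dle: "A * l / (4 * x) \<le> \<bar>D\<bar>" using A l x0 by simp
    have pos: "A * l / (4 * x) > 0" using A l x0 by simp
    hence "D \<noteq> 0" using Dle by auto
    hence fin: "finite_group_velocity F x" using D by (auto simp: finite_group_velocity_def)
    have "\<bar>2 * l / D\<bar> = 2 * l / \<bar>D\<bar>" using l by simp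
    also have "\<dots> \<le> 2 * l / (A * l / (4 * x))"
    proof (rule divide_left_mono[OF Dle])
      show "0 < \<bar>D\<bar> * (A * l / (4 * x))" using pos \<open>D \<noteq> 0\<close> by (intro mult_pos_pos) simp_all
    qed (use l in simp)
    also have "\<dots> = 8 * x / A" using l A x0 by (simp add: field_simps)
    also have "\<dots> \<le> 16 * comb_edge / A" using xb(2) A by (intro divide_right_mono) auto
    finally have "\<bar>2 * l / D\<bar> \<le> 16 * comb_edge / A" .
    moreover have "0 \<le> 16 * comb_edge / A" using comb_edge_pos A by simp
    ultimately have "\<bar>group_velocity (2 * l) F x\<bar> \<le> 16 * comb_edge / A"
      using D by (simp add: group_velocity_def vector_derivative_at)
    thus ?thesis using fin by simp
  qed
  define Q where "Q = 2 * g * l * cos (x * l) - A\<^sup>2 / x ^ 3 * sin (x * l)"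
  have Q: "g * l / 2 \<le> \<bar>Q\<bar>" unfolding Q_def g_def by (rule comb_slope_bound[OF A x s])
  have f': "(comb_F A has_real_derivative - sin (x * l) * Q) (at x)"
    unfolding Q_def g_def by (rule comb_F_deriv[OF x0])
  have Fx: "comb_F A x = 1 - g * (sin (x * l))\<^sup>2" by (simp add: comb_F_def g_def)
  have "\<bar>comb_F A x\<bar> \<le> 1" using in_band_imp(2)[OF Fc band[folded F_def]] F_real[OF x0] by simp
  then consider "sin (x * l) = 0" | "sin (x * l) \<noteq> 0" "\<bar>comb_F A x\<bar> < 1" | "sin (x * l) \<noteq> 0" "comb_F A x = -1"
  proof -
    assume "\<bar>comb_F A x\<bar> \<le> 1"
    moreover have "comb_F A x < 1" if "sin (x * l) \<noteq> 0" using that g0 by (simp add: Fx)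
    ultimately show ?thesis using that by (smt (verit))
  qed
  then show ?thesis
  proof cases
    case 1
    \<comment> \<open>Dividing the sine by w - x leaves its difference quotient, as the sine
      vanishes at x. The limit of the quotient has square l^2, so the limit of \<open>G\<close> is g
      l^2.\<close>
    define G where "G w = (2 + (complex_of_real A)\<^sup>2 / (2 * w\<^sup>2)) *
      ((sin (w * complex_of_real l) - sin (complex_of_real x * complex_of_real l)) / (w - complex_of_real x))\<^sup>2" for w
    have sx: "sin (complex_of_real x * complex_of_real l) = 0"
      using 1 by (simp add: sin_of_real flip: of_real_mult)
    have FG: "F w = 1 * (1 - (w - complex_of_real x)\<^sup>2 * G w)" if "Re w > 0" for w
      using comb_half_trace[OF l that, of A] sx
      by (cases "w = complex_of_real x") (auto simp: F_def G_def power_divide)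
    have "((\<lambda>w. sin (w * complex_of_real l)) has_field_derivative
        cos (complex_of_real x * complex_of_real l) * complex_of_real l) (at (complex_of_real x))"
      by (auto intro!: derivative_eq_intros)
    hence "((\<lambda>w. (sin (w * complex_of_real l) - sin (complex_of_real x * complex_of_real l)) / (w - complex_of_real x))
        \<longlongrightarrow> cos (complex_of_real x * complex_of_real l) * complex_of_real l) (at (complex_of_real x))"
      by (simp add: has_field_derivative_iff)
    hence "(G \<longlongrightarrow> (2 + (complex_of_real A)\<^sup>2 / (2 * (complex_of_real x)\<^sup>2)) *
        (cos (complex_of_real x * complex_of_real l) * complex_of_real l)\<^sup>2) (at (complex_of_real x))"
      unfolding G_def using x0 by (intro tendsto_intros) auto
    moreover have "(cos (complex_of_real x * complex_of_real l))\<^sup>2 = 1"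
      by (simp add: cos_squared_eq sx)
    ultimately have G: "(G \<longlongrightarrow> complex_of_real (g * l\<^sup>2)) (at (complex_of_real x))"
      by (simp add: power_mult_distrib g_def comb_coeff_def)
    have gl: "g * l\<^sup>2 > 0" using g0 l by simp
    have "((\<lambda>y. k (complex_of_real y)) has_vector_derivative complex_of_real (sqrt (2 * (g * l\<^sup>2)))) (at x)"
      by (rule dispersion_derivative_degenerate_edge[OF k x0 Fc _ FG G gl]) simp
    thus ?thesis using gl by (intro concl[of "sqrt (2 * (g * l\<^sup>2))"]) (simp_all add: disp)
  next
    case 2
    obtain D where D: "((\<lambda>y. k (complex_of_real y)) has_vector_derivative complex_of_real D) (at x)"
      "D\<^sup>2 * (1 - (comb_F A x)\<^sup>2) = (- sin (x * l) * Q)\<^sup>2"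
      using dispersion_derivative_inside_band[OF k x0 Fc F_real f' 2(2)] by blast
    define S where "S = (sin (x * l))\<^sup>2"
    have S0: "S > 0" using 2(1) by (simp add: S_def)
    have "(g * l / 2)\<^sup>2 \<le> \<bar>Q\<bar>\<^sup>2" using Q g0 l by (intro power_mono) auto
    hence "S * (g * l / 2)\<^sup>2 \<le> S * Q\<^sup>2" using S0 by simp
    also have "\<dots> = D\<^sup>2 * (1 - (comb_F A x)\<^sup>2)" unfolding D(2) by (simp add: S_def power_mult_distrib)
    \<comment> \<open>\<open>S\<close> occurs both in (F')^2 = S Q^2 and in 1 - F^2 <= 2 g S. It
      cancels, so the bound for D does not deteriorate as the edge is approached.\<close>
    also have "1 - (comb_F A x)\<^sup>2 = 2 * g * S - (g * S)\<^sup>2" by (simp add: Fx S_def power2_eq_square algebra_simps)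
    also have "D\<^sup>2 * (2 * g * S - (g * S)\<^sup>2) \<le> D\<^sup>2 * (2 * g * S)" by (intro mult_left_mono) auto
    finally have "(g * S) * (g * l\<^sup>2 / 4) \<le> (g * S) * (2 * D\<^sup>2)"
      by (simp add: power2_eq_square algebra_simps)
    hence "g * l\<^sup>2 / 4 \<le> 2 * D\<^sup>2" using g0 S0 by (simp only: mult_le_cancel_left_pos mult_pos_pos)
    thus ?thesis using D(1) by (intro concl[of D]) (simp_all add: disp)
  next
    case 3
    have "0 < g * l / 2" using g0 l by simp
    hence "- sin (x * l) * Q \<noteq> 0" using Q 3(1) by auto
    hence "nondegenerate_band_edge F x"
      using nondegenerate_band_edgeI[OF x0 F_real 3(2) f'] by blast
    thus ?thesis using comb_edge_pos A by (simp add: group_velocity_def)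
  qed
qed

end

theorem theorem6:
  fixes L \<omega>\<^sub>0 :: real
  assumes "L > 0" and "\<omega>\<^sub>0 > 0"
  shows
    "(\<forall>(v :: real \<Rightarrow> real) c.
        (\<forall>x. v (x + L) = v x) \<and> smooth_piece 0 L v \<and> c > 0 \<and> (\<forall>x\<in>{0<..<L}. v x \<ge> c) \<longrightarrow>
        (\<forall>\<^sub>F A in at_top. in_gap (half_trace (\<lambda>x. A * v x) (\<lambda>x. 0) L) \<omega>\<^sub>0)) \<and>
     (\<forall>(v :: real \<Rightarrow> real) c.
        (\<forall>x. v (x + L) = v x) \<and> smooth_piece 0 L v \<and> c > 0 \<and> (\<forall>x\<in>{0<..<L}. v x \<le> - c) \<longrightarrow>
        filterlim (\<lambda>A. group_velocity L (half_trace (\<lambda>x. A * v x) (\<lambda>x. 0) L) \<omega>\<^sub>0) at_top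
          (inf at_top
            (principal {A. degenerate_band_edge (half_trace (\<lambda>x. A * v x) (\<lambda>x. 0) L) \<omega>\<^sub>0}))) \<and>
     (\<forall>(v :: real \<Rightarrow> real) c a.
        (\<forall>x. v (x + L) = v x) \<and> 0 < a \<and> a < L \<and> smooth_piece 0 a v \<and> smooth_piece a L v \<and> c > 0 \<and>
        ((\<forall>x\<in>{0<..<a}. v x \<ge> c) \<and> (\<forall>x\<in>{a<..<L}. v x \<le> - c) \<or>
         (\<forall>x\<in>{0<..<a}. v x \<le> - c) \<and> (\<forall>x\<in>{a<..<L}. v x \<ge> c)) \<longrightarrow>
        (\<forall>\<^sub>F A in at_top. \<not> degenerate_band_edge (half_trace (\<lambda>x. A * v x) (\<lambda>x. 0) L) \<omega>\<^sub>0)) \<and>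
     (\<forall>l (n :: nat). l = L / 2 \<and> n \<ge> 1 \<longrightarrow>
        (\<forall>A>0. degenerate_band_edge (half_trace (\<lambda>x. 0) (delta_comb l A) L) (real n * pi / l)) \<and>
        (\<exists>C. \<exists>\<epsilon>>0. \<forall>\<^sub>F A in at_top. \<forall>\<omega>.
           \<bar>\<omega> - real n * pi / l\<bar> < \<epsilon> \<and> A * \<bar>sin (\<omega> * l)\<bar> < 1 \<and>
           in_band (half_trace (\<lambda>x. 0) (delta_comb l A) L) \<omega> \<longrightarrow>
             \<bar>group_velocity L (half_trace (\<lambda>x. 0) (delta_comb l A) L) \<omega>\<bar> \<le> C / A \<and>
             (nondegenerate_band_edge (half_trace (\<lambda>x. 0) (delta_comb l A) L) \<omega> \<or>
              finite_group_velocity (half_trace (\<lambda>x. 0) (delta_comb l A) L) \<omega>)))"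
proof (intro conjI)
  show "\<forall>(v :: real \<Rightarrow> real) c.
        (\<forall>x. v (x + L) = v x) \<and> smooth_piece 0 L v \<and> c > 0 \<and> (\<forall>x\<in>{0<..<L}. v x \<ge> c) \<longrightarrow>
        (\<forall>\<^sub>F A in at_top. in_gap (half_trace (\<lambda>x. A * v x) (\<lambda>x. 0) L) \<omega>\<^sub>0)"
    by (intro allI impI, elim conjE) (rule positive_potential_in_gap[OF assms], auto)
  show "\<forall>(v :: real \<Rightarrow> real) c.
        (\<forall>x. v (x + L) = v x) \<and> smooth_piece 0 L v \<and> c > 0 \<and> (\<forall>x\<in>{0<..<L}. v x \<le> - c) \<longrightarrow>
        filterlim (\<lambda>A. group_velocity L (half_trace (\<lambda>x. A * v x) (\<lambda>x. 0) L) \<omega>\<^sub>0) at_top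
          (inf at_top
            (principal {A. degenerate_band_edge (half_trace (\<lambda>x. A * v x) (\<lambda>x. 0) L) \<omega>\<^sub>0}))"
    by (intro allI impI, elim conjE) (rule negative_potential_group_velocity[OF assms], auto)
  show "\<forall>(v :: real \<Rightarrow> real) c a.
        (\<forall>x. v (x + L) = v x) \<and> 0 < a \<and> a < L \<and> smooth_piece 0 a v \<and> smooth_piece a L v \<and> c > 0 \<and>
        ((\<forall>x\<in>{0<..<a}. v x \<ge> c) \<and> (\<forall>x\<in>{a<..<L}. v x \<le> - c) \<or>
         (\<forall>x\<in>{0<..<a}. v x \<le> - c) \<and> (\<forall>x\<in>{a<..<L}. v x \<ge> c)) \<longrightarrow>
        (\<forall>\<^sub>F A in at_top. \<not> degenerate_band_edge (half_trace (\<lambda>x. A * v x) (\<lambda>x. 0) L) \<omega>\<^sub>0)"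
  proof (intro allI impI, elim conjE)
    fix v :: "real \<Rightarrow> real" and c a
    assume "0 < a" "a < L" "smooth_piece 0 a v" "smooth_piece a L v" "c > 0"
      "(\<forall>x\<in>{0<..<a}. v x \<ge> c) \<and> (\<forall>x\<in>{a<..<L}. v x \<le> - c) \<or>
         (\<forall>x\<in>{0<..<a}. v x \<le> - c) \<and> (\<forall>x\<in>{a<..<L}. v x \<ge> c)"
    thus "\<forall>\<^sub>F A in at_top. \<not> degenerate_band_edge (half_trace (\<lambda>x. A * v x) (\<lambda>x. 0) L) \<omega>\<^sub>0"
      by (rule sign_changing_potential_not_degenerate[OF assms(2)])
  qed
  show "\<forall>l (n :: nat). l = L / 2 \<and> n \<ge> 1 \<longrightarrow>
        (\<forall>A>0. degenerate_band_edge (half_trace (\<lambda>x. 0) (delta_comb l A) L) (real n * pi / l)) \<and>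
        (\<exists>C. \<exists>\<epsilon>>0. \<forall>\<^sub>F A in at_top. \<forall>\<omega>.
           \<bar>\<omega> - real n * pi / l\<bar> < \<epsilon> \<and> A * \<bar>sin (\<omega> * l)\<bar> < 1 \<and>
           in_band (half_trace (\<lambda>x. 0) (delta_comb l A) L) \<omega> \<longrightarrow>
             \<bar>group_velocity L (half_trace (\<lambda>x. 0) (delta_comb l A) L) \<omega>\<bar> \<le> C / A \<and>
             (nondegenerate_band_edge (half_trace (\<lambda>x. 0) (delta_comb l A) L) \<omega> \<or>
              finite_group_velocity (half_trace (\<lambda>x. 0) (delta_comb l A) L) \<omega>))"
  proof (intro allI impI, elim conjE)
    fix l :: real and n :: nat
    assume lL: "l = L / 2" and n: "n \<ge> 1"
    have l: "l > 0" using lL assms by simp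
    have L2: "L = 2 * l" using lL by simp
    have "degenerate_band_edge (half_trace (\<lambda>x. 0) (delta_comb l A) L) (real n * pi / l)" for A
      using comb_edge_degenerate[OF l n] by (simp add: L2 comb_edge_def[OF l n])
    \<comment> \<open>The radius is half the distance between consecutive edges; like the constant
      16 n pi / l and the threshold 4, it does not depend on A.\<close>
    moreover have "pi / (2 * l) > 0" using l by simp
    moreover have "\<forall>\<^sub>F A in at_top. \<forall>\<omega>.
           \<bar>\<omega> - real n * pi / l\<bar> < pi / (2 * l) \<and> A * \<bar>sin (\<omega> * l)\<bar> < 1 \<and>
           in_band (half_trace (\<lambda>x. 0) (delta_comb l A) L) \<omega> \<longrightarrow>
             \<bar>group_velocity L (half_trace (\<lambda>x. 0) (delta_comb l A) L) \<omega>\<bar> \<le> 16 * (real n * pi / l) / A \<and>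
             (nondegenerate_band_edge (half_trace (\<lambda>x. 0) (delta_comb l A) L) \<omega> \<or>
              finite_group_velocity (half_trace (\<lambda>x. 0) (delta_comb l A) L) \<omega>)"
      using eventually_ge_at_top[of 4]
    proof eventually_elim
      case (elim A)
      show ?case
        using comb_group_velocity[OF l n elim] unfolding L2 comb_edge_def[OF l n] by blast
    qed
    ultimately show "(\<forall>A>0. degenerate_band_edge (half_trace (\<lambda>x. 0) (delta_comb l A) L) (real n * pi / l)) \<and>
        (\<exists>C. \<exists>\<epsilon>>0. \<forall>\<^sub>F A in at_top. \<forall>\<omega>.
           \<bar>\<omega> - real n * pi / l\<bar> < \<epsilon> \<and> A * \<bar>sin (\<omega> * l)\<bar> < 1 \<and>
           in_band (half_trace (\<lambda>x. 0) (delta_comb l A) L) \<omega> \<longrightarrow>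
             \<bar>group_velocity L (half_trace (\<lambda>x. 0) (delta_comb l A) L) \<omega>\<bar> \<le> C / A \<and>
             (nondegenerate_band_edge (half_trace (\<lambda>x. 0) (delta_comb l A) L) \<omega> \<or>
              finite_group_velocity (half_trace (\<lambda>x. 0) (delta_comb l A) L) \<omega>))"
      by blast
  qed
qed

end
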